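(* Let $\mathcal M\subset\binom{[n]}{k}$ be a positroid, $r\ge1$, and $\lambda$ with $0\le\lambda_i\le r$, $\sum\lambda_i=kr$. Then $$\mathcal W_\lambda(U)(\mathcal M):=\{x\in\mathcal W_\lambda(U):\ x|_{I\mapsto E_r}=0\text{ for all }I\in\tbinom{[n]}{k}\setminus\mathcal M\}$$ equals the annihilator $(\mathfrak I(\mathcal M)_\lambda)^\perp=\{x\in\mathcal W_\lambda(U):\langle x,f\rangle=0\ \forall f\in\mathfrak I(\mathcal M)_\lambda\}$. In particular $\dim\mathcal W_\lambda(U)(\mathcal M)=\dim\mathbb C[\Pi_{\mathcal M}]_\lambda$.
   Context: $\mathrm{Gr}(k,n)$ with Plücker coordinates $\Delta_I$, $I\in\binom{[n]}k$; $\mathbb C[\mathrm{Gr}(k,n)]_\lambda$ is the span of products $\Delta_{I_1}\cdots\Delta_{I_r}$ with multiset union $I_1\cup\cdots\cup I_r=\{1^{\lambda_1},\dots,n^{\lambda_n}\}$. A positroid is the matroid $\{I:\Delta_I(x)\ne0\}$ of a point $x$ of the totally nonnegative Grassmannian (points representable by real $k\times n$ matrices with all maximal minors $\ge0$); $\Pi_{\mathcal M}$ is the closure of the set of points with matroid $\mathcal M$; $\mathfrak I(\mathcal M)$ is the ideal of $\mathbb C[\mathrm{Gr}(k,n)]$ generated by $\{\Delta_I:I\notin\mathcal M\}$, and $\mathbb C[\Pi_{\mathcal M}]=\mathbb C[\mathrm{Gr}(k,n)]/\mathfrak I(\mathcal M)$ with induced grading. $U=\mathbb C^r$ with basis $E_1,\dots,E_r$,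 $E_1\wedge\cdots\wedge E_r=1$; $\mathcal W_\lambda(U)=\mathrm{Hom}_{SL(U)}(\bigotimes_i\bigwedge^{\lambda_i}U,\mathbb C)$. For a list $\mathcal S=(S_1,\dots,S_n)$, $S_j\subset[r]$, $|S_j|=\lambda_j$, with multiset union $\{1^k,\dots,r^k\}$, let $E_{\mathcal S}=E_{S_1}\otimes\cdots\otimes E_{S_n}$ ($E_S$ = increasing wedge), $\mathrm{sign}(\mathcal S)$ = parity of inversions of the word listing $S_1$ increasingly, then $S_2$, etc., and the dual list $I_i=\{j:i\in S_j\}$. The pairing $\langle\cdot,\cdot\rangle:\mathcal W_\lambda(U)\times\mathbb C[\mathrm{Gr}(k,n)]_\lambda\to\mathbb C$ is the (well-defined, perfect) bilinear pairing with $\langle x,\Delta_{I_1}\cdots\Delta_{I_r}\rangle=\mathrm{sign}(\mathcal S)\,x(E_{\mathcal S})$ for every such $\mathcal S$ with dual list $(I_1,\dots,I_r)$. Partial evaluation: let $U'=\mathrm{span}(E_1,\dots,E_{r-1})$. For $I\in\binom{[n]}k$ with $\lambda_i\ge1$ for all $i\in I$, set $\mu_i=\lambda_i-1$ for $i\in I$, $\mu_i=\lambda_i$ otherwise, and define $x|_{I\mapsto E_r}\in\mathrm{Hom}(\bigotimes_i\bigwedge^{\mu_i}U',\mathbb C)$ (an $SL(U')$-invariant) by $x|_{I\mapsto E_r}(y_1\otimes\cdots\otimes y_n)=x(z_1\otimes\cdots\otimes z_n)$ with $z_i=y_i\wedge E_r$ for $i\in I$ and $z_i=y_i$ otherwise;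 if $\lambda_i=0$ for some $i\in I$, set $x|_{I\mapsto E_r}=0$. *)

theory Defs
  imports Main "HOL-Library.Function_Algebras" "Jordan_Normal_Form.Determinant" "Jordan_Normal_Form.DL_Submatrix"
begin

text \<open>Conventions: indices are 0-based: [n] = {0..<n}, [r] = {0..<r}; the
basis vector E_r of the paper is the index r-1. A list S = (S_1,...,S_n) is a
function S :: nat => nat set (normalised to be empty outside {0..<n}).\<close>

definition fscale :: "complex \<Rightarrow> ('a \<Rightarrow> complex) \<Rightarrow> ('a \<Rightarrow> complex)" where
  "fscale c f = (\<lambda>a. c * f a)"

abbreviation fspan :: "('a \<Rightarrow> complex) set \<Rightarrow> ('a \<Rightarrow> complex) set" where
  "fspan \<equiv> module.span fscale"

abbreviation fdim :: "('a \<Rightarrow> complex) set \<Rightarrow> nat" where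
  "fdim \<equiv> vector_space.dim fscale"

definition ksubsets :: "nat \<Rightarrow> nat \<Rightarrow> nat set set" where
  "ksubsets k n = {I. I \<subseteq> {0..<n} \<and> card I = k}"

definition pl :: "nat \<Rightarrow> nat set \<Rightarrow> 'a::comm_ring_1 mat \<Rightarrow> 'a" where
  "pl k I A = det (submatrix A {0..<k} I)"

definition positroid :: "nat \<Rightarrow> nat \<Rightarrow> nat set set \<Rightarrow> bool" where
  "positroid k n M \<longleftrightarrow> (\<exists>A :: real mat. A \<in> carrier_mat k n
      \<and> (\<forall>I\<in>ksubsets k n. pl k I A \<ge> 0)
      \<and> (\<exists>I\<in>ksubsets k n. pl k I A \<noteq> 0)
      \<and> M = {I \<in> ksubsets k n. pl k I A \<noteq> 0})"

text \<open>Product of Plucker coordinates, as a polynomial function on complex k x n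
matrices (the coordinate ring of the affine cone over Gr(k,n)).\<close>
definition plprod :: "nat \<Rightarrow> nat \<Rightarrow> nat set list \<Rightarrow> complex mat \<Rightarrow> complex" where
  "plprod k n Is = (\<lambda>A. if A \<in> carrier_mat k n then (\<Prod>I\<leftarrow>Is. pl k I A) else 0)"

definition plucker_ring :: "nat \<Rightarrow> nat \<Rightarrow> (complex mat \<Rightarrow> complex) set" where
  "plucker_ring k n = fspan {plprod k n Is | Is. set Is \<subseteq> ksubsets k n}"

definition of_degree :: "nat \<Rightarrow> nat \<Rightarrow> (nat \<Rightarrow> nat) \<Rightarrow> nat set list \<Rightarrow> bool" where
  "of_degree k n lam Is \<longleftrightarrow> set Is \<subseteq> ksubsets k n
      \<and> (\<forall>i<n. length (filter (\<lambda>I. i \<in> I) Is) = lam i)"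

definition ring_deg :: "nat \<Rightarrow> nat \<Rightarrow> (nat \<Rightarrow> nat) \<Rightarrow> (complex mat \<Rightarrow> complex) set" where
  "ring_deg k n lam = fspan {plprod k n Is | Is. of_degree k n lam Is}"

definition pideal :: "nat \<Rightarrow> nat \<Rightarrow> nat set set \<Rightarrow> (complex mat \<Rightarrow> complex) set" where
  "pideal k n M = fspan {(\<lambda>A. plprod k n [J] A * g A) | J g.
       J \<in> ksubsets k n \<and> J \<notin> M \<and> g \<in> plucker_ring k n}"

definition pideal_deg :: "nat \<Rightarrow> nat \<Rightarrow> nat set set \<Rightarrow> (nat \<Rightarrow> nat) \<Rightarrow> (complex mat \<Rightarrow> complex) set" where
  "pideal_deg k n M lam = pideal k n M \<inter> ring_deg k n lam"

text \<open>dim C[Pi_M]_lambda = dim (C[Gr]_lambda / I(M)_lambda).\<close>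
definition positroid_ring_deg_dim :: "nat \<Rightarrow> nat \<Rightarrow> nat set set \<Rightarrow> (nat \<Rightarrow> nat) \<Rightarrow> nat" where
  "positroid_ring_deg_dim k n M lam = fdim (ring_deg k n lam) - fdim (pideal_deg k n M lam)"

text \<open>Index lists S of basis tensors E_{S_1} (x) ... (x) E_{S_n} of
(x)_i wedge^{lambda_i} C^r.\<close>
definition validS :: "nat \<Rightarrow> nat \<Rightarrow> (nat \<Rightarrow> nat) \<Rightarrow> (nat \<Rightarrow> nat set) \<Rightarrow> bool" where
  "validS n r lam S \<longleftrightarrow> (\<forall>j<n. S j \<subseteq> {0..<r} \<and> card (S j) = lam j) \<and> (\<forall>j\<ge>n. S j = {})"

text \<open>A linear functional on the tensor product is represented by its values
on basis tensors (zero on invalid index lists). SL(U)-invariance: for g in SL_r,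
x(g . E_S) = x(E_S), where g . E_S = (x)_j sum_T det(g[T,S_j]) E_T.\<close>
definition Wspace :: "nat \<Rightarrow> nat \<Rightarrow> (nat \<Rightarrow> nat) \<Rightarrow> ((nat \<Rightarrow> nat set) \<Rightarrow> complex) set" where
  "Wspace n r lam = {x. (\<forall>S. \<not> validS n r lam S \<longrightarrow> x S = 0)
     \<and> (\<forall>g \<in> carrier_mat r r. det g = 1 \<longrightarrow> (\<forall>S. validS n r lam S \<longrightarrow>
          (\<Sum>T\<in>{T. validS n r lam T}. x T * (\<Prod>j<n. det (submatrix g (T j) (S j)))) = x S))}"

definition Sword :: "nat \<Rightarrow> (nat \<Rightarrow> nat set) \<Rightarrow> nat list" where
  "Sword n S = concat (map (\<lambda>j. sorted_list_of_set (S j)) [0..<n])"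

definition inversions :: "nat list \<Rightarrow> nat" where
  "inversions w = card {(a, b). a < b \<and> b < length w \<and> w ! a > w ! b}"

definition signS :: "nat \<Rightarrow> (nat \<Rightarrow> nat set) \<Rightarrow> complex" where
  "signS n S = (-1) ^ inversions (Sword n S)"

definition dualS :: "nat \<Rightarrow> nat set list \<Rightarrow> (nat \<Rightarrow> nat set)" where
  "dualS n Is = (\<lambda>j. if j < n then {i. i < length Is \<and> j \<in> Is ! i} else {})"

text \<open>The pairing: bilinear, with <x, Delta_{I_1}...Delta_{I_r}> = sign(S) x(E_S).
It is defined through any representation of f as a combination of degree lambda
products (well-definedness is the statement from the context).\<close>
definition pairing :: "nat \<Rightarrow> nat \<Rightarrow> (nat \<Rightarrow> nat) \<Rightarrow> ((nat \<Rightarrow> nat set) \<Rightarrow> complex)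
     \<Rightarrow> (complex mat \<Rightarrow> complex) \<Rightarrow> complex" where
  "pairing k n lam x f = (SOME c. \<exists>fs :: (complex \<times> nat set list) list.
      (\<forall>(a, Is) \<in> set fs. of_degree k n lam Is)
      \<and> f = (\<lambda>A. \<Sum>(a, Is)\<leftarrow>fs. a * plprod k n Is A)
      \<and> c = (\<Sum>(a, Is)\<leftarrow>fs. a * signS n (dualS n Is) * x (dualS n Is)))"

definition annihilator :: "nat \<Rightarrow> nat \<Rightarrow> nat \<Rightarrow> (nat \<Rightarrow> nat) \<Rightarrow> nat set set
     \<Rightarrow> ((nat \<Rightarrow> nat set) \<Rightarrow> complex) set" where
  "annihilator k n r lam M = {x \<in> Wspace n r lam. \<forall>f \<in> pideal_deg k n M lam. pairing k n lam x f = 0}"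

text \<open>x|_{I -> E_r}, as a functional on the basis tensors of
(x)_i wedge^{mu_i} U' with U' = span(E_0..E_{r-2}).\<close>
definition peval :: "nat \<Rightarrow> nat \<Rightarrow> (nat \<Rightarrow> nat) \<Rightarrow> ((nat \<Rightarrow> nat set) \<Rightarrow> complex)
     \<Rightarrow> nat set \<Rightarrow> ((nat \<Rightarrow> nat set) \<Rightarrow> complex)" where
  "peval n r lam x I =
     (if \<exists>i\<in>I. lam i = 0 then (\<lambda>T. 0)
      else (\<lambda>T. if validS n (r - 1) (\<lambda>j. if j \<in> I then lam j - 1 else lam j) T
                then x (\<lambda>j. if j \<in> I then insert (r - 1) (T j) else T j) else 0))"

definition WspaceM :: "nat \<Rightarrow> nat \<Rightarrow> nat \<Rightarrow> (nat \<Rightarrow> nat) \<Rightarrow> nat set set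
     \<Rightarrow> ((nat \<Rightarrow> nat set) \<Rightarrow> complex) set" where
  "WspaceM k n r lam M = {x \<in> Wspace n r lam.
      \<forall>I \<in> ksubsets k n - M. peval n r lam x I = (\<lambda>T. 0)}"

end

theory Submission
  imports Defs "Jordan_Normal_Form.Char_Poly"
begin

text \<open>A \<open>k \<times> n\<close> matrix \<open>A\<close> with columns \<open>a\<^sub>j\<close> defines an invariant \<open>x\<^sub>A\<close>: send
\<open>u\<^sub>1 \<otimes> u\<^sub>2 \<otimes> \<dots>\<close> to the determinant of the vectors \<open>u\<^sub>p \<otimes> a\<^sub>j\<close> of \<open>\<complex>\<^sup>r \<otimes> \<complex>\<^sup>k\<close>, where \<open>j\<close> is the block of
position \<open>p\<close>. Sorting rows gives \<open>x\<^sub>A(E\<^sub>S) = sign(S) \<Delta>(A)\<close> with \<open>\<Delta>\<close> the product of the dual minors,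
so the pairing of \<open>x\<^sub>A\<close> with \<open>f\<close> is \<open>f(A)\<close>, and everything follows once the \<open>x\<^sub>A\<close> span the invariants.

For the spanning, fix the invariant \<open>D\<close> of standard columns. Invariance of \<open>x\<close> and \<open>D\<close> under \<open>SL\<close> gives a polynomial
identity in all \<open>r \<times> r\<close> matrices \<open>g\<close> (by scaling and density), and polarisation turns every symmetric
function of the index pairs of \<open>g\<close> into a combination of evaluations. Applied to the Gram kernel
\<open>\<Sum>\<^sub>l D\<^sub>l(w) D\<^sub>l(v)\<close>, this writes \<open>x\<close> as a combination of the \<open>D\<^sub>l\<close>, with a
coefficient that is nonzero because the \<open>D\<^sub>l\<close> are real; a second polarisation inside the blocks produces the \<open>x\<^sub>A\<close>.

With \<open>E\<^sub>r\<close> placed last, partial evaluation at \<open>I\<close> reads off the coordinates dual to the products containing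
\<open>\<Delta>\<^sub>I\<close>, which span the graded piece of the ideal.\<close>

section \<open>Signs of permutations and block determinants\<close>

text \<open>Invariance is given for determinant 1 only, while polarisation needs an identity between
  forms of one fixed degree in free matrix entries. A general g acts on invariants by det(g)^k, and
  the fixed invariant \<open>D\<close> serves to eliminate this factor: D(v) (g x)(S) = x(S) (g
  D)(v), where both sides are sums of products of exactly r k entries of g. Such a product is
  recorded by its r k index pairs, so any function of the pairs that ignores their order may replace
  it.

  The Gram kernel qualifies because permuting positions changes both of its factors by the same
  sign. It is also a sum of products of a function of the row letters and a function of the column
  letters, which separates \<open>x\<close> from \<open>S\<close>; this replaces averaging over a
  compact group.

  Two smaller obstacles remain. The graded piece of the ideal is defined as an intersection, so
  homogeneous generators have to be extracted; scaling one column at a time does this. For the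
  dimension, every functional on the graded ring is a combination of evaluations, hence a pairing
  with an invariant, and a nonzero coordinate of an invariant can only sit at a list dual to a
  product.\<close>

definition inv_pairs :: "nat \<Rightarrow> (nat \<Rightarrow> nat) \<Rightarrow> (nat \<times> nat) set" where
  "inv_pairs m p = {(a, b). a < b \<and> b < m \<and> p a > p b}"

text \<open>Two-element sets instead of ordered pairs let a permutation act on the index set of the
  product of these signs, which makes that product multiplicative.\<close>

definition pair_sign :: "(nat \<Rightarrow> nat) \<Rightarrow> nat set \<Rightarrow> int" where
  "pair_sign p e = (if p (Min e) > p (Max e) then -1 else 1)"

lemma card_2_nat:
  fixes e :: "nat set"
  assumes "card e = 2"
  obtains a b where "e = {a, b}" "a < b"
proof -
  obtain a b where ab: "e = {a, b}" "a \<noteq> b"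
    using assms by (auto simp: card_2_iff)
  then consider "a < b" | "b < a" by linarith
  then show thesis using that[of a b] that[of b a] ab by cases (auto simp: insert_commute)
qed

lemma pair_sign_compose:
  assumes "card e = 2" "inj t" "inj p"
  shows "pair_sign (p \<circ> t) e = pair_sign p (t ` e) * pair_sign t e"
proof -
  obtain a b where e: "e = {a, b}" "a < b"
    using assms(1) by (rule card_2_nat)
  have "t a \<noteq> t b" "p (t a) \<noteq> p (t b)" using e assms by (auto dest: injD)
  then show ?thesis using e unfolding pair_sign_def by (auto simp: min_def max_def)
qed

lemma prod_pair_sign:
  "(\<Prod>e\<in>{e. e \<subseteq> {0..<m} \<and> card e = 2}. pair_sign p e) = (-1) ^ card (inv_pairs m p)"
proof -
  let ?E = "{e. e \<subseteq> {0..<m} \<and> card e = 2}"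
  let ?F = "{(a, b). a < b \<and> b < m}"
  have fin: "finite ?F" by (rule finite_subset[of _ "{..<m} \<times> {..<m}"]) auto
  have bij: "bij_betw (\<lambda>(a, b). {a, b}) ?F ?E"
  proof (rule bij_betwI')
    fix x y assume "x \<in> ?F" "y \<in> ?F"
    then show "((case x of (a, b) \<Rightarrow> {a, b}) = (case y of (a, b) \<Rightarrow> {a, b})) = (x = y)"
      by (auto simp: doubleton_eq_iff)
  next
    fix x assume "x \<in> ?F" then show "(case x of (a, b) \<Rightarrow> {a, b}) \<in> ?E" by auto
  next
    fix e assume e: "e \<in> ?E"
    then obtain a b where ab: "e = {a, b}" "a < b"
      using card_2_nat by blast
    then show "\<exists>x\<in>?F. e = (case x of (a, b) \<Rightarrow> {a, b})" using e by (intro bexI[of _ "(a, b)"]) auto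
  qed
  have "(\<Prod>e\<in>?E. pair_sign p e) = (\<Prod>(a,b)\<in>?F. if p a > p b then -1 else 1)"
    unfolding prod.reindex_bij_betw[OF bij, symmetric]
    by (rule prod.cong) (auto simp: pair_sign_def min_def max_def)
  also have "\<dots> = (\<Prod>x\<in>{x\<in>?F. p (fst x) > p (snd x)}. -1)"
    by (subst prod.inter_filter[OF fin]) (auto intro!: prod.cong)
  also have "{x\<in>?F. p (fst x) > p (snd x)} = inv_pairs m p"
    unfolding inv_pairs_def by auto
  finally show ?thesis by simp
qed

text \<open>Besides (a, b), every c strictly between contributes the two inversions (a, c) and (c,
  b); what matters later is that the count is odd.\<close>

lemma card_inv_pairs_transpose:
  assumes "a < b" "b < m"
  shows "card (inv_pairs m (transpose a b)) = 2 * (b - a - 1) + 1"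
proof -
  have *: "inv_pairs m (transpose a b) =
      insert (a, b) ((\<lambda>c. (a, c)) ` {a<..<b} \<union> (\<lambda>c. (c, b)) ` {a<..<b})"
    using assms unfolding inv_pairs_def transpose_def by (auto split: if_splits)
  show ?thesis unfolding *
    by (subst card_insert_disjoint; (subst card_Un_disjoint)?) (auto simp: card_image inj_on_def)
qed

text \<open>Bridge between the library sign, which determinants use, and the inversion count in
  \<open>signS\<close>. Composing with a transposition multiplies the product of pair signs by that
  of the transposition, which is -1.\<close>

lemma sign_eq_inv_pairs:
  assumes "p permutes {0..<m}"
  shows "sign p = (-1) ^ card (inv_pairs m p)"
  using assms finite_atLeastLessThan
proof (induction rule: permutes_induct)
  case id
  have "inv_pairs m id = {}" by (auto simp: inv_pairs_def)
  then show ?case by (simp add: id_def)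
next
  case (swap a b p)
  let ?E = "{e. e \<subseteq> {0..<m} \<and> card e = 2}"
  have inj: "inj p" using swap.hyps permutes_inj by blast
  \<comment> \<open>Since the permutation acts on the two-element subsets, the factors coming from
    the transposition can be reindexed to run over all pairs.\<close>
  have "bij_betw ((`) p) ?E ?E"
  proof (rule bij_betwI[where g = "(`) (Hilbert_Choice.inv p)"])
    show "(`) p \<in> ?E \<rightarrow> ?E"
      using swap.hyps(4) inj permutes_image[OF swap.hyps(4)]
      by (auto simp: card_image inj_on_subset)
    have ip: "Hilbert_Choice.inv p permutes {0..<m}" using permutes_inv[OF swap.hyps(4)] .
    show "(`) (Hilbert_Choice.inv p) \<in> ?E \<rightarrow> ?E"
      using permutes_inj[OF ip] permutes_image[OF ip]
      by (auto simp: card_image inj_on_subset)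
    show "Hilbert_Choice.inv p ` p ` x = x" for x
      using inj by (simp add: image_comp)
    show "p ` Hilbert_Choice.inv p ` x = x" for x
      using permutes_surj[OF swap.hyps(4)] by (simp add: image_comp surj_iff)
  qed
  note bij = this
  have "(-1) ^ card (inv_pairs m (transpose a b \<circ> p))
      = (\<Prod>e\<in>?E. pair_sign (transpose a b) (p ` e) * pair_sign p e)"
    unfolding prod_pair_sign[symmetric] using inj by (intro prod.cong) (auto simp: pair_sign_compose)
  also have "\<dots> = (\<Prod>e\<in>?E. pair_sign (transpose a b) e) * (\<Prod>e\<in>?E. pair_sign p e)"
    unfolding prod.distrib using prod.reindex_bij_betw[OF bij, of "pair_sign (transpose a b)"] by simp
  also have "\<dots> = (-1) ^ card (inv_pairs m (transpose a b)) * sign p"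
    unfolding prod_pair_sign using swap by simp
  also have "(-1) ^ card (inv_pairs m (transpose a b)) = (-1 :: int)"
  proof (cases "a < b")
    case True
    then show ?thesis using card_inv_pairs_transpose[of a b m] swap.hyps by simp
  next
    case False
    then have "b < a" using swap.hyps by auto
    then show ?thesis using card_inv_pairs_transpose[of b a m] swap.hyps
      by (simp add: transpose_commute)
  qed
  also have "(-1) * sign p = sign (transpose a b \<circ> p)"
    using swap.hyps by (subst sign_compose) (auto simp: sign_swap_id permutation_swap_id intro: permutation_permutes[THEN iffD2])
  finally show ?case by (simp add: o_def)
qed

lemma det_block_diag2:
  assumes "\<And>i j. i < na \<Longrightarrow> j < na \<Longrightarrow> f (i, j) = g (i, j)"
    and "\<And>i j. i < nb \<Longrightarrow> j < nb \<Longrightarrow> f (na + i, na + j) = h (i, j)"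
    and "\<And>i j. i < na \<Longrightarrow> j < nb \<Longrightarrow> f (i, na + j) = 0"
    and "\<And>i j. i < nb \<Longrightarrow> j < na \<Longrightarrow> f (na + i, j) = 0"
  shows "det (mat (na + nb) (na + nb) f) = det (mat na na g) * det (mat nb nb h :: 'a :: idom mat)"
proof -
  have *: "mat (na + nb) (na + nb) f
      = four_block_mat (mat na na g) (0\<^sub>m na nb) (0\<^sub>m nb na) (mat nb nb h)"
  proof (rule eq_matI)
    fix i j assume ij: "i < dim_row (four_block_mat (mat na na g) (0\<^sub>m na nb) (0\<^sub>m nb na) (mat nb nb h))"
      "j < dim_col (four_block_mat (mat na na g) (0\<^sub>m na nb) (0\<^sub>m nb na) (mat nb nb h))"
    show "mat (na + nb) (na + nb) f $$ (i, j)
      = four_block_mat (mat na na g) (0\<^sub>m na nb) (0\<^sub>m nb na) (mat nb nb h) $$ (i, j)"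
      using ij assms(1)[of i j] assms(2)[of "i - na" "j - na"]
        assms(3)[of i "j - na"] assms(4)[of "i - na" j] by auto
  qed auto
  show ?thesis unfolding * by (rule det_four_block_mat_upper_right_zero[where n = na and m = nb]) auto
qed

lemma det_block_diag:
  fixes f :: "nat \<Rightarrow> nat \<Rightarrow> nat \<Rightarrow> 'a :: idom"
  assumes "k > 0"
  shows "det (mat (r * k) (r * k) (\<lambda>(p, q). if p div k = q div k then f (p div k) (p mod k) (q mod k) else 0))
    = (\<Prod>i<r. det (mat k k (\<lambda>(a, b). f i a b)))"
proof (induction r)
  case 0
  show ?case by (simp add: det_def)
next
  case (Suc r)
  have lt: "(i div k = r) = False" "(r = i div k) = False" if "i < r * k" for i
    using less_mult_imp_div_less[OF that] by auto
  have "Suc r * k = r * k + k" by simp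
  then show ?case unfolding \<open>Suc r * k = r * k + k\<close> prod.lessThan_Suc Suc.IH[symmetric]
    by (subst det_block_diag2[where na = "r * k" and nb = k
          and g = "\<lambda>(p, q). if p div k = q div k then f (p div k) (p mod k) (q mod k) else 0"
          and h = "\<lambda>(a, b). f r a b"])
      (use assms in \<open>auto simp: lt\<close>)
qed

section \<open>Determinants of tensor rows\<close>

abbreviation words :: "nat \<Rightarrow> nat \<Rightarrow> (nat \<Rightarrow> nat) set" where
  "words m s \<equiv> {0..<m} \<rightarrow>\<^sub>E {0..<s}"

lemma permutes_lt: "\<sigma> permutes {0..<m} \<Longrightarrow> p < m \<Longrightarrow> \<sigma> p < (m :: nat)"
  using permutes_in_image[of \<sigma> "{0..<m}" p] by simp

lemma finite_words [simp]: "finite (words m s)"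
  by (simp add: finite_PiE)

text \<open>Multilinearity in all rows at once. It serves twice: to expand the vectors of a row in
  the standard basis, and to let a matrix act on the letters.\<close>

lemma det_expand_rows:
  fixes c :: "nat \<Rightarrow> nat \<Rightarrow> 'a :: comm_ring_1"
  shows "det (mat m m (\<lambda>(p, q). \<Sum>b\<in>{0..<s}. c p b * F p b q))
    = (\<Sum>w\<in>words m s. (\<Prod>p=0..<m. c p (w p)) * det (mat m m (\<lambda>(p, q). F p (w p) q)))"
proof -
  have "det (mat m m (\<lambda>(p, q). \<Sum>b\<in>{0..<s}. c p b * F p b q))
      = (\<Sum>\<sigma> | \<sigma> permutes {0..<m}. signof \<sigma> * (\<Prod>p=0..<m. \<Sum>b\<in>{0..<s}. c p b * F p b (\<sigma> p)))"
    by (subst det_def'[of _ m]) (auto intro!: sum.cong prod.cong simp: permutes_lt)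
  also have "\<dots> = (\<Sum>\<sigma> | \<sigma> permutes {0..<m}. signof \<sigma> *
      (\<Sum>w\<in>words m s. (\<Prod>p=0..<m. c p (w p)) * (\<Prod>p=0..<m. F p (w p) (\<sigma> p))))"
    by (subst prod_sum_PiE) (auto simp: prod.distrib)
  also have "\<dots> = (\<Sum>w\<in>words m s. (\<Prod>p=0..<m. c p (w p)) *
      (\<Sum>\<sigma> | \<sigma> permutes {0..<m}. signof \<sigma> * (\<Prod>p=0..<m. F p (w p) (\<sigma> p))))"
    unfolding sum_distrib_left by (subst sum.swap) (simp add: mult_ac)
  also have "\<dots> = (\<Sum>w\<in>words m s. (\<Prod>p=0..<m. c p (w p)) * det (mat m m (\<lambda>(p, q). F p (w p) q)))"
    by (intro sum.cong refl arg_cong2[where f = "(*)"], subst det_def'[of _ m])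
      (auto intro!: sum.cong prod.cong simp: permutes_lt)
  finally show ?thesis .
qed

lemma det_permute_rows_cols:
  fixes M :: "'a :: comm_ring_1 mat"
  assumes M: "M \<in> carrier_mat n n" and p: "p permutes {0..<n}"
  shows "det (mat n n (\<lambda>(i, j). M $$ (p i, p j))) = det M"
proof -
  let ?A = "mat n n (\<lambda>(i, j). M $$ (i, p j))"
  have lt: "p i < n" if "i < n" for i using permutes_lt[OF p] that by auto
  have "mat n n (\<lambda>(i, j). M $$ (p i, p j)) = mat n n (\<lambda>(i, j). ?A $$ (p i, j))"
    by (rule eq_matI) (auto simp: lt)
  then have "det (mat n n (\<lambda>(i, j). M $$ (p i, p j))) = signof p * det ?A"
    using det_permute_rows[of ?A n p] p by simp
  also have "det ?A = det (mat n n (\<lambda>(i, j). transpose_mat M $$ (p i, j)))"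
    by (subst det_transpose[of ?A n, symmetric]) (use M in \<open>auto intro!: arg_cong[where f = det] eq_matI simp: lt\<close>)
  also have "\<dots> = signof p * det M"
    using det_permute_rows[of "transpose_mat M" n p] p M by (simp add: det_transpose)
  finally show ?thesis by (simp flip: mult.assoc of_int_mult)
qed

text \<open>Row \<open>p\<close> is \<open>e\<^bsub>v(p)\<^esub> \<otimes> a\<^sub>p\<close> in \<open>\<complex>\<^sup>r \<otimes> \<complex>\<^sup>k\<close>, where \<open>e\<^sub>i \<otimes> e\<^sub>l\<close> is the basis vector \<open>i k + l\<close>.\<close>

definition bdet :: "nat \<Rightarrow> nat \<Rightarrow> (nat \<Rightarrow> nat \<Rightarrow> complex) \<Rightarrow> (nat \<Rightarrow> nat) \<Rightarrow> complex" where
  "bdet r k a v = det (mat (r * k) (r * k) (\<lambda>(p, q). if q div k = v p then a p (q mod k) else 0))"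

text \<open>The \<open>D\<^sub>l\<close> of the overview. Each row is a standard basis vector or
  zero, so the value is 0, 1 or -1.\<close>

definition bsign :: "nat \<Rightarrow> nat \<Rightarrow> (nat \<Rightarrow> nat) \<Rightarrow> (nat \<Rightarrow> nat) \<Rightarrow> complex" where
  "bsign r k l v = bdet r k (\<lambda>p i. if i = l p then 1 else 0) v"

lemma bdet_cong:
  assumes "\<And>p i. p < r * k \<Longrightarrow> i < k \<Longrightarrow> a p i = b p i" "\<And>p. p < r * k \<Longrightarrow> v p = w p"
  shows "bdet r k a v = bdet r k b w"
proof -
  have "q mod k < k" if "q < r * k" for q using that by (cases k) auto
  then show ?thesis unfolding bdet_def
    by (intro arg_cong[where f = det] eq_matI) (auto simp: assms)
qed

lemma bdet_permute:
  assumes "\<sigma> permutes {0..<r * k}"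
  shows "bdet r k (\<lambda>p. a (\<sigma> p)) (v \<circ> \<sigma>) = signof \<sigma> * bdet r k a v"
proof -
  let ?M = "mat (r * k) (r * k) (\<lambda>(p, q). if q div k = v p then a p (q mod k) else 0)"
  have "bdet r k (\<lambda>p. a (\<sigma> p)) (v \<circ> \<sigma>) = det (mat (r * k) (r * k) (\<lambda>(i, j). ?M $$ (\<sigma> i, j)))"
    unfolding bdet_def using permutes_lt[OF assms]
    by (intro arg_cong[where f = det] eq_matI) auto
  also have "\<dots> = signof \<sigma> * bdet r k a v"
    unfolding bdet_def by (rule det_permute_rows) (use assms in auto)
  finally show ?thesis .
qed

lemma bdet_equal_rows:
  assumes "p < r * k" "q < r * k" "p \<noteq> q" "v p = v q" "\<And>i. i < k \<Longrightarrow> a p i = a q i"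
  shows "bdet r k a v = 0"
proof -
  have "x mod k < k" if "x < r * k" for x using that by (cases k) auto
  then show ?thesis unfolding bdet_def using assms
    by (intro det_identical_rows[where n = "r * k" and i = p and j = q]) (auto intro!: eq_vecI)
qed

lemma bdet_expand:
  "bdet r k a v = (\<Sum>l\<in>words (r * k) k. (\<Prod>p=0..<r * k. a p (l p)) * bsign r k l v)"
proof -
  have m: "q mod k < k" if "q < r * k" for q using that by (cases k) auto
  have "bdet r k a v = det (mat (r * k) (r * k) (\<lambda>(p, q). \<Sum>b\<in>{0..<k}.
      a p b * (if q div k = v p then if q mod k = b then 1 else 0 else 0)))"
    unfolding bdet_def
    by (intro arg_cong[where f = det] eq_matI) (auto simp: m if_distrib[of "(*) c" for c] cong: if_cong)
  then show ?thesis unfolding det_expand_rows bsign_def bdet_def by simp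
qed

text \<open>The swap of the two tensor factors, taking the basis index i k + l to l r + i; it is the
  identity outside the range because \<open>permutes\<close> demands this.\<close>

definition transp_index :: "nat \<Rightarrow> nat \<Rightarrow> nat \<Rightarrow> nat" where
  "transp_index r k x = (if x < r * k then (x mod k) * r + x div k else x)"

lemma transp_index_bounds:
  fixes x r k :: nat
  assumes "x < r * k"
  shows "x div k < r" "x mod k < k" "(x mod k) * r + x div k < r * k"
proof -
  have k: "k > 0" using assms by (cases k) auto
  show a: "x div k < r" using assms by (simp add: less_mult_imp_div_less)
  show b: "x mod k < k" using k by simp
  have "(x mod k) * r + x div k < (x mod k + 1) * r" using a by simp
  also have "\<dots> \<le> k * r" using b by (intro mult_right_mono) auto
  finally show "(x mod k) * r + x div k < r * k" by (simp add: mult.commute)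
qed

lemma transp_index_permutes: "transp_index r k permutes {0..<r * k}"
proof (rule bij_imp_permutes)
  have inv: "transp_index k r (transp_index r k x) = x" if "x < r * k" for x r k
  proof -
    have "r > 0" using that by (cases r) auto
    then show ?thesis
      using transp_index_bounds[OF that] that by (simp add: transp_index_def mult.commute)
  qed
  show "bij_betw (transp_index r k) {0..<r * k} {0..<r * k}"
  proof (rule bij_betw_byWitness[where f' = "transp_index k r"])
    show "\<forall>x\<in>{0..<r * k}. transp_index k r (transp_index r k x) = x" using inv by auto
    show "\<forall>x\<in>{0..<r * k}. transp_index r k (transp_index k r x) = x"
      using inv[of _ k r] by (auto simp: mult.commute)
    show "transp_index r k ` {0..<r * k} \<subseteq> {0..<r * k}"
      using transp_index_bounds(3)[of _ r k] by (auto simp: transp_index_def)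
    show "transp_index k r ` {0..<r * k} \<subseteq> {0..<r * k}"
      using transp_index_bounds(3)[of _ k r] by (auto simp: transp_index_def mult.commute)
  qed
qed (auto simp: transp_index_def)

text \<open>The matrix is the transpose of \<open>g\<close> tensored with the identity of size
  \<open>k\<close>; reordering the basis by \<open>transp_index\<close> turns it into
  \<open>k\<close> diagonal copies of that transpose.\<close>

lemma det_kronecker:
  fixes g :: "complex mat"
  assumes g: "g \<in> carrier_mat r r"
  shows "det (mat (r * k) (r * k) (\<lambda>(x, y). if x mod k = y mod k then g $$ (y div k, x div k) else 0))
    = det g ^ k"
proof (cases "r = 0")
  case True
  then show ?thesis using g by (simp add: det_def)
next
  case False
  let ?B = "mat (r * k) (r * k) (\<lambda>(x, y). if x div r = y div r then transpose_mat g $$ (x mod r, y mod r) else 0)"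
  have "mat (r * k) (r * k) (\<lambda>(x, y). if x mod k = y mod k then g $$ (y div k, x div k) else 0)
      = mat (r * k) (r * k) (\<lambda>(i, j). ?B $$ (transp_index r k i, transp_index r k j))"
    using transp_index_bounds[of _ r k] g False
    by (intro eq_matI) (auto simp: transp_index_def)
  then have "det (mat (r * k) (r * k) (\<lambda>(x, y). if x mod k = y mod k then g $$ (y div k, x div k) else 0)) = det ?B"
    using det_permute_rows_cols[of ?B "r * k" "transp_index r k"] transp_index_permutes[of r k] by simp
  also have "\<dots> = (\<Prod>i<k. det (mat r r (\<lambda>(a, b). transpose_mat g $$ (a, b))))"
    using det_block_diag[of r k "\<lambda>i a b. transpose_mat g $$ (a, b)"] False by (simp add: mult.commute)
  also have "mat r r (\<lambda>(a, b). transpose_mat g $$ (a, b)) = transpose_mat g"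
    using g by (intro eq_matI) auto
  finally show ?thesis using g by (simp add: det_transpose)
qed

text \<open>Acting by \<open>g\<close> on the letters multiplies the matrix behind
  \<open>bdet\<close> on the right by the one of \<open>det_kronecker\<close>.\<close>

lemma bdet_transform:
  assumes g: "g \<in> carrier_mat r r" and v: "\<And>p. p < r * k \<Longrightarrow> v p < r"
  shows "(\<Sum>w\<in>words (r * k) r. bdet r k a w * (\<Prod>p=0..<r * k. g $$ (w p, v p)))
    = det g ^ k * bdet r k a v"
proof -
  let ?m = "r * k"
  let ?B = "mat ?m ?m (\<lambda>(p, q). if q div k = v p then a p (q mod k) else 0)"
  let ?K = "mat ?m ?m (\<lambda>(x, y). if x mod k = y mod k then g $$ (y div k, x div k) else 0)"
  have "(\<Sum>w\<in>words ?m r. bdet r k a w * (\<Prod>p=0..<?m. g $$ (w p, v p)))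
      = det (mat ?m ?m (\<lambda>(p, q). \<Sum>i\<in>{0..<r}. g $$ (i, v p) * (if q div k = i then a p (q mod k) else 0)))"
    unfolding det_expand_rows bdet_def by (simp add: mult.commute)
  also have "mat ?m ?m (\<lambda>(p, q). \<Sum>i\<in>{0..<r}. g $$ (i, v p) * (if q div k = i then a p (q mod k) else 0)) = ?B * ?K"
  proof (rule eq_matI)
    fix p q assume "p < dim_row (?B * ?K)" "q < dim_col (?B * ?K)"
    then have p: "p < ?m" and q: "q < ?m" by auto
    have k: "k > 0" using q by (cases k) auto
    note qb = transp_index_bounds[OF q]
    \<comment> \<open>The only summation index that contributes: row \<open>p\<close> is supported
      on block \<open>v p\<close>, and the Kronecker factor keeps the residue of \<open>q\<close>
      modulo \<open>k\<close>.\<close>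
    let ?x = "v p * k + q mod k"
    have x: "?x < ?m"
    proof -
      have "?x < (v p + 1) * k" using qb by simp
      also have "\<dots> \<le> r * k" using v[OF p] by (intro mult_right_mono) auto
      finally show ?thesis .
    qed
    have x_iff: "(x div k = v p \<and> x mod k = q mod k) \<longleftrightarrow> x = ?x" for x
      using k by (metis add.commute div_mult_mod_eq div_mult_self3 div_less mod_less_divisor add_0 mod_mult_self3 mod_mod_trivial less_numeral_extra(3))
    have "(?B * ?K) $$ (p, q) = (\<Sum>x=0..<?m. (if x div k = v p then a p (x mod k) else 0) *
        (if x mod k = q mod k then g $$ (q div k, x div k) else 0))"
      using p q by (simp add: scalar_prod_def)
    also have "\<dots> = (\<Sum>x=0..<?m. if x = ?x then a p (q mod k) * g $$ (q div k, v p) else 0)"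
      by (intro sum.cong refl) (use x_iff in auto)
    also have "\<dots> = a p (q mod k) * g $$ (q div k, v p)" using x by simp
    finally show "mat ?m ?m (\<lambda>(p, q). \<Sum>i\<in>{0..<r}. g $$ (i, v p) * (if q div k = i then a p (q mod k) else 0)) $$ (p, q)
      = (?B * ?K) $$ (p, q)"
      using p q qb by (simp add: if_distrib[of "(*) c" for c] mult.commute cong: if_cong)
  qed auto
  also have "det (?B * ?K) = bdet r k a v * det g ^ k"
    unfolding bdet_def by (subst det_mult[of _ ?m]) (auto simp: det_kronecker[OF g])
  finally show ?thesis by (simp add: mult.commute)
qed

lemma bsign_real: "cnj (bsign r k l v) = bsign r k l v"
proof -
  interpret cnj: comm_ring_hom cnj by unfold_locales auto
  show ?thesis unfolding bsign_def bdet_def cnj.hom_det[symmetric]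
    by (intro arg_cong[where f = det] eq_matI) auto
qed

lemma bsign_standard: "bsign r k (\<lambda>p. p mod k) (\<lambda>p. p div k) = 1"
proof -
  have "mat (r * k) (r * k) (\<lambda>(p, q). if q div k = p div k then if q mod k = p mod k then 1 else 0 else 0) = (1\<^sub>m (r * k) :: complex mat)"
    by (rule eq_matI) (auto, metis div_mult_mod_eq)
  then show ?thesis unfolding bsign_def bdet_def by simp
qed

lemma bsign_permute:
  assumes "\<sigma> permutes {0..<r * k}"
  shows "bsign r k (l \<circ> \<sigma>) (v \<circ> \<sigma>) = signof \<sigma> * bsign r k l v"
  unfolding bsign_def using bdet_permute[OF assms, of "\<lambda>p i. if i = l p then 1 else 0" v] by (simp add: o_def)

section \<open>Polarisation\<close>

lemma sum_alternating_supersets: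
  assumes "finite P" "U \<subseteq> P"
  shows "(\<Sum>Q | Q \<subseteq> P \<and> U \<subseteq> Q. (-1) ^ card Q) = (if U = P then (-1) ^ card P else (0 :: 'b :: ring_1))"
proof (cases "U = P")
  case True
  then have "{Q. Q \<subseteq> P \<and> U \<subseteq> Q} = {P}" by auto
  then show ?thesis using True by simp
next
  case False
  then have "U \<subset> P" using assms by auto
  then show ?thesis using False card_subsupersets_even_odd[OF assms(1)] assms(1)
    by (simp add: sum_alternating_cancels conj_assoc)
qed

text \<open>Expanding the products gives maps \<tau> from P to P. The alternating sum over the sets
  Q containing the image of \<tau> kills all but the surjective maps, which on a finite set are the
  permutations.\<close>

lemma permanent_ryser:
  fixes f :: "'a \<Rightarrow> 'a \<Rightarrow> 'b :: comm_ring_1"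
  assumes "finite P"
  shows "(\<Sum>Q\<in>Pow P. (-1) ^ card Q * (\<Prod>p\<in>P. \<Sum>q\<in>Q. f p q))
    = (-1) ^ card P * (\<Sum>\<sigma> | \<sigma> permutes P. \<Prod>p\<in>P. f p (\<sigma> p))"
proof -
  let ?T = "P \<rightarrow>\<^sub>E P"
  let ?F = "\<lambda>\<tau>. \<Prod>p\<in>P. f p (\<tau> p)"
  have finT: "finite ?T" using assms by (simp add: finite_PiE)
  have "(\<Prod>p\<in>P. \<Sum>q\<in>Q. f p q) = (\<Sum>\<tau>\<in>?T. if \<tau> ` P \<subseteq> Q then ?F \<tau> else 0)" if "Q \<subseteq> P" for Q
  proof -
    have "(\<Prod>p\<in>P. \<Sum>q\<in>Q. f p q) = (\<Sum>\<tau>\<in>P \<rightarrow>\<^sub>E Q. ?F \<tau>)"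
      using assms that by (intro prod_sum_PiE) (auto intro: finite_subset)
    also have "P \<rightarrow>\<^sub>E Q = {\<tau> \<in> ?T. \<tau> ` P \<subseteq> Q}" using that by (auto simp: PiE_iff extensional_def)
    finally show ?thesis using sum.inter_filter[OF finT, of ?F "\<lambda>\<tau>. \<tau> ` P \<subseteq> Q"] by simp
  qed
  then have "(\<Sum>Q\<in>Pow P. (-1) ^ card Q * (\<Prod>p\<in>P. \<Sum>q\<in>Q. f p q))
      = (\<Sum>Q\<in>Pow P. \<Sum>\<tau>\<in>?T. (if \<tau> ` P \<subseteq> Q then (-1) ^ card Q * ?F \<tau> else 0))"
    by (auto intro!: sum.cong simp: sum_distrib_left)
  also have "\<dots> = (\<Sum>\<tau>\<in>?T. \<Sum>Q\<in>Pow P. (if \<tau> ` P \<subseteq> Q then (-1) ^ card Q * ?F \<tau> else 0))"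
    by (rule sum.swap)
  also have "\<dots> = (\<Sum>\<tau>\<in>?T. (\<Sum>Q | Q \<subseteq> P \<and> \<tau> ` P \<subseteq> Q. (-1) ^ card Q) * ?F \<tau>)"
    using assms by (intro sum.cong refl) (simp add: sum.inter_filter[symmetric] sum_distrib_right)
  also have "\<dots> = (\<Sum>\<tau>\<in>?T. if \<tau> ` P = P then (-1) ^ card P * ?F \<tau> else 0)"
  proof (intro sum.cong refl)
    fix \<tau> assume "\<tau> \<in> ?T"
    then have "\<tau> ` P \<subseteq> P" by (auto simp: PiE_iff)
    then show "(\<Sum>Q | Q \<subseteq> P \<and> \<tau> ` P \<subseteq> Q. (-1) ^ card Q) * ?F \<tau>
        = (if \<tau> ` P = P then (-1) ^ card P * ?F \<tau> else 0)"
      by (simp add: sum_alternating_supersets[OF assms])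
  qed
  also have "\<dots> = (\<Sum>\<tau>\<in>{\<tau> \<in> ?T. \<tau> ` P = P}. (-1) ^ card P * ?F \<tau>)"
    by (rule sum.inter_filter[OF finT, symmetric])
  also have "\<dots> = (\<Sum>\<sigma> | \<sigma> permutes P. (-1) ^ card P * ?F \<sigma>)"
  proof (rule sum.reindex_bij_witness[where i = "\<lambda>\<sigma>. restrict \<sigma> P" and j = "\<lambda>\<tau> x. if x \<in> P then \<tau> x else x"])
    fix \<tau> assume \<tau>: "\<tau> \<in> {\<tau> \<in> ?T. \<tau> ` P = P}"
    show "restrict (\<lambda>x. if x \<in> P then \<tau> x else x) P = \<tau>" using \<tau> by (auto simp: PiE_iff extensional_def)
    have "inj_on \<tau> P" using \<tau> assms by (simp add: eq_card_imp_inj_on)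
    then show "(\<lambda>x. if x \<in> P then \<tau> x else x) \<in> {\<sigma>. \<sigma> permutes P}"
      using \<tau> by (auto intro!: bij_imp_permutes simp: bij_betw_def inj_on_def)
    show "(-1) ^ card P * ?F (\<lambda>x. if x \<in> P then \<tau> x else x) = (-1) ^ card P * ?F \<tau>" by simp
  next
    fix \<sigma> assume \<sigma>: "\<sigma> \<in> {\<sigma>. \<sigma> permutes P}"
    then show "(\<lambda>x. if x \<in> P then restrict \<sigma> P x else x) = \<sigma>"
      by (auto simp: permutes_not_in)
    show "restrict \<sigma> P \<in> {\<tau> \<in> ?T. \<tau> ` P = P}"
      using \<sigma> permutes_image[of \<sigma> P] permutes_in_image[of \<sigma> P] by auto
  qed
  finally show ?thesis by (simp add: sum_distrib_left)
qed

text \<open>Polarisation by Ryser's formula; the weights \<open>A z\<close> count the positions in a subset having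
a given letter and colour.\<close>

lemma symmetric_eq_sum_products:
  fixes s :: "(nat \<Rightarrow> 'b) \<Rightarrow> complex" and c :: "nat \<Rightarrow> 'c"
  assumes B: "finite B"
    and cong: "\<And>u u'. (\<And>p. p < m \<Longrightarrow> u p = u' p) \<Longrightarrow> s u = s u'"
    and sym: "\<And>u \<sigma>. \<sigma> permutes {0..<m} \<Longrightarrow> (\<And>p. p < m \<Longrightarrow> c (\<sigma> p) = c p) \<Longrightarrow> s (u \<circ> \<sigma>) = s u"
  obtains Z :: "((nat \<Rightarrow> 'b) \<times> nat set) set" and e A
  where "finite Z"
    and "\<And>u. (\<And>p. p < m \<Longrightarrow> u p \<in> B) \<Longrightarrow> s u = (\<Sum>z\<in>Z. e z * (\<Prod>p=0..<m. A z (u p) (c p)))"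
proof -
  let ?P = "{0..<m}"
  let ?L = "?P \<rightarrow>\<^sub>E B"
  let ?G = "{\<sigma>. \<sigma> permutes ?P \<and> (\<forall>p<m. c (\<sigma> p) = c p)}"
  have finG: "finite ?G" by (rule finite_subset[OF _ finite_permutations[of ?P]]) auto
  have "id \<in> ?G" by (auto simp: permutes_id)
  then have G0: "card ?G \<noteq> 0" using finG by (metis (lifting) card_0_eq empty_iff)
  define Z where "Z = ?L \<times> Pow ?P"
  \<comment> \<open>The power \<open>(-1) ^ m\<close> cancels the sign in Ryser's formula, and
    dividing by the order of the colour-preserving group makes the sum over it an average.\<close>
  define e where "e = (\<lambda>(l, Q :: nat set). s l * (-1) ^ m * (-1) ^ card Q / of_nat (card ?G))"
  define A where "A = (\<lambda>(l :: nat \<Rightarrow> 'b, Q :: nat set) b j. \<Sum>q\<in>Q. if l q = b \<and> c q = j then 1 else (0 :: complex))"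
  show thesis
  proof (rule that[of Z e A])
    show "finite Z" unfolding Z_def using B by (auto intro: finite_PiE)
    fix u assume u: "\<And>p. p < m \<Longrightarrow> u p \<in> B"
    \<comment> \<open>A colour-preserving \<open>\<sigma>\<close> selects the single word
      \<open>u\<close> composed with its inverse, where \<open>s\<close> has the value
      \<open>s u\<close> by symmetry; every other \<open>\<sigma>\<close> contributes zero.\<close>
    have one: "(\<Sum>l\<in>?L. s l * (\<Prod>p=0..<m. if l (\<sigma> p) = u p \<and> c (\<sigma> p) = c p then 1 else 0))
        = (if \<sigma> \<in> ?G then s u else 0)" if \<sigma>: "\<sigma> permutes ?P" for \<sigma>
    proof (cases "\<sigma> \<in> ?G")
      case True
      let ?i = "Hilbert_Choice.inv \<sigma>"
      let ?l = "restrict (u \<circ> ?i) ?P"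
      have ip: "?i permutes ?P" using permutes_inv[OF \<sigma>] .
      have l: "?l \<in> ?L" using u permutes_lt[OF ip] by auto
      have iff: "(\<forall>p<m. l (\<sigma> p) = u p) \<longleftrightarrow> l = ?l" if "l \<in> ?L" for l
      proof
        assume *: "\<forall>p<m. l (\<sigma> p) = u p"
        show "l = ?l"
        proof
          fix p show "l p = ?l p"
            using * \<open>l \<in> ?L\<close> permutes_lt[OF ip, of p] permutes_inverses(1)[OF \<sigma>, of p]
            by (cases "p < m") (auto simp: PiE_iff extensional_def)
        qed
      next
        assume "l = ?l"
        then show "\<forall>p<m. l (\<sigma> p) = u p" using permutes_lt[OF \<sigma>] permutes_inverses(2)[OF \<sigma>] by simp
      qed
      have "(\<Prod>p=0..<m. if l (\<sigma> p) = u p \<and> c (\<sigma> p) = c p then 1 else 0) = (if l = ?l then 1 else (0::complex))"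
        if "l \<in> ?L" for l
      proof (cases "l = ?l")
        case t: True
        then have "\<forall>p<m. l (\<sigma> p) = u p" using iff[OF that] by blast
        then show ?thesis using True t by simp
      next
        case f: False
        have "\<not> (\<forall>p<m. l (\<sigma> p) = u p)" using f iff[OF that] by blast
        then obtain p where "p < m" "l (\<sigma> p) \<noteq> u p" by blast
        then show ?thesis using f by (auto intro!: prod_zero)
      qed
      then have "(\<Sum>l\<in>?L. s l * (\<Prod>p=0..<m. if l (\<sigma> p) = u p \<and> c (\<sigma> p) = c p then 1 else 0))
          = (\<Sum>l\<in>?L. if l = ?l then s l else 0)" by (intro sum.cong refl) simp
      also have "\<dots> = s ?l" using B l by (simp add: finite_PiE)
      also have "\<dots> = s (u \<circ> ?i)" by (rule cong) simp
      also have "\<dots> = s u"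
      proof (rule sym[OF ip])
        fix p assume "p < m"
        then show "c (?i p) = c p"
          using True permutes_lt[OF ip, of p] permutes_inverses(1)[OF \<sigma>, of p] by (metis (mono_tags, lifting) mem_Collect_eq)
      qed
      finally show ?thesis using True by simp
    next
      case False
      then obtain p where "p < m" "c (\<sigma> p) \<noteq> c p" using \<sigma> by auto
      then have 0: "(\<Prod>p=0..<m. if l (\<sigma> p) = u p \<and> c (\<sigma> p) = c p then 1 else (0::complex)) = 0" for l
        by (auto intro!: prod_zero)
      show ?thesis unfolding 0 if_not_P[OF False] by simp
    qed
    have "(\<Sum>z\<in>Z. e z * (\<Prod>p=0..<m. A z (u p) (c p)))
      = (\<Sum>l\<in>?L. s l * (-1) ^ m / of_nat (card ?G) *
          (\<Sum>Q\<in>Pow ?P. (-1) ^ card Q * (\<Prod>p\<in>?P. \<Sum>q\<in>Q. if l q = u p \<and> c q = c p then 1 else 0)))"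
      unfolding Z_def sum.cartesian_product' e_def A_def
      by (simp add: sum_distrib_left mult_ac)
    also have "\<dots> = (\<Sum>l\<in>?L. s l / of_nat (card ?G) *
          (\<Sum>\<sigma> | \<sigma> permutes ?P. \<Prod>p=0..<m. if l (\<sigma> p) = u p \<and> c (\<sigma> p) = c p then 1 else 0))"
      by (subst permanent_ryser) (auto intro!: sum.cong simp flip: power_mult_distrib)
    also have "\<dots> = (\<Sum>\<sigma> | \<sigma> permutes ?P. (\<Sum>l\<in>?L. s l * (\<Prod>p=0..<m. if l (\<sigma> p) = u p \<and> c (\<sigma> p) = c p then 1 else 0)) / of_nat (card ?G))"
      unfolding sum_distrib_left sum_divide_distrib by (subst sum.swap) simp
    also have "\<dots> = (\<Sum>\<sigma> | \<sigma> permutes ?P. if \<sigma> \<in> ?G then s u / of_nat (card ?G) else 0)"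
    proof (intro sum.cong refl)
      fix \<sigma> assume "\<sigma> \<in> {\<sigma>. \<sigma> permutes ?P}"
      then have "\<sigma> permutes ?P" by simp
      then show "(\<Sum>l\<in>?L. s l * (\<Prod>p=0..<m. if l (\<sigma> p) = u p \<and> c (\<sigma> p) = c p then 1 else 0)) / of_nat (card ?G)
          = (if \<sigma> \<in> ?G then s u / of_nat (card ?G) else 0)"
        unfolding one[OF \<open>\<sigma> permutes ?P\<close>] by (cases "\<sigma> \<in> ?G") (simp_all only: if_True if_False div_0)
    qed
    also have "\<dots> = (\<Sum>\<sigma>\<in>?G. s u / of_nat (card ?G))"
      using finite_permutations[of ?P] by (subst sum.inter_filter[symmetric]) (auto intro!: sum.cong)
    also have "\<dots> = s u" using G0 by simp
    finally show "s u = (\<Sum>z\<in>Z. e z * (\<Prod>p=0..<m. A z (u p) (c p)))" by simp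
  qed
qed

text \<open>Along the line g + t 1 the sum is a polynomial in t. It vanishes unless -t is an
  eigenvalue of \<open>g\<close>, hence at infinitely many t, hence also at t = 0.\<close>

lemma matrix_polynomial_zero_density:
  fixes h :: "'z \<Rightarrow> complex" and u :: "'z \<Rightarrow> nat \<Rightarrow> nat \<times> nat"
  assumes u: "\<And>z p. z \<in> Z \<Longrightarrow> p < m \<Longrightarrow> u z p \<in> {0..<r} \<times> {0..<r}"
    and zero: "\<And>g. g \<in> carrier_mat r r \<Longrightarrow> det g \<noteq> 0 \<Longrightarrow> (\<Sum>z\<in>Z. h z * (\<Prod>p=0..<m. g $$ u z p)) = 0"
    and g: "g \<in> carrier_mat r r"
  shows "(\<Sum>z\<in>Z. h z * (\<Prod>p=0..<m. g $$ u z p)) = 0"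
proof -
  define q where "q = (\<Sum>z\<in>Z. smult (h z) (\<Prod>p=0..<m. [:g $$ u z p, if fst (u z p) = snd (u z p) then 1 else 0:]))"
  let ?g = "\<lambda>t. g + t \<cdot>\<^sub>m 1\<^sub>m r"
  have q: "poly q t = (\<Sum>z\<in>Z. h z * (\<Prod>p=0..<m. ?g t $$ u z p))" for t
  proof -
    have "?g t $$ u z p = g $$ u z p + (if fst (u z p) = snd (u z p) then t else 0)"
      if "z \<in> Z" "p < m" for z p
      using u[OF that] g by (cases "u z p") auto
    then show ?thesis unfolding q_def by (auto simp: poly_sum poly_prod intro!: sum.cong prod.cong)
  qed
  have "char_poly g \<noteq> 0" using degree_monic_char_poly[OF g] by auto
  then have fin: "finite {t. poly (char_poly g) (- t) = 0}"
    using finite_vimageI[of "{t. poly (char_poly g) t = 0}" uminus] poly_roots_finite[of "char_poly g"]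
    by (simp add: vimage_def inj_on_def)
  have "poly q t = 0" if "poly (char_poly g) (- t) \<noteq> 0" for t
  proof -
    have "?g t = char_matrix g (- t)" unfolding char_matrix_def using g by (intro eq_matI) auto
    then have "det (?g t) \<noteq> 0"
      using that eigenvalue_root_char_poly[OF g] eigenvalue_det[OF g] by simp
    then show ?thesis unfolding q using g by (intro zero) auto
  qed
  then have "- {t. poly (char_poly g) (- t) = 0} \<subseteq> {t. poly q t = 0}" by auto
  moreover have "infinite (- {t. poly (char_poly g) (- t) = 0})"
    using fin infinite_UNIV_char_0 by (simp add: finite_compl)
  ultimately have "infinite {t. poly q t = 0}" using finite_subset by blast
  then have "q = 0" using poly_roots_finite by blast
  then have "poly q 0 = 0" by simp
  moreover have "?g 0 = g" using g by (intro eq_matI) auto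
  ultimately show ?thesis unfolding q by simp
qed

text \<open>With a single colour, \<open>symmetric_eq_sum_products\<close> writes \<open>s\<close>
  as a combination of evaluations of monomials at matrices, one for each weight \<open>A y\<close>.
  These matrices may be singular, so the identity must first be extended by density.\<close>

lemma matrix_polynomial_symmetric:
  fixes h :: "'z \<Rightarrow> complex" and u :: "'z \<Rightarrow> nat \<Rightarrow> nat \<times> nat"
  assumes u: "\<And>z p. z \<in> Z \<Longrightarrow> p < m \<Longrightarrow> u z p \<in> {0..<r} \<times> {0..<r}"
    and zero: "\<And>g. g \<in> carrier_mat r r \<Longrightarrow> det g \<noteq> 0 \<Longrightarrow> (\<Sum>z\<in>Z. h z * (\<Prod>p=0..<m. g $$ u z p)) = 0"
    and cong: "\<And>u u'. (\<And>p. p < m \<Longrightarrow> u p = u' p) \<Longrightarrow> s u = s u'"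
    and sym: "\<And>u \<sigma>. \<sigma> permutes {0..<m} \<Longrightarrow> s (u \<circ> \<sigma>) = s u"
  shows "(\<Sum>z\<in>Z. h z * s (u z)) = 0"
proof -
  obtain Y :: "((nat \<Rightarrow> nat \<times> nat) \<times> nat set) set" and e A where Y: "finite Y"
    "\<And>u. (\<And>p. p < m \<Longrightarrow> u p \<in> {0..<r} \<times> {0..<r}) \<Longrightarrow> s u = (\<Sum>y\<in>Y. e y * (\<Prod>p=0..<m. A y (u p) ()))"
  proof (rule symmetric_eq_sum_products[of "{0..<r} \<times> {0..<r}" m s "\<lambda>_. ()"])
    show "s (u \<circ> \<sigma>) = s u" if "\<sigma> permutes {0..<m}" for u \<sigma> using sym that .
    show "s u = s u'" if "\<And>p. p < m \<Longrightarrow> u p = u' p" for u u' using cong that .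
  qed auto
  let ?g = "\<lambda>y. mat r r (\<lambda>ij. A y ij ())"
  have "(\<Sum>z\<in>Z. h z * s (u z)) = (\<Sum>z\<in>Z. \<Sum>y\<in>Y. e y * (h z * (\<Prod>p=0..<m. ?g y $$ u z p)))"
  proof (intro sum.cong refl)
    fix z assume z: "z \<in> Z"
    have "?g y $$ u z p = A y (u z p) ()" if "p < m" for y p
      using u[OF z that] by (cases "u z p") auto
    then show "h z * s (u z) = (\<Sum>y\<in>Y. e y * (h z * (\<Prod>p=0..<m. ?g y $$ u z p)))"
      by (subst Y(2)[OF u[OF z]]) (auto simp: sum_distrib_left mult_ac intro!: sum.cong)
  qed
  also have "\<dots> = (\<Sum>y\<in>Y. e y * (\<Sum>z\<in>Z. h z * (\<Prod>p=0..<m. ?g y $$ u z p)))"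
    by (subst sum.swap) (simp add: sum_distrib_left)
  also have "\<dots> = 0"
    by (intro sum.neutral ballI, subst matrix_polynomial_zero_density[OF u zero]) auto
  finally show ?thesis .
qed

section \<open>Words of index lists\<close>

text \<open>\<open>submatrix\<close> enumerates a set by \<open>pick\<close>, while
  \<open>Sword\<close> uses its sorted list.\<close>

lemma pick_eq_nth_sorted:
  assumes "finite S" "a < card S"
  shows "pick S a = sorted_list_of_set S ! a"
proof -
  have "sorted_wrt (<) (map (pick S) [0..<card S])"
    by (auto simp: sorted_wrt_iff_nth_less intro: pick_mono_le)
  moreover have "set (map (pick S) [0..<card S]) = S"
  proof (rule card_subset_eq[OF assms(1)])
    show "set (map (pick S) [0..<card S]) \<subseteq> S" by (auto intro: pick_in_set_le)
    have "inj_on (pick S) {0..<card S}"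
      by (rule inj_onI) (metis atLeastLessThan_iff linorder_neqE_nat nat_neq_iff pick_mono_le)
    then show "card (set (map (pick S) [0..<card S])) = card S" by (simp add: card_image)
  qed
  ultimately have "sorted_list_of_set S = map (pick S) [0..<card S]"
    using sorted_list_of_set_unique[OF assms(1), of "map (pick S) [0..<card S]"] by simp
  then show ?thesis using assms by simp
qed

text \<open>The block of a position depends on \<open>lam\<close> alone, so all lists of this shape
  share one block map, and a position can carry a column of a matrix besides its letter.\<close>

definition blk :: "nat \<Rightarrow> (nat \<Rightarrow> nat) \<Rightarrow> nat \<Rightarrow> nat" where
  "blk n lam p = concat (map (\<lambda>j. replicate (lam j) j) [0..<n]) ! p"

definition letter :: "nat \<Rightarrow> (nat \<Rightarrow> nat set) \<Rightarrow> nat \<Rightarrow> nat" where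
  "letter n S p = Sword n S ! p"

text \<open>\<open>validS\<close> without the bound on the letters and without the normalisation
  beyond \<open>n\<close>; it passes to smaller \<open>n\<close> and so fits induction on
  \<open>n\<close>.\<close>

definition has_cards :: "nat \<Rightarrow> (nat \<Rightarrow> nat) \<Rightarrow> (nat \<Rightarrow> nat set) \<Rightarrow> bool" where
  "has_cards n lam S \<longleftrightarrow> (\<forall>j<n. finite (S j) \<and> card (S j) = lam j)"

lemma has_cards_Suc: "has_cards (Suc n) lam S \<longleftrightarrow> has_cards n lam S \<and> finite (S n) \<and> card (S n) = lam n"
  unfolding has_cards_def by (auto simp: less_Suc_eq)

lemma validS_has_cards: "validS n r lam S \<Longrightarrow> has_cards n lam S"
  unfolding validS_def has_cards_def by (meson finite_atLeastLessThan finite_subset)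

lemma length_Sword: "has_cards n lam S \<Longrightarrow> length (Sword n S) = (\<Sum>j<n. lam j)"
  by (induction n) (auto simp: Sword_def has_cards_Suc)

lemma blk_Suc_less:
  assumes "p < (\<Sum>j<n. lam j)"
  shows "blk (Suc n) lam p = blk n lam p"
proof -
  have "length (concat (map (\<lambda>j. replicate (lam j) j) [0..<n])) = (\<Sum>j<n. lam j)"
    by (induction n) auto
  then show ?thesis using assms by (simp add: blk_def nth_append)
qed

lemma blk_Suc_add:
  assumes "a < lam n"
  shows "blk (Suc n) lam ((\<Sum>j<n. lam j) + a) = n"
proof -
  have "length (concat (map (\<lambda>j. replicate (lam j) j) [0..<n])) = (\<Sum>j<n. lam j)"
    by (induction n) auto
  then show ?thesis using assms by (simp add: blk_def nth_append)
qed

lemma letter_Suc_less: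
  assumes "has_cards n lam S" "p < (\<Sum>j<n. lam j)"
  shows "letter (Suc n) S p = letter n S p"
  using length_Sword[OF assms(1)] assms(2) by (simp add: letter_def Sword_def nth_append)

lemma letter_Suc_add:
  assumes "has_cards n lam S"
  shows "letter (Suc n) S ((\<Sum>j<n. lam j) + a) = sorted_list_of_set (S n) ! a"
  using length_Sword[OF assms] by (simp add: letter_def Sword_def nth_append)

lemma less_sum_Suc_cases:
  fixes lam :: "nat \<Rightarrow> nat"
  assumes "p < (\<Sum>j<Suc n. lam j)"
  obtains "p < (\<Sum>j<n. lam j)" | a where "p = (\<Sum>j<n. lam j) + a" "a < lam n"
proof (cases "p < (\<Sum>j<n. lam j)")
  case False
  then show thesis using that(2)[of "p - (\<Sum>j<n. lam j)"] assms by simp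
qed (rule that(1))

lemma blk_less: "p < (\<Sum>j<n. lam j) \<Longrightarrow> blk n lam p < n"
proof (induction n)
  case (Suc n)
  from Suc.prems show ?case
    by (cases rule: less_sum_Suc_cases) (use Suc.IH in \<open>auto simp: blk_Suc_less blk_Suc_add less_SucI\<close>)
qed simp

lemma letter_in:
  assumes "has_cards n lam S" "p < (\<Sum>j<n. lam j)"
  shows "letter n S p \<in> S (blk n lam p)"
  using assms
proof (induction n)
  case (Suc n)
  have h: "has_cards n lam S" "finite (S n)" "card (S n) = lam n" using Suc.prems by (auto simp: has_cards_Suc)
  from Suc.prems(2) show ?case
  proof (cases rule: less_sum_Suc_cases)
    case 1
    then show ?thesis using Suc.IH h by (simp add: letter_Suc_less[OF h(1)] blk_Suc_less)
  next
    case (2 a)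
    have "sorted_list_of_set (S n) ! a \<in> set (sorted_list_of_set (S n))"
      using 2 h by (intro nth_mem) simp
    then show ?thesis using 2 h by (simp only: letter_Suc_add[OF h(1)] blk_Suc_add) simp
  qed
qed simp

lemma blk_letter_lex:
  assumes "has_cards n lam S" "p < q" "q < (\<Sum>j<n. lam j)"
  shows "blk n lam p < blk n lam q \<or> (blk n lam p = blk n lam q \<and> letter n S p < letter n S q)"
  using assms
proof (induction n)
  case (Suc n)
  have h: "has_cards n lam S" "finite (S n)" "card (S n) = lam n" using Suc.prems by (auto simp: has_cards_Suc)
  have p: "p < (\<Sum>j<Suc n. lam j)" using Suc.prems by simp
  from Suc.prems(3) show ?case
  proof (cases rule: less_sum_Suc_cases)
    case 1
    then show ?thesis using Suc h by (simp add: letter_Suc_less[OF h(1)] blk_Suc_less)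
  next
    case (2 a)
    from p show ?thesis
    proof (cases rule: less_sum_Suc_cases)
      case 1
      then show ?thesis using blk_less[OF 1] 2 by (simp only: blk_Suc_less blk_Suc_add) simp
    next
      case p': (2 b)
      then have "sorted_list_of_set (S n) ! b < sorted_list_of_set (S n) ! a"
        using 2 h Suc.prems(2) sorted_wrt_nth_less[OF strict_sorted_list_of_set[of "S n"], of b a] by simp
      then show ?thesis using 2 p' by (simp only: blk_Suc_add letter_Suc_add[OF h(1)]) simp
    qed
  qed
qed simp

text \<open>The lexicographic order of the positions gives injectivity, and equal cardinalities do
  the rest. Positions thus stand for the incidences between letters and sets of the list.\<close>

lemma blk_letter_bij:
  assumes "has_cards n lam S"
  shows "bij_betw (\<lambda>p. (blk n lam p, letter n S p)) {0..<(\<Sum>j<n. lam j)} (SIGMA j:{0..<n}. S j)"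
proof -
  let ?f = "\<lambda>p. (blk n lam p, letter n S p)"
  let ?m = "\<Sum>j<n. lam j"
  have inj: "inj_on ?f {0..<?m}"
  proof (rule inj_onI)
    fix p q assume "p \<in> {0..<?m}" "q \<in> {0..<?m}" "?f p = ?f q"
    then show "p = q" using blk_letter_lex[OF assms, of p q] blk_letter_lex[OF assms, of q p]
      by (cases p q rule: linorder_cases) auto
  qed
  have "?f ` {0..<?m} = (SIGMA j:{0..<n}. S j)"
  proof (rule card_subset_eq)
    show "finite (SIGMA j:{0..<n}. S j)" using assms by (auto simp: has_cards_def)
    show "?f ` {0..<?m} \<subseteq> (SIGMA j:{0..<n}. S j)"
      using blk_less letter_in[OF assms] by auto
    have "card (SIGMA j:{0..<n}. S j) = (\<Sum>j\<in>{0..<n}. card (S j))"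
      using assms by (subst card_SigmaI) (auto simp: has_cards_def)
    also have "\<dots> = ?m" using assms by (auto simp: has_cards_def atLeast0LessThan intro!: sum.cong)
    finally show "card (?f ` {0..<?m}) = card (SIGMA j:{0..<n}. S j)" using inj by (simp add: card_image)
  qed
  then show ?thesis using inj by (simp add: bij_betw_def)
qed

lemma det_submatrix_eq:
  assumes "g \<in> carrier_mat r s" "T \<subseteq> {0..<r}" "S \<subseteq> {0..<s}" "card T = l" "card S = l"
  shows "submatrix g T S = mat l l (\<lambda>(a, b). g $$ (sorted_list_of_set T ! a, sorted_list_of_set S ! b))"
proof -
  have T: "{i. i < r \<and> i \<in> T} = T" "{i. i < s \<and> i \<in> S} = S" using assms by auto
  have "finite T" "finite S" using assms finite_subset by auto
  then show ?thesis using assms unfolding submatrix_def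
    by (intro eq_matI) (auto simp: T pick_eq_nth_sorted)
qed

text \<open>Collecting the minors in one block-diagonal determinant makes a single Leibniz expansion
  over positions available.\<close>

lemma prod_det_submatrix:
  fixes g :: "complex mat"
  assumes g: "g \<in> carrier_mat r r" and T: "validS n r lam T" and S: "validS n r lam S"
  shows "(\<Prod>j<n. det (submatrix g (T j) (S j))) =
    det (mat (\<Sum>j<n. lam j) (\<Sum>j<n. lam j)
      (\<lambda>(p, q). if blk n lam p = blk n lam q then g $$ (letter n T p, letter n S q) else 0))"
proof -
  have "(\<Prod>j<i. det (submatrix g (T j) (S j))) =
    det (mat (\<Sum>j<i. lam j) (\<Sum>j<i. lam j)
      (\<lambda>(p, q). if blk i lam p = blk i lam q then g $$ (letter i T p, letter i S q) else 0))"
    if "i \<le> n" for i using that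
  proof (induction i)
    case 0
    show ?case by (simp add: det_def)
  next
    case (Suc i)
    have h: "has_cards i lam T" "has_cards i lam S"
      using validS_has_cards[OF T] validS_has_cards[OF S] Suc.prems by (auto simp: has_cards_def)
    have TS: "T i \<subseteq> {0..<r}" "S i \<subseteq> {0..<r}" "card (T i) = lam i" "card (S i) = lam i"
      using T S Suc.prems by (auto simp: validS_def)
    note bl = blk_less[of _ lam i]
    show ?case unfolding prod.lessThan_Suc Suc.IH[OF Suc_leD[OF Suc.prems]] det_submatrix_eq[OF g TS] sum.lessThan_Suc
      by (rule det_block_diag2[symmetric])
        (use bl in \<open>force simp: blk_Suc_less blk_Suc_add letter_Suc_less[OF h(1)] letter_Suc_less[OF h(2)]
          letter_Suc_add[OF h(1)] letter_Suc_add[OF h(2)]\<close>)+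
  qed
  then show ?thesis by simp
qed

lemma prod_list_eq_prod_nth: "prod_list (map f xs) = (\<Prod>i<length xs. f (xs ! i) :: 'a :: comm_monoid_mult)"
  by (induction xs) (simp_all add: prod.lessThan_Suc_shift del: prod.lessThan_Suc)

text \<open>Sort the rows by letter and, within a letter, by the rank of their column in the set
  belonging to that letter. The rows of letter i then form the transposed minor of
  \<open>Is ! i\<close>, and the sorting permutation has the sign of the word.\<close>

lemma bdet_eq_plprod:
  fixes A :: "complex mat"
  assumes A: "A \<in> carrier_mat k n" and k: "k > 0" and len: "length Is = r"
    and Is: "set Is \<subseteq> ksubsets k n"
    and h: "has_cards n lam (dualS n Is)" and m: "(\<Sum>j<n. lam j) = r * k"
  shows "bdet r k (\<lambda>p i. A $$ (i, blk n lam p)) (letter n (dualS n Is))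
    = signS n (dualS n Is) * plprod k n Is A"
proof -
  let ?S = "dualS n Is"
  let ?l = "letter n ?S" and ?b = "blk n lam"
  \<comment> \<open>The rank counts from 0, so letter and rank become quotient and remainder of
    \<open>\<rho> p\<close> modulo \<open>k\<close>.\<close>
  let ?rank = "\<lambda>p. card {j \<in> Is ! ?l p. j < ?b p}"
  define \<rho> where "\<rho> = (\<lambda>p. if p < r * k then ?l p * k + ?rank p else p)"
  have bn: "?b p < n" if "p < r * k" for p using blk_less[of p lam n] that m by simp
  have lI: "?l p < r" "?b p \<in> Is ! ?l p" if "p < r * k" for p
  proof -
    have "?l p \<in> ?S (?b p)" using letter_in[OF h, of p] that unfolding m by simp
    then have "?l p \<in> {i. i < length Is \<and> ?b p \<in> Is ! i}" using bn[OF that] by (simp only: dualS_def if_True)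
    then show "?l p < r" "?b p \<in> Is ! ?l p" using len by auto
  qed
  have I: "Is ! i \<subseteq> {0..<n}" "card (Is ! i) = k" "finite (Is ! i)" if "i < r" for i
  proof -
    have "Is ! i \<in> ksubsets k n" using Is nth_mem[of i Is] that len by blast
    then show "Is ! i \<subseteq> {0..<n}" "card (Is ! i) = k" "finite (Is ! i)"
      using finite_subset[of "Is ! i" "{0..<n}"] by (auto simp: ksubsets_def)
  qed
  have rk: "?rank p < k" if "p < r * k" for p
  proof -
    have "{j \<in> Is ! ?l p. j < ?b p} \<subset> Is ! ?l p" using lI[OF that] by auto
    then show ?thesis using psubset_card_mono I[OF lI(1)[OF that]] by metis
  qed
  have \<rho>: "\<rho> p div k = ?l p" "\<rho> p mod k = ?rank p" "\<rho> p < r * k" if "p < r * k" for p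
  proof -
    show "\<rho> p div k = ?l p" "\<rho> p mod k = ?rank p" using that rk[OF that] by (auto simp: \<rho>_def)
    have "?l p * k + ?rank p < (?l p + 1) * k" using rk[OF that] by simp
    also have "\<dots> \<le> r * k" using lI(1)[OF that] by (intro mult_right_mono) auto
    finally show "\<rho> p < r * k" using that by (simp add: \<rho>_def)
  qed
  have rank_pick: "pick (Is ! ?l p) (?rank p) = ?b p" if "p < r * k" for p
    using pick_card_in_set[OF lI(2)[OF that]] .
  have rank_pick': "pick (Is ! i) (card {j \<in> Is ! i. j < ?b p}) = ?b p" if "p < r * k" "?l p = i" for p i
    using rank_pick[OF that(1)] that(2) by simp
  have inj: "p = q" if "p < r * k" "q < r * k" "\<rho> p = \<rho> q" for p q
  proof -
    have "?l p = ?l q" using \<rho>(1) that by metis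
    moreover have "?rank p = ?rank q" using \<rho>(2) that by metis
    ultimately have "?b p = ?b q" using rank_pick that by metis
    with \<open>?l p = ?l q\<close> show ?thesis
      using that by (intro inj_onD[OF bij_betw_imp_inj_on[OF blk_letter_bij[OF h]]]) (simp_all add: m)
  qed
  have perm: "\<rho> permutes {0..<r * k}"
  proof (rule bij_imp_permutes)
    have i: "inj_on \<rho> {0..<r * k}" by (rule inj_onI, rule inj) auto
    have "\<rho> ` {0..<r * k} \<subseteq> {0..<r * k}" using \<rho>(3) by auto
    from endo_inj_surj[OF _ this i] show "bij_betw \<rho> {0..<r * k} {0..<r * k}"
      using i by (simp add: bij_betw_def)
  qed (simp add: \<rho>_def)
  \<comment> \<open>Positions with equal letters occur in order of increasing block, hence of
    increasing rank, so \<open>\<rho>\<close> inverts exactly the pairs that the word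
    inverts.\<close>
  have "(\<rho> a > \<rho> b) \<longleftrightarrow> (?l a > ?l b)" if "a < b" "b < r * k" for a b
  proof -
    have a: "a < r * k" using that by simp
    consider "?l a < ?l b" | "?l a > ?l b" | "?l a = ?l b" by linarith
    then show ?thesis
    proof cases
      case 1
      then have "\<rho> a < \<rho> b" using \<rho>(1)[OF a] \<rho>(1)[OF that(2)] by (metis div_le_mono leD linorder_not_less)
      then show ?thesis using 1 by simp
    next
      case 2
      then have "\<rho> b < \<rho> a" using \<rho>(1)[OF a] \<rho>(1)[OF that(2)] by (metis div_le_mono leD linorder_not_less)
      then show ?thesis using 2 by simp
    next
      case 3
      then have "?b a < ?b b" using blk_letter_lex[OF h that(1)] that unfolding m by simp
      then have "{j \<in> Is ! ?l a. j < ?b a} \<subseteq> {j \<in> Is ! ?l b. j < ?b b}" using 3 by auto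
      then have "?rank a \<le> ?rank b" using I(3)[OF lI(1)[OF that(2)]] by (intro card_mono) auto
      then show ?thesis using 3 a that by (simp add: \<rho>_def)
    qed
  qed
  then have "inv_pairs (r * k) \<rho> = {(a, b). a < b \<and> b < length (Sword n ?S) \<and> Sword n ?S ! a > Sword n ?S ! b}"
    unfolding inv_pairs_def length_Sword[OF h] m letter_def by auto
  then have sgn: "signof \<rho> = signS n ?S"
    using sign_eq_inv_pairs[OF perm] by (simp add: signS_def inversions_def)
  let ?f = "\<lambda>i a b. A $$ (b, pick (Is ! i) a)"
  let ?M = "mat (r * k) (r * k) (\<lambda>(p, q). if p div k = q div k then ?f (p div k) (p mod k) (q mod k) else 0)"
  have "bdet r k (\<lambda>p i. A $$ (i, ?b p)) ?l = det (mat (r * k) (r * k) (\<lambda>(i, j). ?M $$ (\<rho> i, j)))"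
    unfolding bdet_def
    by (intro arg_cong[where f = det] eq_matI) (auto simp: \<rho> rank_pick')
  also have "\<dots> = signof \<rho> * det ?M" by (rule det_permute_rows[OF _ perm]) simp
  also have "det ?M = (\<Prod>i<r. det (mat k k (\<lambda>(a, b). ?f i a b)))" by (rule det_block_diag[OF k])
  also have "\<dots> = (\<Prod>i<r. pl k (Is ! i) A)"
  proof (rule prod.cong)
    fix i assume "i \<in> {..<r}"
    then have i: "i < r" by simp
    have "{j. j < n \<and> j \<in> Is ! i} = Is ! i" using I[OF i] by auto
    then have "submatrix A {0..<k} (Is ! i) = transpose_mat (mat k k (\<lambda>(a, b). ?f i a b))"
      unfolding submatrix_def using A I[OF i]
      by (intro eq_matI) (auto simp: pick_eq_nth_sorted)
    then show "det (mat k k (\<lambda>(a, b). ?f i a b)) = pl k (Is ! i) A"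
      unfolding pl_def by (simp add: det_transpose[of _ k])
  qed simp
  also have "\<dots> = plprod k n Is A"
    using A len by (simp add: plprod_def prod_list_eq_prod_nth)
  finally show ?thesis using sgn by simp
qed

section \<open>The invariants of a matrix\<close>

interpretation fs: vector_space "fscale :: complex \<Rightarrow> ('a \<Rightarrow> complex) \<Rightarrow> 'a \<Rightarrow> complex"
  by unfold_locales (auto simp: fscale_def algebra_simps)

lemma sum_fun_apply: "(\<Sum>i\<in>I. f i) x = (\<Sum>i\<in>I. (f i x :: complex))"
  by (induction I rule: infinite_finite_induct) auto

text \<open>The \<open>x\<^sub>A\<close> of the overview, put to zero off the valid lists as
  \<open>Wspace\<close> requires.\<close>

definition evec :: "nat \<Rightarrow> nat \<Rightarrow> nat \<Rightarrow> (nat \<Rightarrow> nat) \<Rightarrow> complex mat \<Rightarrow> (nat \<Rightarrow> nat set) \<Rightarrow> complex" where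
  "evec k n r lam A S = (if validS n r lam S
     then bdet r k (\<lambda>p i. A $$ (i, blk n lam p)) (letter n S) else 0)"

text \<open>The Young subgroup of the composition \<open>lam\<close>.\<close>

definition young :: "nat \<Rightarrow> (nat \<Rightarrow> nat) \<Rightarrow> nat \<Rightarrow> (nat \<Rightarrow> nat) set" where
  "young n lam m = {\<sigma>. \<sigma> permutes {0..<m} \<and> (\<forall>p<m. blk n lam (\<sigma> p) = blk n lam p)}"

lemma finite_young [simp]: "finite (young n lam m)"
  unfolding young_def by (rule finite_subset[OF _ finite_permutations[of "{0..<m}"]]) auto

lemma young_inv:
  assumes "\<sigma> \<in> young n lam m"
  shows "inv_into UNIV \<sigma> \<in> young n lam m"
proof -
  have \<sigma>: "\<sigma> permutes {0..<m}" using assms by (simp add: young_def)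
  have "blk n lam (inv_into UNIV \<sigma> p) = blk n lam p" if "p < m" for p
  proof -
    have "inv_into UNIV \<sigma> p < m" by (rule permutes_lt[OF permutes_inv[OF \<sigma>] that])
    then have "blk n lam (\<sigma> (inv_into UNIV \<sigma> p)) = blk n lam (inv_into UNIV \<sigma> p)"
      using assms by (simp add: young_def)
    then show ?thesis by (simp add: permutes_inverses(1)[OF \<sigma>])
  qed
  then show ?thesis using permutes_inv[OF \<sigma>] by (simp add: young_def)
qed

lemma young_comp:
  assumes "\<sigma> \<in> young n lam m" "\<tau> \<in> young n lam m"
  shows "\<sigma> \<circ> \<tau> \<in> young n lam m"
proof -
  have \<tau>: "\<tau> permutes {0..<m}" using assms by (simp add: young_def)
  have "blk n lam (\<sigma> (\<tau> p)) = blk n lam p" if "p < m" for p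
    using assms permutes_lt[OF \<tau> that] that by (simp add: young_def)
  then show ?thesis using assms by (simp add: young_def permutes_compose)
qed

lemma finite_validS [simp]: "finite {S. validS n r lam S}"
proof (rule finite_subset)
  show "{S. validS n r lam S} \<subseteq> {S. \<forall>j. (j \<in> {0..<n} \<longrightarrow> S j \<in> Pow {0..<r}) \<and> (j \<notin> {0..<n} \<longrightarrow> S j = {})}"
    by (auto simp: validS_def)
  show "finite {S. \<forall>j. (j \<in> {0..<n} \<longrightarrow> S j \<in> Pow {0..<r}) \<and> (j \<notin> {0..<n} \<longrightarrow> S j = {})}"
    by (rule finite_set_of_finite_funs) auto
qed

lemma card_blk:
  assumes "j < n"
  shows "card {p \<in> {0..<(\<Sum>j<n. lam j)}. blk n lam p = j} = lam j"
proof -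
  \<comment> \<open>Any list with these cardinalities would do; it only makes
    \<open>blk_letter_bij\<close> applicable.\<close>
  let ?S = "\<lambda>j. {0..<lam j}"
  have "has_cards n lam ?S" by (simp add: has_cards_def)
  note bij = blk_letter_bij[OF this]
  let ?P = "{p \<in> {0..<(\<Sum>j<n. lam j)}. blk n lam p = j}"
  have "(\<lambda>p. (blk n lam p, letter n ?S p)) ` ?P = {j} \<times> {0..<lam j}"
  proof
    show "(\<lambda>p. (blk n lam p, letter n ?S p)) ` ?P \<subseteq> {j} \<times> {0..<lam j}"
      using bij by (auto simp: bij_betw_def)
    show "{j} \<times> {0..<lam j} \<subseteq> (\<lambda>p. (blk n lam p, letter n ?S p)) ` ?P"
    proof
      fix x assume x: "x \<in> {j} \<times> {0..<lam j}"
      then have "x \<in> (\<lambda>p. (blk n lam p, letter n ?S p)) ` {0..<(\<Sum>j<n. lam j)}"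
        using bij assms unfolding bij_betw_def by auto
      then show "x \<in> (\<lambda>p. (blk n lam p, letter n ?S p)) ` ?P" using x by auto
    qed
  qed
  moreover have "inj_on (\<lambda>p. (blk n lam p, letter n ?S p)) ?P"
    by (rule inj_on_subset[OF bij_betw_imp_inj_on[OF bij]]) auto
  ultimately show ?thesis using card_image[of "\<lambda>p. (blk n lam p, letter n ?S p)" ?P] by simp
qed

lemma letter_less:
  assumes "validS n r lam S" "p < (\<Sum>j<n. lam j)"
  shows "letter n S p < r"
proof -
  have "S (blk n lam p) \<subseteq> {0..<r}" using assms(1) blk_less[OF assms(2)] unfolding validS_def by blast
  then show ?thesis using letter_in[OF validS_has_cards[OF assms(1)] assms(2)] by auto
qed

text \<open>A word that is injective on each block amounts to the set of its letters in each block
  together with an arrangement of them. A sum over valid lists and Young permutations thereby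
  becomes a sum over words.\<close>

lemma block_injective_words:
  assumes m: "(\<Sum>j<n. lam j) = m"
  shows "bij_betw (\<lambda>(T, \<sigma>). restrict (letter n T \<circ> \<sigma>) {0..<m})
    ({T. validS n r lam T} \<times> young n lam m)
    {w \<in> words m r. \<forall>p<m. \<forall>q<m. blk n lam p = blk n lam q \<and> w p = w q \<longrightarrow> p = q}"
    (is "bij_betw ?\<Phi> (?V \<times> ?G) ?W")
proof -
  let ?b = "blk n lam"
  have bn: "?b p < n" if "p < m" for p using blk_less[of p lam n] that m by simp
  have inj: "p = q" if "validS n r lam T" "p < m" "q < m" "?b p = ?b q" "letter n T p = letter n T q" for T p q
    using that(2-)
    by (intro inj_onD[OF bij_betw_imp_inj_on[OF blk_letter_bij[OF validS_has_cards[OF that(1)]]]]) (simp_all add: m)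
  have surj: "\<exists>p<m. ?b p = j \<and> letter n T p = i" if "validS n r lam T" "j < n" "i \<in> T j" for T i j
  proof -
    have "(j, i) \<in> (\<lambda>p. (?b p, letter n T p)) ` {0..<m}"
      using blk_letter_bij[OF validS_has_cards[OF that(1)]] that(2-) unfolding m bij_betw_def by simp
    then show ?thesis by auto
  qed
  have mem: "letter n T p \<in> T (?b p)" if "validS n r lam T" "p < m" for T p
    using letter_in[OF validS_has_cards[OF that(1)]] that unfolding m by simp
  have G: "\<sigma> permutes {0..<m}" "\<And>p. p < m \<Longrightarrow> ?b (\<sigma> p) = ?b p" if "\<sigma> \<in> ?G" for \<sigma>
    using that by (auto simp: young_def)
  \<comment> \<open>The word determines the list, because rearranging inside a block leaves its set
    of letters unchanged; injectivity of the letters then determines the arrangement.\<close>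
  have T_eq: "T j = (if j < n then {w p | p. p < m \<and> ?b p = j} else {})"
    if T: "validS n r lam T" and \<sigma>: "\<sigma> \<in> ?G" and w: "w = restrict (letter n T \<circ> \<sigma>) {0..<m}" for T \<sigma> w j
  proof (cases "j < n")
    case True
    have "T j = {w p | p. p < m \<and> ?b p = j}"
    proof
      show "{w p | p. p < m \<and> ?b p = j} \<subseteq> T j"
      proof
        fix i assume "i \<in> {w p | p. p < m \<and> ?b p = j}"
        then obtain p where p: "i = w p" "p < m" "?b p = j" by auto
        then show "i \<in> T j" using mem[OF T, of "\<sigma> p"] permutes_lt[OF G(1)[OF \<sigma>], of p] G(2)[OF \<sigma>, of p] w by auto
      qed
      show "T j \<subseteq> {w p | p. p < m \<and> ?b p = j}"
      proof
        fix i assume "i \<in> T j"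
        then obtain q where q: "q < m" "?b q = j" "letter n T q = i" using surj[OF T True] by blast
        let ?p = "inv_into UNIV \<sigma> q"
        have p: "\<sigma> ?p = q" "?p < m"
          using permutes_inverses(1)[OF G(1)[OF \<sigma>]] permutes_lt[OF permutes_inv[OF G(1)[OF \<sigma>]] q(1)] by auto
        then show "i \<in> {w p | p. p < m \<and> ?b p = j}"
          using q w G(2)[OF \<sigma>, of ?p] by (auto intro!: exI[of _ ?p])
      qed
    qed
    then show ?thesis using True by simp
  next
    case False
    then show ?thesis using T by (simp add: validS_def)
  qed
  show ?thesis unfolding bij_betw_def
  proof
    show "inj_on ?\<Phi> (?V \<times> ?G)"
    proof (rule inj_onI)
      fix x y assume x: "x \<in> ?V \<times> ?G" and y: "y \<in> ?V \<times> ?G" and xy: "?\<Phi> x = ?\<Phi> y"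
      obtain T \<sigma> T' \<sigma>' where xy': "x = (T, \<sigma>)" "y = (T', \<sigma>')" by (cases x, cases y)
      have T: "validS n r lam T" "validS n r lam T'" and \<sigma>: "\<sigma> \<in> ?G" "\<sigma>' \<in> ?G"
        and eq: "restrict (letter n T \<circ> \<sigma>) {0..<m} = restrict (letter n T' \<circ> \<sigma>') {0..<m}"
        using x y xy unfolding xy' by simp_all
      have TT: "T = T'"
      proof
        fix j show "T j = T' j" using T_eq[OF T(1) \<sigma>(1) refl, of j] T_eq[OF T(2) \<sigma>(2) eq, of j] by simp
      qed
      have "\<sigma> p = \<sigma>' p" for p
      proof (cases "p < m")
        case True
        have "letter n T (\<sigma> p) = letter n T (\<sigma>' p)"
          using fun_cong[OF eq, of p] True TT by simp
        then show ?thesis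
          using G(2)[OF \<sigma>(1) True] G(2)[OF \<sigma>(2) True]
          by - (rule inj[OF T(1) permutes_lt[OF G(1)[OF \<sigma>(1)] True] permutes_lt[OF G(1)[OF \<sigma>(2)] True]], simp_all)
      next
        case False
        then show ?thesis using G(1)[OF \<sigma>(1)] G(1)[OF \<sigma>(2)] by (simp add: permutes_not_in)
      qed
      then show "x = y" unfolding xy' using TT by auto
    qed
    show "?\<Phi> ` (?V \<times> ?G) = ?W"
    proof
      show "?\<Phi> ` (?V \<times> ?G) \<subseteq> ?W"
      proof
        fix w assume "w \<in> ?\<Phi> ` (?V \<times> ?G)"
        then obtain T \<sigma> where T: "validS n r lam T" and \<sigma>: "\<sigma> \<in> ?G"
          and w: "w = restrict (letter n T \<circ> \<sigma>) {0..<m}" by auto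
        note g = G[OF \<sigma>]
        have "letter n T (\<sigma> p) < r" if "p < m" for p
          using letter_less[OF T] permutes_lt[OF g(1) that] m by simp
        moreover have "p = q" if "p < m" "q < m" "?b p = ?b q" "letter n T (\<sigma> p) = letter n T (\<sigma> q)" for p q
        proof -
          have "\<sigma> p = \<sigma> q"
            using inj[OF T permutes_lt[OF g(1) that(1)] permutes_lt[OF g(1) that(2)]] that g(2)[of p] g(2)[of q] by simp
          then show ?thesis using permutes_inj[OF g(1)] by (auto dest: injD)
        qed
        ultimately show "w \<in> ?W" unfolding w by simp
      qed
      show "?W \<subseteq> ?\<Phi> ` (?V \<times> ?G)"
      proof
        fix w assume w: "w \<in> ?W"
        then have wr: "w p < r" if "p < m" for p using that by (auto simp: PiE_iff)
        have winj: "p = q" if "p < m" "q < m" "?b p = ?b q" "w p = w q" for p q using w that by blast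
        define T where "T j = (if j < n then {w p | p. p < m \<and> ?b p = j} else {})" for j
        have T: "validS n r lam T"
          unfolding validS_def
        proof (intro conjI allI impI)
          fix j assume j: "j < n"
          show "T j \<subseteq> {0..<r}" using wr by (auto simp: T_def)
          have "T j = w ` {p \<in> {0..<m}. ?b p = j}" using j by (auto simp: T_def)
          moreover have "inj_on w {p \<in> {0..<m}. ?b p = j}" using winj by (auto simp: inj_on_def)
          ultimately show "card (T j) = lam j" using card_blk[OF j, of lam] m by (simp add: card_image)
        qed (auto simp: T_def)
        have ex: "\<exists>q<m. ?b q = ?b p \<and> letter n T q = w p" if "p < m" for p
          using surj[OF T bn[OF that], of "w p"] that bn[OF that] by (auto simp: T_def)
        define \<sigma> where "\<sigma> p = (if p < m then SOME q. q < m \<and> ?b q = ?b p \<and> letter n T q = w p else p)" for p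
        have \<sigma>: "\<sigma> p < m" "?b (\<sigma> p) = ?b p" "letter n T (\<sigma> p) = w p" if "p < m" for p
          using someI_ex[OF ex[OF that]] that by (auto simp: \<sigma>_def)
        have "\<sigma> permutes {0..<m}"
        proof (rule bij_imp_permutes)
          have i: "inj_on \<sigma> {0..<m}" 
          proof (rule inj_onI)
            fix p q assume "p \<in> {0..<m}" "q \<in> {0..<m}" "\<sigma> p = \<sigma> q"
            then show "p = q" using winj[of p q] \<sigma>(2,3)[of p] \<sigma>(2,3)[of q] by simp
          qed
          have "\<sigma> ` {0..<m} \<subseteq> {0..<m}" using \<sigma>(1) by auto
          from endo_inj_surj[OF _ this i] show "bij_betw \<sigma> {0..<m} {0..<m}"
            using i by (simp add: bij_betw_def)
        qed (simp add: \<sigma>_def)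
        then have "\<sigma> \<in> ?G" using \<sigma> by (simp add: young_def)
        moreover have "w = ?\<Phi> (T, \<sigma>)"
          using w \<sigma>(3) by (auto simp: PiE_iff extensional_def fun_eq_iff)
        ultimately show "w \<in> ?\<Phi> ` (?V \<times> ?G)" using T by blast
      qed
    qed
  qed
qed

text \<open>Only block-preserving permutations can have a nonzero Leibniz term. Both placements are
  used: on the column letters for the polynomial identity, on the row letters for the reindexing by
  words.\<close>

lemma prod_det_submatrix_young:
  fixes g :: "complex mat"
  assumes g: "g \<in> carrier_mat r r" and T: "validS n r lam T" and S: "validS n r lam S"
    and m: "(\<Sum>j<n. lam j) = m"
  shows "(\<Prod>j<n. det (submatrix g (T j) (S j))) =
      (\<Sum>\<sigma>\<in>young n lam m. signof \<sigma> * (\<Prod>p=0..<m. g $$ (letter n T p, letter n S (\<sigma> p))))"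
    and "(\<Prod>j<n. det (submatrix g (T j) (S j))) =
      (\<Sum>\<sigma>\<in>young n lam m. signof \<sigma> * (\<Prod>p=0..<m. g $$ (letter n T (\<sigma> p), letter n S p)))"
proof -
  let ?b = "blk n lam"
  let ?M = "mat m m (\<lambda>(p, q). if ?b p = ?b q then g $$ (letter n T p, letter n S q) else 0)"
  let ?\<Sigma> = "{\<sigma>. \<sigma> permutes {0..<m}}"
  have M: "(\<Prod>j<n. det (submatrix g (T j) (S j))) = det ?M"
    using prod_det_submatrix[OF g T S] m by simp
  have fin: "finite ?\<Sigma>" by (simp add: finite_permutations)
  have Y: "young n lam m = {\<sigma> \<in> ?\<Sigma>. \<forall>p<m. ?b (\<sigma> p) = ?b p}" by (auto simp: young_def)
  have *: "(\<Sum>\<sigma>\<in>?\<Sigma>. signof \<sigma> * (\<Prod>p=0..<m. if ?b (\<sigma> p) = ?b p then F \<sigma> p else 0))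
      = (\<Sum>\<sigma>\<in>young n lam m. signof \<sigma> * (\<Prod>p=0..<m. F \<sigma> p))" for F :: "_ \<Rightarrow> nat \<Rightarrow> complex"
    unfolding Y sum.inter_filter[OF fin]
  proof (intro sum.cong refl)
    fix \<sigma>
    show "signof \<sigma> * (\<Prod>p=0..<m. if ?b (\<sigma> p) = ?b p then F \<sigma> p else 0)
      = (if \<forall>p<m. ?b (\<sigma> p) = ?b p then signof \<sigma> * (\<Prod>p=0..<m. F \<sigma> p) else 0)"
      by (cases "\<forall>p<m. ?b (\<sigma> p) = ?b p") (auto intro!: prod_zero)
  qed
  show "(\<Prod>j<n. det (submatrix g (T j) (S j))) =
      (\<Sum>\<sigma>\<in>young n lam m. signof \<sigma> * (\<Prod>p=0..<m. g $$ (letter n T p, letter n S (\<sigma> p))))"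
    unfolding M *[symmetric]
    by (subst det_def'[of _ m]) (auto intro!: sum.cong prod.cong simp: permutes_lt)
  show "(\<Prod>j<n. det (submatrix g (T j) (S j))) =
      (\<Sum>\<sigma>\<in>young n lam m. signof \<sigma> * (\<Prod>p=0..<m. g $$ (letter n T (\<sigma> p), letter n S p)))"
    unfolding M *[symmetric]
    by (subst mat_det_left_def[of _ m]) (auto intro!: sum.cong prod.cong simp: permutes_lt)
qed

text \<open>Expanding the minors and absorbing each sign into a permutation of rows gives a sum over
  blockwise injective words. After the remaining words are added, \<open>bdet_transform\<close>
  returns det(g)^k, which is 1.\<close>

lemma evec_in_Wspace:
  assumes m: "(\<Sum>j<n. lam j) = r * k"
  shows "evec k n r lam A \<in> Wspace n r lam"
proof -
  let ?m = "r * k" and ?b = "blk n lam"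
  let ?a = "\<lambda>p i. A $$ (i, ?b p)"
  let ?V = "{T. validS n r lam T}" and ?G = "young n lam (r * k)"
  let ?W = "{w \<in> words ?m r. \<forall>p<?m. \<forall>q<?m. ?b p = ?b q \<and> w p = w q \<longrightarrow> p = q}"
  have "(\<Sum>T\<in>?V. evec k n r lam A T * (\<Prod>j<n. det (submatrix g (T j) (S j)))) = evec k n r lam A S"
    if g: "g \<in> carrier_mat r r" "det g = 1" and S: "validS n r lam S" for g S
  proof -
    let ?F = "\<lambda>w. bdet r k ?a w * (\<Prod>p=0..<?m. g $$ (w p, letter n S p))"
    have "(\<Sum>T\<in>?V. evec k n r lam A T * (\<Prod>j<n. det (submatrix g (T j) (S j))))
      = (\<Sum>T\<in>?V. \<Sum>\<sigma>\<in>?G. ?F (restrict (letter n T \<circ> \<sigma>) {0..<?m}))"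
    proof (rule sum.cong[OF refl])
      fix T assume "T \<in> ?V"
      then have T: "validS n r lam T" by simp
      have "signof \<sigma> * bdet r k ?a (letter n T) = bdet r k ?a (restrict (letter n T \<circ> \<sigma>) {0..<?m})"
        if "\<sigma> \<in> ?G" for \<sigma>
      proof -
        have "bdet r k ?a (restrict (letter n T \<circ> \<sigma>) {0..<?m}) = bdet r k (\<lambda>p. ?a (\<sigma> p)) (letter n T \<circ> \<sigma>)"
          using that by (intro bdet_cong) (auto simp: young_def)
        then show ?thesis using that using bdet_permute[of \<sigma> r k ?a "letter n T"] by (simp add: young_def)
      qed
      then show "evec k n r lam A T * (\<Prod>j<n. det (submatrix g (T j) (S j)))
        = (\<Sum>\<sigma>\<in>?G. ?F (restrict (letter n T \<circ> \<sigma>) {0..<?m}))"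
        unfolding prod_det_submatrix_young(2)[OF g(1) T S m] sum_distrib_left
        using T by (intro sum.cong refl) (simp add: evec_def mult_ac flip: mult.assoc)
    qed
    also have "\<dots> = (\<Sum>x\<in>?V \<times> ?G. ?F ((\<lambda>(T, \<sigma>). restrict (letter n T \<circ> \<sigma>) {0..<?m}) x))"
      by (simp add: sum.cartesian_product split_def)
    also have "\<dots> = (\<Sum>w\<in>?W. ?F w)"
      by (rule sum.reindex_bij_betw[OF block_injective_words[OF m]])
    also have "\<dots> = (\<Sum>w\<in>words ?m r. ?F w)"
    proof (rule sum.mono_neutral_left)
      \<comment> \<open>Equal letters in one block give equal rows, since the column of a row
        depends only on its block.\<close>
      show "\<forall>w\<in>words ?m r - ?W. ?F w = 0"
      proof
        fix w assume "w \<in> words ?m r - ?W"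
        then obtain p q where "p < ?m" "q < ?m" "?b p = ?b q" "w p = w q" "p \<noteq> q" by blast
        then have "bdet r k ?a w = 0" by (intro bdet_equal_rows[of p r k q]) auto
        then show "?F w = 0" by simp
      qed
    qed auto
    also have "\<dots> = det g ^ k * bdet r k ?a (letter n S)"
      using letter_less[OF S] m by (intro bdet_transform g) auto
    finally show ?thesis using g S by (simp add: evec_def)
  qed
  then show ?thesis unfolding Wspace_def by (auto simp: evec_def)
qed

section \<open>Invariance as a polynomial identity\<close>

lemma bsign_cong:
  assumes "\<And>p. p < r * k \<Longrightarrow> l p = l' p" "\<And>p. p < r * k \<Longrightarrow> v p = v' p"
  shows "bsign r k l v = bsign r k l' v'"
  unfolding bsign_def by (rule bdet_cong) (use assms in auto)

lemma words_comp_bij: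
  assumes \<sigma>: "\<sigma> permutes {0..<m}"
  shows "bij_betw (\<lambda>l. l \<circ> \<sigma>) (words m k) (words m k)"
proof (rule bij_betw_byWitness[where f' = "\<lambda>l. l \<circ> inv_into UNIV \<sigma>"])
  have *: "(\<lambda>l. l \<circ> \<tau>) ` words m k \<subseteq> words m k" if \<tau>: "\<tau> permutes {0..<m}" for \<tau>
  proof clarify
    fix l assume l: "l \<in> words m k"
    show "l \<circ> \<tau> \<in> words m k"
    proof (rule PiE_I)
      show "(l \<circ> \<tau>) p \<in> {0..<k}" if "p \<in> {0..<m}" for p
        using l permutes_in_image[OF \<tau>, of p] that by (auto simp: PiE_iff)
      show "(l \<circ> \<tau>) p = undefined" if "p \<notin> {0..<m}" for p
        using l permutes_not_in[OF \<tau> that] that by (auto simp: PiE_iff extensional_def)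
    qed
  qed
  show "(\<lambda>l. l \<circ> \<sigma>) ` words m k \<subseteq> words m k" by (rule *[OF \<sigma>])
  show "(\<lambda>l. l \<circ> inv_into UNIV \<sigma>) ` words m k \<subseteq> words m k" by (rule *[OF permutes_inv[OF \<sigma>]])
  show "\<forall>l\<in>words m k. l \<circ> \<sigma> \<circ> inv_into UNIV \<sigma> = l"
    using permutes_inv_o(1)[OF \<sigma>] by (simp add: comp_assoc)
  show "\<forall>l\<in>words m k. l \<circ> inv_into UNIV \<sigma> \<circ> \<sigma> = l"
    using permutes_inv_o(2)[OF \<sigma>] by (simp add: comp_assoc)
qed

lemma young_left_translate:
  assumes \<tau>: "\<tau> \<in> young n lam m"
  shows "bij_betw (\<lambda>\<sigma>. \<tau> \<circ> \<sigma>) (young n lam m) (young n lam m)"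
proof (rule bij_betw_byWitness[where f' = "\<lambda>\<sigma>. inv_into UNIV \<tau> \<circ> \<sigma>"])
  have p: "\<tau> permutes {0..<m}" using \<tau> by (simp add: young_def)
  show "\<forall>\<sigma>\<in>young n lam m. inv_into UNIV \<tau> \<circ> (\<tau> \<circ> \<sigma>) = \<sigma>"
    using permutes_inv_o(2)[OF p] by (simp add: o_assoc)
  show "\<forall>\<sigma>\<in>young n lam m. \<tau> \<circ> (inv_into UNIV \<tau> \<circ> \<sigma>) = \<sigma>"
    using permutes_inv_o(1)[OF p] by (simp add: o_assoc)
qed (use \<tau> young_inv young_comp in blast)+

text \<open>Antisymmetrising the letters inside the blocks amounts to symmetrising the labels, which by
polarisation is a combination of determinants built from the columns of \<open>k \<times> n\<close> matrices.\<close>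

lemma young_antisymmetrisation:
  assumes l: "l \<in> words (r * k) k"
  obtains Z :: "((nat \<Rightarrow> nat) \<times> nat set) set" and e A where "finite Z"
    and "\<And>v. (\<Sum>\<sigma>\<in>young n lam (r * k). signof \<sigma> * bsign r k l (v \<circ> \<sigma>))
      = (\<Sum>z\<in>Z. e z * bdet r k (\<lambda>p i. A z i (blk n lam p)) v)"
proof -
  let ?m = "r * k" and ?G = "young n lam (r * k)"
  \<comment> \<open>Counts the block-preserving rearrangements of \<open>u\<close> that yield
    \<open>l\<close>. It is invariant under the Young subgroup, so it can be polarised with the
    block as colour.\<close>
  define s :: "(nat \<Rightarrow> nat) \<Rightarrow> complex" where
    "s u = (\<Sum>\<sigma>\<in>?G. if \<forall>p<?m. u (\<sigma> p) = l p then 1 else 0)" for u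
  obtain Z :: "((nat \<Rightarrow> nat) \<times> nat set) set" and e A where Z: "finite Z"
    "\<And>u. (\<And>p. p < ?m \<Longrightarrow> u p \<in> {0..<k}) \<Longrightarrow> s u = (\<Sum>z\<in>Z. e z * (\<Prod>p=0..<?m. A z (u p) (blk n lam p)))"
  proof (rule symmetric_eq_sum_products[of "{0..<k}" ?m s "blk n lam"])
    show "s u = s u'" if "\<And>p. p < ?m \<Longrightarrow> u p = u' p" for u u'
    proof -
      have "(\<forall>p<?m. u (\<sigma> p) = l p) = (\<forall>p<?m. u' (\<sigma> p) = l p)" if "\<sigma> \<in> ?G" for \<sigma>
        using \<open>\<And>p. p < ?m \<Longrightarrow> u p = u' p\<close> permutes_lt[of \<sigma> ?m] that by (auto simp: young_def)
      then show ?thesis unfolding s_def by (intro sum.cong refl) simp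
    qed
    show "s (u \<circ> \<tau>) = s u" if "\<tau> permutes {0..<?m}" "\<And>p. p < ?m \<Longrightarrow> blk n lam (\<tau> p) = blk n lam p" for u \<tau>
    proof -
      have \<tau>: "\<tau> \<in> ?G" using that by (simp add: young_def)
      show ?thesis unfolding s_def
        using sum.reindex_bij_betw[OF young_left_translate[OF \<tau>],
          of "\<lambda>\<sigma>. if \<forall>p<?m. u (\<sigma> p) = l p then 1 else 0"] by simp
    qed
  qed auto
  show thesis
  proof (rule that[OF Z(1)])
    fix v
    have "signof \<sigma> * bsign r k l (v \<circ> \<sigma>)
        = (\<Sum>u\<in>words ?m k. (if \<forall>p<?m. u (\<sigma> p) = l p then 1 else 0) * bsign r k u v)" if "\<sigma> \<in> ?G" for \<sigma>
    proof -
      have \<sigma>: "\<sigma> permutes {0..<?m}" using that by (simp add: young_def)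
      \<comment> \<open>Permuting labels and letters together costs just the sign; this moves
        \<open>\<sigma>\<close> from the letters to the labels, where \<open>s\<close> collects
        it.\<close>
      have "(\<Sum>u\<in>words ?m k. (if \<forall>p<?m. u (\<sigma> p) = l p then 1 else 0) * bsign r k u v)
        = (\<Sum>u\<in>words ?m k. signof \<sigma> * ((if \<forall>p<?m. (u \<circ> \<sigma>) p = l p then 1 else 0) * bsign r k (u \<circ> \<sigma>) (v \<circ> \<sigma>)))"
        unfolding bsign_permute[OF \<sigma>] by (intro sum.cong refl) (simp flip: mult.assoc of_int_mult)
      also have "\<dots> = (\<Sum>u\<in>words ?m k. signof \<sigma> * ((if \<forall>p<?m. u p = l p then 1 else 0) * bsign r k u (v \<circ> \<sigma>)))"
        by (rule sum.reindex_bij_betw[OF words_comp_bij[OF \<sigma>]])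
      also have "\<dots> = (\<Sum>u\<in>words ?m k. if u = l then signof \<sigma> * bsign r k l (v \<circ> \<sigma>) else 0)"
      proof (intro sum.cong refl)
        fix u assume u: "u \<in> words ?m k"
        have "(\<forall>p<?m. u p = l p) \<longleftrightarrow> u = l"
        proof
          assume *: "\<forall>p<?m. u p = l p"
          show "u = l" by (rule PiE_ext[OF u l]) (use * in auto)
        qed simp
        then show "signof \<sigma> * ((if \<forall>p<?m. u p = l p then 1 else 0) * bsign r k u (v \<circ> \<sigma>))
          = (if u = l then signof \<sigma> * bsign r k l (v \<circ> \<sigma>) else 0)" by simp
      qed
      also have "\<dots> = signof \<sigma> * bsign r k l (v \<circ> \<sigma>)" using l by simp
      finally show ?thesis by simp
    qed
    then have "(\<Sum>\<sigma>\<in>?G. signof \<sigma> * bsign r k l (v \<circ> \<sigma>))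
        = (\<Sum>\<sigma>\<in>?G. \<Sum>u\<in>words ?m k. (if \<forall>p<?m. u (\<sigma> p) = l p then 1 else 0) * bsign r k u v)"
      by (intro sum.cong refl)
    also have "\<dots> = (\<Sum>u\<in>words ?m k. s u * bsign r k u v)"
      unfolding s_def sum_distrib_right by (rule sum.swap)
    also have "\<dots> = (\<Sum>u\<in>words ?m k. \<Sum>z\<in>Z. e z * ((\<Prod>p=0..<?m. A z (u p) (blk n lam p)) * bsign r k u v))"
      by (intro sum.cong refl) (simp add: Z(2) PiE_iff sum_distrib_right mult.assoc)
    also have "\<dots> = (\<Sum>z\<in>Z. e z * bdet r k (\<lambda>p i. A z i (blk n lam p)) v)"
      unfolding bdet_expand[of r k "\<lambda>p i. A z i (blk n lam p)" v for z] sum_distrib_left by (rule sum.swap)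
    finally show "(\<Sum>\<sigma>\<in>?G. signof \<sigma> * bsign r k l (v \<circ> \<sigma>))
      = (\<Sum>z\<in>Z. e z * bdet r k (\<lambda>p i. A z i (blk n lam p)) v)" .
  qed
qed

lemma complex_root_exists:
  assumes "r > 0"
  obtains c :: complex where "c ^ r = z"
proof
  have "rcis (root r (cmod z)) (Arg z / real r) ^ r = rcis (root r (cmod z) ^ r) (real r * (Arg z / real r))"
    by (rule DeMoivre2)
  also have "\<dots> = z" using assms by (simp add: rcis_cmod_Arg)
  finally show "rcis (root r (cmod z)) (Arg z / real r) ^ r = z" .
qed

text \<open>Dividing \<open>g\<close> by an r-th root c of its determinant reaches SL, and both
  sides equal c^(r k) times \<open>bsign r k l v * x S\<close>. Pairing \<open>x\<close> with a
  second invariant is what makes the determinant disappear from the statement.\<close>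

lemma Wspace_GL_identity:
  assumes x: "x \<in> Wspace n r lam" and r: "r > 0" and m: "(\<Sum>j<n. lam j) = r * k"
    and g: "g \<in> carrier_mat r r" "det g \<noteq> 0"
    and S: "validS n r lam S" and v: "\<And>p. p < r * k \<Longrightarrow> v p < r"
  shows "bsign r k l v * (\<Sum>T | validS n r lam T. x T * (\<Prod>j<n. det (submatrix g (T j) (S j))))
    = x S * (\<Sum>w\<in>words (r * k) r. bsign r k l w * (\<Prod>p=0..<r * k. g $$ (w p, v p)))"
proof -
  obtain c where c: "c ^ r = det g" using complex_root_exists[OF r] .
  have c0: "c \<noteq> 0" using c g(2) r by (auto simp: zero_power)
  define h where "h = (1 / c) \<cdot>\<^sub>m g"
  have h: "h \<in> carrier_mat r r" using g by (simp add: h_def)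
  have gh: "g = c \<cdot>\<^sub>m h" unfolding h_def using c0 by (intro eq_matI) auto
  have dh: "det h = 1" unfolding h_def using g c c0 by (simp add: power_one_over)
  have "(\<Prod>j<n. det (submatrix g (T j) (S j))) = c ^ (r * k) * (\<Prod>j<n. det (submatrix h (T j) (S j)))"
    if T: "validS n r lam T" for T
  proof -
    let ?P = "\<lambda>g. mat (r * k) (r * k) (\<lambda>(p, q). if blk n lam p = blk n lam q then g $$ (letter n T p, letter n S q) else 0)"
    have "?P g = c \<cdot>\<^sub>m ?P h"
      using letter_less[OF T] letter_less[OF S] m h by (intro eq_matI) (auto simp: gh)
    then show ?thesis
      unfolding prod_det_submatrix[OF g(1) T S] prod_det_submatrix[OF h T S] m by simp
  qed
  then have "(\<Sum>T | validS n r lam T. x T * (\<Prod>j<n. det (submatrix g (T j) (S j))))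
      = c ^ (r * k) * (\<Sum>T | validS n r lam T. x T * (\<Prod>j<n. det (submatrix h (T j) (S j))))"
    unfolding sum_distrib_left by (intro sum.cong refl) simp
  also have "(\<Sum>T | validS n r lam T. x T * (\<Prod>j<n. det (submatrix h (T j) (S j)))) = x S"
    using x h dh S unfolding Wspace_def by blast
  finally have 1: "(\<Sum>T | validS n r lam T. x T * (\<Prod>j<n. det (submatrix g (T j) (S j)))) = c ^ (r * k) * x S" .
  have "(\<Prod>p=0..<r * k. g $$ (w p, v p)) = c ^ (r * k) * (\<Prod>p=0..<r * k. h $$ (w p, v p))"
    if "w \<in> words (r * k) r" for w
  proof -
    have "(\<Prod>p=0..<r * k. g $$ (w p, v p)) = (\<Prod>p=0..<r * k. c * h $$ (w p, v p))"
      using that v h by (intro prod.cong refl) (auto simp: gh PiE_iff)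
    then show ?thesis by (simp add: prod.distrib)
  qed
  then have "(\<Sum>w\<in>words (r * k) r. bsign r k l w * (\<Prod>p=0..<r * k. g $$ (w p, v p)))
      = c ^ (r * k) * (\<Sum>w\<in>words (r * k) r. bsign r k l w * (\<Prod>p=0..<r * k. h $$ (w p, v p)))"
    unfolding sum_distrib_left by (intro sum.cong refl) simp
  also have "(\<Sum>w\<in>words (r * k) r. bsign r k l w * (\<Prod>p=0..<r * k. h $$ (w p, v p))) = bsign r k l v"
    unfolding bsign_def by (subst bdet_transform[OF h v]) (auto simp: dh)
  finally show ?thesis unfolding 1 by (simp add: mult_ac)
qed

text \<open>The sum is the Gram operator of the \<open>D\<^sub>l\<close> applied to the one with
  label \<open>l\<^sub>0\<close>. Pairing it once more with that \<open>D\<close> gives a sum of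
  squares of real numbers, whose term at \<open>l\<^sub>0\<close> is the square of a positive
  squared norm; so some coordinate \<open>v\<close> is nonzero.\<close>

lemma bsign_gram_nonzero:
  fixes r k :: nat
  defines "l\<^sub>0 \<equiv> \<lambda>p. p mod k"
  obtains v where "v \<in> words (r * k) r"
    "(\<Sum>w\<in>words (r * k) r. bsign r k l\<^sub>0 w * (\<Sum>l\<in>words (r * k) k. bsign r k l w * bsign r k l v)) \<noteq> 0"
proof -
  let ?m = "r * k"
  let ?b = "\<lambda>l v. Re (bsign r k l v)"
  have re: "bsign r k l v = of_real (?b l v)" for l v
    using bsign_real[of r k l v] by (simp add: complex_eq_iff)
  let ?\<gamma> = "\<lambda>v. \<Sum>w\<in>words ?m r. bsign r k l\<^sub>0 w * (\<Sum>l\<in>words ?m k. bsign r k l w * bsign r k l v)"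
  have "(\<Sum>v\<in>words ?m r. bsign r k l\<^sub>0 v * ?\<gamma> v)
      = (\<Sum>v\<in>words ?m r. \<Sum>w\<in>words ?m r. \<Sum>l\<in>words ?m k. bsign r k l\<^sub>0 v * (bsign r k l\<^sub>0 w * (bsign r k l w * bsign r k l v)))"
    by (simp add: sum_distrib_left)
  also have "\<dots> = (\<Sum>v\<in>words ?m r. \<Sum>l\<in>words ?m k. \<Sum>w\<in>words ?m r. bsign r k l\<^sub>0 v * (bsign r k l\<^sub>0 w * (bsign r k l w * bsign r k l v)))"
    by (intro sum.cong refl sum.swap)
  also have "\<dots> = (\<Sum>l\<in>words ?m k. \<Sum>v\<in>words ?m r. \<Sum>w\<in>words ?m r. bsign r k l\<^sub>0 v * (bsign r k l\<^sub>0 w * (bsign r k l w * bsign r k l v)))"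
    by (rule sum.swap)
  also have "\<dots> = (\<Sum>l\<in>words ?m k. (\<Sum>w\<in>words ?m r. bsign r k l\<^sub>0 w * bsign r k l w)\<^sup>2)"
    by (simp add: power2_eq_square sum_product mult_ac)
  also have "\<dots> = of_real (\<Sum>l\<in>words ?m k. (\<Sum>w\<in>words ?m r. ?b l\<^sub>0 w * ?b l w)\<^sup>2)"
    unfolding of_real_sum of_real_power of_real_mult re[symmetric] ..
  finally have eq: "(\<Sum>v\<in>words ?m r. bsign r k l\<^sub>0 v * ?\<gamma> v)
    = of_real (\<Sum>l\<in>words ?m k. (\<Sum>w\<in>words ?m r. ?b l\<^sub>0 w * ?b l w)\<^sup>2)" .
  have k: "p mod k < k" "p div k < r" if "p < ?m" for p
    using transp_index_bounds[OF that] by auto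
  \<comment> \<open>Words are extensional, hence the restrictions. This label and this word together
    produce the identity matrix, where \<open>bsign\<close> is 1.\<close>
  let ?l = "restrict l\<^sub>0 {0..<?m}" and ?v = "restrict (\<lambda>p. p div k) {0..<?m}"
  have l: "?l \<in> words ?m k" and v: "?v \<in> words ?m r" using k by (auto simp: l\<^sub>0_def)
  have bl: "bsign r k ?l w = bsign r k l\<^sub>0 w" for w by (rule bsign_cong) auto
  have "bsign r k l\<^sub>0 ?v = bsign r k l\<^sub>0 (\<lambda>p. p div k)" by (rule bsign_cong) auto
  then have one: "?b l\<^sub>0 ?v = 1" using bsign_standard[of r k] by (simp add: l\<^sub>0_def)
  have "0 < (\<Sum>w\<in>words ?m r. ?b l\<^sub>0 w * ?b l\<^sub>0 w)"
    by (rule sum_pos2[OF _ v]) (use one in auto)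
  then have "0 < (\<Sum>w\<in>words ?m r. ?b l\<^sub>0 w * ?b ?l w)\<^sup>2" unfolding bl by simp
  then have "0 < (\<Sum>l\<in>words ?m k. (\<Sum>w\<in>words ?m r. ?b l\<^sub>0 w * ?b l w)\<^sup>2)"
    by (intro sum_pos2[OF _ l]) auto
  then have "(\<Sum>v\<in>words ?m r. bsign r k l\<^sub>0 v * ?\<gamma> v) \<noteq> 0" unfolding eq of_real_eq_0_iff by simp
  then obtain v where "v \<in> words ?m r" "bsign r k l\<^sub>0 v * ?\<gamma> v \<noteq> 0"
    by (rule sum.not_neutral_contains_not_neutral)
  then show thesis using that[of v] by simp
qed

section \<open>Invariants and the pairing\<close>

lemma fspan_imageE:
  assumes "x \<in> fspan (F ` X)"
  obtains T c where "finite T" "T \<subseteq> X" "x = (\<lambda>a. \<Sum>t\<in>T. c t * F t a)"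
proof -
  obtain t s where t: "finite t" "t \<subseteq> F ` X" "x = (\<Sum>a\<in>t. fscale (s a) a)"
    using assms unfolding fs.span_explicit by blast
  obtain U where U: "U \<subseteq> X" "inj_on F U" "t = F ` U" using t(2) unfolding subset_image_inj by blast
  show thesis
  proof (rule that[of U "\<lambda>u. s (F u)"])
    show "finite U" using t U finite_imageD by blast
    show "x = (\<lambda>a. \<Sum>u\<in>U. s (F u) * F u a)"
      unfolding t(3) U(3) sum.reindex[OF U(2)] by (simp add: fun_eq_iff sum_fun_apply fscale_def)
  qed (rule U(1))
qed

lemma fspan_sumI:
  assumes "finite T" "\<And>t. t \<in> T \<Longrightarrow> F t \<in> fspan X" "\<And>a. x a = (\<Sum>t\<in>T. c t * F t a)"
  shows "x \<in> fspan X"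
proof -
  have "x = (\<Sum>t\<in>T. fscale (c t) (F t))" by (rule ext) (simp add: assms(3) sum_fun_apply fscale_def)
  then show ?thesis using assms(2) by (auto intro!: fs.span_sum fs.span_scale)
qed

lemma subspace_Wspace: "fs.subspace (Wspace n r lam)"
proof (unfold fs.subspace_def, intro conjI ballI allI)
  show "0 \<in> Wspace n r lam" by (simp add: Wspace_def)
  show "x + y \<in> Wspace n r lam" if "x \<in> Wspace n r lam" "y \<in> Wspace n r lam" for x y
    using that by (simp add: Wspace_def sum.distrib distrib_right)
  show "fscale c x \<in> Wspace n r lam" if "x \<in> Wspace n r lam" for c x
    using that by (simp add: Wspace_def fscale_def mult.assoc flip: sum_distrib_left)
qed

text \<open>A reproducing formula: polarising the GL identity with the Gram kernel turns the side of
  \<open>D\<close> into \<open>x S\<close> times a nonzero constant, while on the other side the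
  kernel separates \<open>T\<close> from \<open>S\<close> and leaves a combination of the functions
  \<open>E l\<close> with coefficients that do not involve \<open>S\<close>.\<close>

lemma Wspace_subset_span:
  assumes x: "x \<in> Wspace n r lam" and r: "r > 0" and m: "(\<Sum>j<n. lam j) = r * k"
  shows "x \<in> fspan (evec k n r lam ` carrier_mat k n)"
proof -
  let ?m = "r * k" and ?G = "young n lam (r * k)" and ?V = "{T. validS n r lam T}"
  define D where "D = bsign r k (\<lambda>p. p mod k)"
  obtain v where v: "v \<in> words ?m r"
    and \<gamma>: "(\<Sum>w\<in>words ?m r. D w * (\<Sum>l\<in>words ?m k. bsign r k l w * bsign r k l v)) \<noteq> 0" (is "?\<gamma> \<noteq> 0")
    unfolding D_def by (rule bsign_gram_nonzero)
  have vr: "v p < r" if "p < ?m" for p using v that by (auto simp: PiE_iff)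
  \<comment> \<open>A single \<open>bsign r k l\<close> need not come from a matrix, since its
    labels may vary inside a block; antisymmetrising over the Young subgroup repairs this.\<close>
  define E where "E l S = (if validS n r lam S then \<Sum>\<sigma>\<in>?G. signof \<sigma> * bsign r k l (letter n S \<circ> \<sigma>) else 0)" for l S
  define s where "s u = (\<Sum>l\<in>words ?m k. bsign r k l (\<lambda>p. fst (u p)) * bsign r k l (\<lambda>p. snd (u p)))"
    for u :: "nat \<Rightarrow> nat \<times> nat"
  \<comment> \<open>Once the labels are permuted along, both factors of the kernel change by the
    same sign.\<close>
  have s_sym: "s (u \<circ> \<sigma>) = s u" if \<sigma>: "\<sigma> permutes {0..<?m}" for u \<sigma>
  proof -
    let ?f = "\<lambda>l. bsign r k l ((\<lambda>p. fst (u p)) \<circ> \<sigma>) * bsign r k l ((\<lambda>p. snd (u p)) \<circ> \<sigma>)"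
    have "s (u \<circ> \<sigma>) = (\<Sum>l\<in>words ?m k. ?f l)" unfolding s_def by (simp add: o_def)
    also have "\<dots> = (\<Sum>l\<in>words ?m k. ?f (l \<circ> \<sigma>))"
      by (rule sum.reindex_bij_betw[OF words_comp_bij[OF \<sigma>], symmetric])
    also have "\<dots> = s u"
      unfolding s_def bsign_permute[OF \<sigma>] by (intro sum.cong refl) (simp add: sign_def)
    finally show ?thesis .
  qed
  have s_cong: "s u = s u'" if "\<And>p. p < ?m \<Longrightarrow> u p = u' p" for u u'
    unfolding s_def by (intro sum.cong refl arg_cong2[where f = "(*)"] bsign_cong) (auto simp: that)
  have key: "x S * ?\<gamma> = (\<Sum>l\<in>words ?m k. D v * (\<Sum>T\<in>?V. x T * bsign r k l (letter n T)) * E l S)"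
    if S: "validS n r lam S" for S
  proof -
    \<comment> \<open>The monomials of both sides of the GL identity as one family:
      \<open>Inl\<close> indexes the action on \<open>x\<close>, \<open>Inr\<close> the action on
      \<open>D\<close>, entered with a minus sign.\<close>
    define Z where "Z = (?V \<times> ?G) <+> words ?m r"
    define h where "h z = (case z of Inl (T, \<sigma>) \<Rightarrow> D v * x T * signof \<sigma> | Inr w \<Rightarrow> - x S * D w)"
      for z :: "(nat \<Rightarrow> nat set) \<times> (nat \<Rightarrow> nat) + (nat \<Rightarrow> nat)"
    define u where "u z p = (case z of Inl (T, \<sigma>) \<Rightarrow> (letter n T p, letter n S (\<sigma> p)) | Inr w \<Rightarrow> (w p, v p))"
      for z :: "(nat \<Rightarrow> nat set) \<times> (nat \<Rightarrow> nat) + (nat \<Rightarrow> nat)" and p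
    have split: "(\<Sum>z\<in>Z. h z * F (u z)) =
        D v * (\<Sum>T\<in>?V. x T * (\<Sum>\<sigma>\<in>?G. signof \<sigma> * F (\<lambda>p. (letter n T p, letter n S (\<sigma> p)))))
        - x S * (\<Sum>w\<in>words ?m r. D w * F (\<lambda>p. (w p, v p)))" for F
    proof -
      have "(\<Sum>z\<in>Z. h z * F (u z)) = (\<Sum>y\<in>?V \<times> ?G. h (Inl y) * F (u (Inl y))) + (\<Sum>w\<in>words ?m r. h (Inr w) * F (u (Inr w)))"
        unfolding Z_def by (subst sum.Plus) auto
      moreover have "(\<Sum>y\<in>?V \<times> ?G. h (Inl y) * F (u (Inl y)))
          = D v * (\<Sum>T\<in>?V. x T * (\<Sum>\<sigma>\<in>?G. signof \<sigma> * F (\<lambda>p. (letter n T p, letter n S (\<sigma> p)))))"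
        unfolding sum.cartesian_product' h_def u_def by (simp add: sum_distrib_left mult.assoc)
      moreover have "(\<Sum>w\<in>words ?m r. h (Inr w) * F (u (Inr w))) = - (x S * (\<Sum>w\<in>words ?m r. D w * F (\<lambda>p. (w p, v p))))"
        unfolding h_def u_def by (simp add: sum_distrib_left sum_negf mult.assoc)
      ultimately show ?thesis by simp
    qed
    have "(\<Sum>z\<in>Z. h z * s (u z)) = 0"
    proof (rule matrix_polynomial_symmetric[where m = ?m and r = r])
      show "u z p \<in> {0..<r} \<times> {0..<r}" if z: "z \<in> Z" and p: "p < ?m" for z p
      proof (cases z)
        case (Inl y)
        obtain T \<sigma> where y: "y = (T, \<sigma>)" by (cases y)
        have T: "validS n r lam T" "\<sigma> permutes {0..<?m}" using z Inl y by (auto simp: Z_def young_def)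
        have "\<sigma> p < ?m" by (rule permutes_lt[OF T(2) p])
        then have "letter n S (\<sigma> p) < r" using letter_less[OF S, of "\<sigma> p"] m by simp
        moreover have "letter n T p < r" using letter_less[OF T(1), of p] m p by simp
        ultimately show ?thesis using Inl y by (simp add: u_def)
      next
        case (Inr w)
        then have "w p < r" using z p by (auto simp: Z_def PiE_iff)
        then show ?thesis using Inr vr[OF p] by (simp add: u_def)
      qed
      show "(\<Sum>z\<in>Z. h z * (\<Prod>p=0..<?m. g $$ u z p)) = 0" if g: "g \<in> carrier_mat r r" "det g \<noteq> 0" for g
      proof -
        have "(\<Sum>T\<in>?V. x T * (\<Prod>j<n. det (submatrix g (T j) (S j))))
          = (\<Sum>T\<in>?V. x T * (\<Sum>\<sigma>\<in>?G. signof \<sigma> * (\<Prod>p=0..<?m. g $$ (letter n T p, letter n S (\<sigma> p)))))"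
          by (intro sum.cong refl) (simp add: prod_det_submatrix_young(1)[OF g(1) _ S m])
        then show ?thesis
          using Wspace_GL_identity[OF x r m g S vr, where l = "\<lambda>p. p mod k"]
          unfolding split[of "\<lambda>u. \<Prod>p=0..<?m. g $$ u p"] D_def by simp
      qed
    qed (use s_sym s_cong in blast)+
    then have "x S * (\<Sum>w\<in>words ?m r. D w * s (\<lambda>p. (w p, v p)))
        = D v * (\<Sum>T\<in>?V. x T * (\<Sum>\<sigma>\<in>?G. signof \<sigma> * s (\<lambda>p. (letter n T p, letter n S (\<sigma> p)))))"
      unfolding split by simp
    also have "(\<Sum>w\<in>words ?m r. D w * s (\<lambda>p. (w p, v p))) = ?\<gamma>" unfolding s_def by simp
    also have "D v * (\<Sum>T\<in>?V. x T * (\<Sum>\<sigma>\<in>?G. signof \<sigma> * s (\<lambda>p. (letter n T p, letter n S (\<sigma> p)))))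
        = (\<Sum>T\<in>?V. \<Sum>\<sigma>\<in>?G. \<Sum>l\<in>words ?m k. D v * (x T * bsign r k l (letter n T)) * (signof \<sigma> * bsign r k l (letter n S \<circ> \<sigma>)))"
      unfolding s_def by (simp add: sum_distrib_left o_def mult_ac)
    also have "\<dots> = (\<Sum>T\<in>?V. \<Sum>l\<in>words ?m k. \<Sum>\<sigma>\<in>?G. D v * (x T * bsign r k l (letter n T)) * (signof \<sigma> * bsign r k l (letter n S \<circ> \<sigma>)))"
      by (intro sum.cong refl sum.swap)
    also have "\<dots> = (\<Sum>l\<in>words ?m k. \<Sum>T\<in>?V. \<Sum>\<sigma>\<in>?G. D v * (x T * bsign r k l (letter n T)) * (signof \<sigma> * bsign r k l (letter n S \<circ> \<sigma>)))"
      by (rule sum.swap)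
    also have "\<dots> = (\<Sum>l\<in>words ?m k. D v * (\<Sum>T\<in>?V. x T * bsign r k l (letter n T)) * E l S)"
      by (simp only: E_def S if_True sum_distrib_left[of "D v"] sum_product)
    finally show ?thesis .
  qed
  have E: "E l \<in> fspan (evec k n r lam ` carrier_mat k n)" if l: "l \<in> words ?m k" for l
  proof -
    obtain Z :: "((nat \<Rightarrow> nat) \<times> nat set) set" and e A where Z: "finite Z"
      and eq: "\<And>v. (\<Sum>\<sigma>\<in>?G. signof \<sigma> * bsign r k l (v \<circ> \<sigma>))
        = (\<Sum>z\<in>Z. e z * bdet r k (\<lambda>p i. A z i (blk n lam p)) v)"
      using young_antisymmetrisation[OF l, of n lam] by blast
    let ?A = "\<lambda>z. mat k n (\<lambda>(i, j). A z i j)"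
    have A: "bdet r k (\<lambda>p i. ?A z $$ (i, blk n lam p)) v = bdet r k (\<lambda>p i. A z i (blk n lam p)) v" for z v
      using blk_less[of _ lam n] m by (intro bdet_cong) auto
    show ?thesis
    proof (rule fspan_sumI[OF Z])
      show "evec k n r lam (?A z) \<in> fspan (evec k n r lam ` carrier_mat k n)" for z
        by (rule fs.span_base) auto
      show "E l S = (\<Sum>z\<in>Z. e z * evec k n r lam (?A z) S)" for S
        unfolding E_def evec_def A eq by simp
    qed
  qed
  show ?thesis
  proof (rule fspan_sumI[OF finite_words[of ?m k] E])
    fix S
    show "x S = (\<Sum>l\<in>words ?m k. D v * (\<Sum>T\<in>?V. x T * bsign r k l (letter n T)) / ?\<gamma> * E l S)"
    proof (cases "validS n r lam S")
      case True
      have "x S = (x S * ?\<gamma>) / ?\<gamma>" using \<gamma> by simp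
      also have "\<dots> = (\<Sum>l\<in>words ?m k. D v * (\<Sum>T\<in>?V. x T * bsign r k l (letter n T)) * E l S) / ?\<gamma>"
        unfolding key[OF True] ..
      finally show ?thesis by (simp add: sum_divide_distrib)
    next
      case False
      then show ?thesis using x by (simp add: E_def Wspace_def)
    qed
  qed
qed

lemma Wspace_eq_span:
  assumes "r > 0" and "(\<Sum>j<n. lam j) = r * k"
  shows "Wspace n r lam = fspan (evec k n r lam ` carrier_mat k n)"
proof
  show "fspan (evec k n r lam ` carrier_mat k n) \<subseteq> Wspace n r lam"
    by (rule fs.span_minimal[OF _ subspace_Wspace]) (auto intro: evec_in_Wspace assms)
qed (use Wspace_subset_span assms in blast)

lemma WspaceE:
  assumes "x \<in> Wspace n r lam" "r > 0" "(\<Sum>j<n. lam j) = r * k"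
  obtains T c where "finite T" "T \<subseteq> carrier_mat k n" "x = (\<lambda>S. \<Sum>A\<in>T. c A * evec k n r lam A S)"
  using assms(1) unfolding Wspace_eq_span[OF assms(2,3)] by (rule fspan_imageE)

section \<open>Products of minors, their dual lists and the pairing\<close>

lemma of_degree_length:
  assumes "of_degree k n lam Is"
  shows "length Is * k = (\<Sum>j<n. lam j)"
proof -
  have "length Js * k = (\<Sum>j<n. length (filter (\<lambda>I. j \<in> I) Js))" if "set Js \<subseteq> ksubsets k n" for Js
    using that
  proof (induction Js)
    case (Cons I Js)
    have I: "I \<subseteq> {..<n}" "card I = k" using Cons.prems by (auto simp: ksubsets_def)
    have "(\<Sum>j<n. length (filter (\<lambda>I. j \<in> I) (I # Js)))
        = (\<Sum>j<n. (if j \<in> I then 1 else 0) + length (filter (\<lambda>I. j \<in> I) Js))"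
      by (intro sum.cong) auto
    also have "\<dots> = card ({..<n} \<inter> I) + length Js * k"
      using Cons by (simp add: sum.distrib sum.If_cases)
    also have "{..<n} \<inter> I = I" using I by auto
    finally show ?case using I by simp
  qed simp
  then show ?thesis using assms by (simp add: of_degree_def)
qed

text \<open>Double counting fixes the length only for positive \<open>k\<close>. For
  \<open>k = 0\<close> the list may have any length, but then \<open>lam\<close> vanishes on the
  range and all dual sets are empty.\<close>

lemma of_degree_validS:
  assumes Is: "of_degree k n lam Is" and m: "(\<Sum>j<n. lam j) = r * k"
  shows "validS n r lam (dualS n Is)" and "k > 0 \<Longrightarrow> length Is = r"
proof -
  show len: "length Is = r" if "k > 0" using of_degree_length[OF Is] m that by simp
  have c: "card (dualS n Is j) = lam j" if "j < n" for j
    using Is that unfolding of_degree_def dualS_def by (simp add: length_filter_conv_card)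
  have "dualS n Is j \<subseteq> {0..<r}" if "j < n" for j
  proof (cases "k > 0")
    case True
    then show ?thesis using len by (auto simp: dualS_def)
  next
    case False
    then have "lam j = 0" using m that by simp
    moreover have "finite (dualS n Is j)" by (simp add: dualS_def)
    ultimately show ?thesis using c[OF that] by simp
  qed
  then show "validS n r lam (dualS n Is)" using c by (auto simp: validS_def dualS_def)
qed

lemma signS_square [simp]: "signS n S * signS n S = 1"
  unfolding signS_def by (simp flip: power_mult_distrib)

lemma plprod_eq_evec:
  assumes Is: "of_degree k n lam Is" and m: "(\<Sum>j<n. lam j) = r * k" and A: "A \<in> carrier_mat k n"
  shows "plprod k n Is A = signS n (dualS n Is) * evec k n r lam A (dualS n Is)"
proof (cases "k > 0")
  case True
  note v = of_degree_validS[OF Is m]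
  have "evec k n r lam A (dualS n Is) = signS n (dualS n Is) * plprod k n Is A"
    using bdet_eq_plprod[OF A True v(2)[OF True] _ validS_has_cards[OF v(1)] m] Is v(1)
    by (simp add: evec_def of_degree_def)
  then show ?thesis by (simp flip: mult.assoc)
next
  case False
  \<comment> \<open>The list now consists of copies of the empty set, and empty determinants make
    every term equal to 1.\<close>
  then have k: "k = 0" by simp
  have "has_cards n lam (dualS n Is)" using validS_has_cards of_degree_validS(1)[OF Is m] by blast
  then have "Sword n (dualS n Is) = []" using length_Sword[of n lam "dualS n Is"] m k by simp
  then have "signS n (dualS n Is) = 1" by (simp add: signS_def inversions_def)
  moreover have "evec k n r lam A (dualS n Is) = 1"
    using of_degree_validS(1)[OF Is m] by (simp add: evec_def bdet_def k det_def)
  moreover have "(\<Prod>I\<leftarrow>Is. pl k I A) = 1"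
  proof -
    have "pl k I A = 1" if "I \<in> set Is" for I
    proof -
      have "I = {}" using that Is k finite_subset[of I "{0..<n}"]
        by (auto simp: of_degree_def ksubsets_def)
      then show ?thesis by (simp add: pl_def submatrix_def k det_def)
    qed
    then show ?thesis by (induction Is) auto
  qed
  ultimately show ?thesis using A by (simp add: plprod_def)
qed

lemma ring_degE:
  assumes "f \<in> ring_deg k n lam"
  obtains fs where "\<forall>(a, Is)\<in>set fs. of_degree k n lam Is" "f = (\<lambda>A. \<Sum>(a, Is)\<leftarrow>fs. a * plprod k n Is A)"
proof -
  have "ring_deg k n lam = fspan (plprod k n ` {Is. of_degree k n lam Is})"
    unfolding ring_deg_def by (simp add: setcompr_eq_image)
  then obtain T c where T: "finite T" "T \<subseteq> {Is. of_degree k n lam Is}" "f = (\<lambda>A. \<Sum>Is\<in>T. c Is * plprod k n Is A)"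
    using assms fspan_imageE[of f "plprod k n"] by blast
  obtain xs where xs: "set xs = T" "distinct xs" using finite_distinct_list[OF T(1)] by blast
  show thesis
  proof (rule that[of "map (\<lambda>Is. (c Is, Is)) xs"])
    show "f = (\<lambda>A. \<Sum>(a, Is)\<leftarrow>map (\<lambda>Is. (c Is, Is)) xs. a * plprod k n Is A)"
      using xs by (simp add: T(3) fun_eq_iff o_def sum_list_distinct_conv_sum_set)
  qed (use T xs in auto)
qed

text \<open>Expanding an invariant as \<open>x = \<Sum>c\<^sub>A x\<^sub>A\<close>, the pairing with \<open>f\<close> is \<open>\<Sum>c\<^sub>A f(A)\<close>; this depends
on \<open>f\<close> only, which gives well-definedness.\<close>

lemma
  assumes x: "x \<in> Wspace n r lam" and r: "r > 0" and m: "(\<Sum>j<n. lam j) = r * k"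
  shows pairing_list: "\<forall>(a, Is)\<in>set fs. of_degree k n lam Is \<Longrightarrow>
      pairing k n lam x (\<lambda>A. \<Sum>(a, Is)\<leftarrow>fs. a * plprod k n Is A)
      = (\<Sum>(a, Is)\<leftarrow>fs. a * signS n (dualS n Is) * x (dualS n Is))"
    and pairing_eval: "finite T \<Longrightarrow> T \<subseteq> carrier_mat k n \<Longrightarrow> x = (\<lambda>S. \<Sum>A\<in>T. c A * evec k n r lam A S) \<Longrightarrow>
      f \<in> ring_deg k n lam \<Longrightarrow> pairing k n lam x f = (\<Sum>A\<in>T. c A * f A)"
proof -
  have ev: "(\<Sum>(a, Is)\<leftarrow>fs. a * signS n (dualS n Is) * x (dualS n Is))
      = (\<Sum>A\<in>T. c A * (\<Sum>(a, Is)\<leftarrow>fs. a * plprod k n Is A))"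
    if T: "finite T" "T \<subseteq> carrier_mat k n" "x = (\<lambda>S. \<Sum>A\<in>T. c A * evec k n r lam A S)"
      and "\<forall>(a, Is)\<in>set fs. of_degree k n lam Is" for T c fs
    using that(4)
  proof (induction fs)
    case (Cons y fs)
    obtain a Is where y: "y = (a, Is)" by (cases y)
    have "plprod k n Is A = signS n (dualS n Is) * evec k n r lam A (dualS n Is)" if "A \<in> T" for A
      using Cons.prems y T(2) that plprod_eq_evec[OF _ m] by auto
    then have "a * signS n (dualS n Is) * x (dualS n Is) = (\<Sum>A\<in>T. c A * (a * plprod k n Is A))"
      unfolding T(3) sum_distrib_left by (intro sum.cong refl) (simp add: mult_ac)
    then show ?case using Cons y by (simp add: sum.distrib distrib_left)
  qed simp
  obtain T c where T: "finite T" "T \<subseteq> carrier_mat k n" "x = (\<lambda>S. \<Sum>A\<in>T. c A * evec k n r lam A S)"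
    by (rule WspaceE[OF x r m])
  have *: "pairing k n lam x (\<lambda>A. \<Sum>(a, Is)\<leftarrow>fs. a * plprod k n Is A)
      = (\<Sum>(a, Is)\<leftarrow>fs. a * signS n (dualS n Is) * x (dualS n Is))"
    if fs: "\<forall>(a, Is)\<in>set fs. of_degree k n lam Is" for fs
    unfolding pairing_def
  proof (rule someI2)
    let ?f = "\<lambda>A. \<Sum>(a, Is)\<leftarrow>fs. a * plprod k n Is A"
    show "\<exists>gs. (\<forall>(a, Is)\<in>set gs. of_degree k n lam Is) \<and> ?f = (\<lambda>A. \<Sum>(a, Is)\<leftarrow>gs. a * plprod k n Is A)
      \<and> (\<Sum>(a, Is)\<leftarrow>fs. a * signS n (dualS n Is) * x (dualS n Is)) = (\<Sum>(a, Is)\<leftarrow>gs. a * signS n (dualS n Is) * x (dualS n Is))"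
      using fs by blast
    fix d
    assume "\<exists>gs. (\<forall>(a, Is)\<in>set gs. of_degree k n lam Is) \<and> ?f = (\<lambda>A. \<Sum>(a, Is)\<leftarrow>gs. a * plprod k n Is A)
      \<and> d = (\<Sum>(a, Is)\<leftarrow>gs. a * signS n (dualS n Is) * x (dualS n Is))"
    then obtain gs where gs: "\<forall>(a, Is)\<in>set gs. of_degree k n lam Is"
      "?f = (\<lambda>A. \<Sum>(a, Is)\<leftarrow>gs. a * plprod k n Is A)"
      "d = (\<Sum>(a, Is)\<leftarrow>gs. a * signS n (dualS n Is) * x (dualS n Is))" by blast
    show "d = (\<Sum>(a, Is)\<leftarrow>fs. a * signS n (dualS n Is) * x (dualS n Is))"
      unfolding gs(3) ev[OF T gs(1)] ev[OF T fs] fun_cong[OF gs(2), symmetric] ..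
  qed
  then show "\<forall>(a, Is)\<in>set fs. of_degree k n lam Is \<Longrightarrow>
      pairing k n lam x (\<lambda>A. \<Sum>(a, Is)\<leftarrow>fs. a * plprod k n Is A)
      = (\<Sum>(a, Is)\<leftarrow>fs. a * signS n (dualS n Is) * x (dualS n Is))" .
  show "pairing k n lam x f = (\<Sum>A\<in>T. c A * f A)"
    if T: "finite T" "T \<subseteq> carrier_mat k n" "x = (\<lambda>S. \<Sum>A\<in>T. c A * evec k n r lam A S)"
      and f: "f \<in> ring_deg k n lam" for T c
  proof -
    obtain fs where fs: "\<forall>(a, Is)\<in>set fs. of_degree k n lam Is" "f = (\<lambda>A. \<Sum>(a, Is)\<leftarrow>fs. a * plprod k n Is A)"
      by (rule ring_degE[OF f])
    show ?thesis unfolding fs(2) *[OF fs(1)] ev[OF T fs(1)] ..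
  qed
qed

lemma pairing_plprod:
  assumes "x \<in> Wspace n r lam" "r > 0" "(\<Sum>j<n. lam j) = r * k" "of_degree k n lam Is"
  shows "pairing k n lam x (plprod k n Is) = signS n (dualS n Is) * x (dualS n Is)"
  using pairing_list[OF assms(1-3), of "[(1, Is)]"] assms(4) by simp

text \<open>By the spanning result some \<open>evec\<close> is nonzero at \<open>S\<close>. A
  nonzero Leibniz term of it matches the positions of letter i bijectively with the \<open>k\<close>
  columns of block i, so every letter occurs exactly \<open>k\<close> times, and the letters define
  \<open>r\<close> sets of size \<open>k\<close>.\<close>

lemma Wspace_nonzero_dual:
  assumes x: "x \<in> Wspace n r lam" and r: "r > 0" and m: "(\<Sum>j<n. lam j) = r * k" and xS: "x S \<noteq> 0"
  obtains Is where "of_degree k n lam Is" "length Is = r" "dualS n Is = S"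
proof -
  let ?b = "blk n lam"
  obtain T c where T: "x = (\<lambda>S. \<Sum>A\<in>T. c A * evec k n r lam A S)"
    using WspaceE[OF x r m] by blast
  have "(\<Sum>A\<in>T. c A * evec k n r lam A S) \<noteq> 0" using xS unfolding T .
  then obtain A where "c A * evec k n r lam A S \<noteq> 0" by (rule sum.not_neutral_contains_not_neutral)
  then have "evec k n r lam A S \<noteq> 0" by simp
  then have S: "validS n r lam S" and nz: "bdet r k (\<lambda>p i. A $$ (i, ?b p)) (letter n S) \<noteq> 0"
    by (auto simp: evec_def split: if_splits)
  let ?M = "mat (r * k) (r * k) (\<lambda>(p, q). if q div k = letter n S p then A $$ (q mod k, ?b p) else 0)"
  have "(\<Sum>\<sigma> | \<sigma> permutes {0..<r * k}. signof \<sigma> * (\<Prod>p=0..<r * k. ?M $$ (p, \<sigma> p))) \<noteq> 0"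
    using nz unfolding bdet_def by (subst (asm) det_def'[of _ "r * k"]) auto
  then obtain \<sigma> where "\<sigma> \<in> {\<sigma>. \<sigma> permutes {0..<r * k}}"
    "signof \<sigma> * (\<Prod>p=0..<r * k. ?M $$ (p, \<sigma> p)) \<noteq> 0"
    by (rule sum.not_neutral_contains_not_neutral)
  then have \<sigma>: "\<sigma> permutes {0..<r * k}" "(\<Prod>p=0..<r * k. ?M $$ (p, \<sigma> p)) \<noteq> 0" by simp_all
  have \<sigma>l: "\<sigma> p div k = letter n S p" if "p < r * k" for p
  proof (rule ccontr)
    assume "\<sigma> p div k \<noteq> letter n S p"
    then have "?M $$ (p, \<sigma> p) = 0" using that permutes_lt[OF \<sigma>(1) that] by simp
    then show False using \<sigma>(2) that by auto
  qed
  have card_I: "card {j \<in> {0..<n}. i \<in> S j} = k" if i: "i < r" for i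
  proof -
    let ?P = "{p \<in> {0..<r * k}. letter n S p = i}" and ?Q = "{q \<in> {0..<r * k}. q div k = i}"
    have bij: "bij_betw (\<lambda>p. (?b p, letter n S p)) {0..<r * k} (SIGMA j:{0..<n}. S j)"
      using blk_letter_bij[OF validS_has_cards[OF S]] m by simp
    have img: "(\<lambda>p. (?b p, letter n S p)) ` {0..<r * k} = (SIGMA j:{0..<n}. S j)"
      using bij by (simp add: bij_betw_def)
    have "?b ` ?P = {j \<in> {0..<n}. i \<in> S j}"
    proof
      show "?b ` ?P \<subseteq> {j \<in> {0..<n}. i \<in> S j}" using img by blast
      show "{j \<in> {0..<n}. i \<in> S j} \<subseteq> ?b ` ?P"
      proof
        fix j assume "j \<in> {j \<in> {0..<n}. i \<in> S j}"
        then have "(j, i) \<in> (\<lambda>p. (?b p, letter n S p)) ` {0..<r * k}" unfolding img by simp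
        then show "j \<in> ?b ` ?P" by auto
      qed
    qed
    moreover have "inj_on ?b ?P"
    proof (rule inj_onI)
      fix p q assume "p \<in> ?P" "q \<in> ?P" "?b p = ?b q"
      then show "p = q" by (intro inj_onD[OF bij_betw_imp_inj_on[OF bij]]) simp_all
    qed
    ultimately have "card {j \<in> {0..<n}. i \<in> S j} = card ?P" using card_image by fastforce
    also have "card ?P = card (\<sigma> ` ?P)"
      by (rule card_image[symmetric]) (rule inj_on_subset[OF permutes_inj[OF \<sigma>(1)]], simp)
    also have "\<sigma> ` ?P = ?Q"
    proof
      show "\<sigma> ` ?P \<subseteq> ?Q" using \<sigma>l permutes_lt[OF \<sigma>(1)] by auto
      show "?Q \<subseteq> \<sigma> ` ?P"
      proof
        fix q assume q: "q \<in> ?Q"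
        let ?p = "inv_into UNIV \<sigma> q"
        have p: "\<sigma> ?p = q" "?p < r * k"
          using permutes_inverses(1)[OF \<sigma>(1)] permutes_lt[OF permutes_inv[OF \<sigma>(1)]] q by auto
        then show "q \<in> \<sigma> ` ?P" using \<sigma>l[OF p(2)] q by (intro image_eqI[of _ _ ?p]) auto
      qed
    qed
    also have "?Q = {i * k..<i * k + k}"
    proof (cases "k = 0")
      case False
      have le: "i * k + k \<le> r * k" using i by (metis Suc_leI add.commute mult_Suc mult_le_mono1)
      have iff: "q div k = i \<longleftrightarrow> q \<in> {i * k..<i * k + k}" for q
      proof
        assume "q div k = i"
        then show "q \<in> {i * k..<i * k + k}"
          using dividend_less_div_times[of k q] div_times_less_eq_dividend[of q k] False
          by (simp add: add.commute)
      qed (auto intro!: div_nat_eqI simp: mult.commute)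
      show ?thesis
      proof
        show "?Q \<subseteq> {i * k..<i * k + k}" using iff by blast
        show "{i * k..<i * k + k} \<subseteq> ?Q"
        proof
          fix q assume q: "q \<in> {i * k..<i * k + k}"
          then have "q < r * k" using le by simp
          moreover have "q div k = i" using iff q by blast
          ultimately show "q \<in> ?Q" by simp
        qed
      qed
    qed simp
    finally show ?thesis by simp
  qed
  define Is where "Is = map (\<lambda>i. {j \<in> {0..<n}. i \<in> S j}) [0..<r]"
  have len: "length Is = r" by (simp add: Is_def)
  have Sr: "S j \<subseteq> {0..<r}" "card (S j) = lam j" if "j < n" for j using S that by (auto simp: validS_def)
  have d: "dualS n Is = S"
  proof
    fix j show "dualS n Is j = S j"
    proof (cases "j < n")
      case True
      then have "i < r" if "i \<in> S j" for i using Sr(1)[of j] that by auto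
      then show ?thesis using True by (auto simp: dualS_def Is_def)
    next
      case False
      then show ?thesis using S by (simp add: dualS_def validS_def)
    qed
  qed
  have "of_degree k n lam Is"
    unfolding of_degree_def
  proof (intro conjI allI impI)
    show "set Is \<subseteq> ksubsets k n" using card_I by (auto simp: Is_def ksubsets_def)
    fix j assume j: "j < n"
    have "length (filter (\<lambda>I. j \<in> I) Is) = card (dualS n Is j)"
      using j by (simp add: dualS_def length_filter_conv_card)
    then show "length (filter (\<lambda>I. j \<in> I) Is) = lam j" using d Sr(2)[OF j] by simp
  qed
  then show thesis using that len d by blast
qed

section \<open>The ideal of a positroid\<close>

lemma det_scale_columns:
  fixes F :: "nat \<Rightarrow> nat \<Rightarrow> 'a :: comm_ring_1"
  shows "det (mat k k (\<lambda>(a, b). d b * F a b)) = (\<Prod>b=0..<k. d b) * det (mat k k (\<lambda>(a, b). F a b))"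
proof -
  have "det (mat k k (\<lambda>(a, b). d b * F a b))
      = (\<Sum>\<sigma> | \<sigma> permutes {0..<k}. signof \<sigma> * (\<Prod>a=0..<k. d (\<sigma> a) * F a (\<sigma> a)))"
    by (subst det_def'[of _ k]) (auto intro!: sum.cong prod.cong simp: permutes_lt)
  also have "\<dots> = (\<Sum>\<sigma> | \<sigma> permutes {0..<k}. (\<Prod>b=0..<k. d b) * (signof \<sigma> * (\<Prod>a=0..<k. F a (\<sigma> a))))"
  proof (intro sum.cong refl)
    fix \<sigma> assume "\<sigma> \<in> {\<sigma>. \<sigma> permutes {0..<k}}"
    then have "(\<Prod>a=0..<k. d (\<sigma> a)) = (\<Prod>b=0..<k. d b)"
      using prod.permute[of \<sigma> "{0..<k}" d] by (simp add: o_def)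
    then show "signof \<sigma> * (\<Prod>a=0..<k. d (\<sigma> a) * F a (\<sigma> a)) = (\<Prod>b=0..<k. d b) * (signof \<sigma> * (\<Prod>a=0..<k. F a (\<sigma> a)))"
      by (simp add: prod.distrib mult_ac)
  qed
  also have "\<dots> = (\<Prod>b=0..<k. d b) * det (mat k k (\<lambda>(a, b). F a b))"
    unfolding sum_distrib_left[symmetric]
    by (subst det_def'[of _ k]) (auto intro!: sum.cong prod.cong simp: permutes_lt)
  finally show ?thesis .
qed

definition scale_col :: "nat \<Rightarrow> nat \<Rightarrow> nat \<Rightarrow> complex \<Rightarrow> complex mat \<Rightarrow> complex mat" where
  "scale_col k n j z A = mat k n (\<lambda>(i, q). (if q = j then z else 1) * A $$ (i, q))"

lemma pl_scale_col:
  assumes A: "A \<in> carrier_mat k n" and I: "I \<in> ksubsets k n"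
  shows "pl k I (scale_col k n j z A) = (if j \<in> I then z else 1) * pl k I A"
proof -
  have I': "I \<subseteq> {0..<n}" "card I = k" and fin: "finite I"
    using I finite_subset[of I "{0..<n}"] by (auto simp: ksubsets_def)
  have sub: "submatrix B {0..<k} I = mat k k (\<lambda>(a, b). B $$ (a, sorted_list_of_set I ! b))"
    if B: "B \<in> carrier_mat k n" for B :: "complex mat"
    by (subst det_submatrix_eq[OF B, where l = k]) (use I' in auto)
  have lt: "sorted_list_of_set I ! b < n" if "b < k" for b
    using nth_mem[of b "sorted_list_of_set I"] I' fin that by auto
  let ?d = "\<lambda>q. if q = j then z else 1"
  have "pl k I (scale_col k n j z A)
      = det (mat k k (\<lambda>(a, b). ?d (sorted_list_of_set I ! b) * A $$ (a, sorted_list_of_set I ! b)))"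
    unfolding pl_def scale_col_def
    by (subst sub, simp) (auto intro!: arg_cong[where f = det] eq_matI simp: lt)
  also have "\<dots> = (\<Prod>b=0..<k. ?d (sorted_list_of_set I ! b)) * pl k I A"
    unfolding det_scale_columns pl_def sub[OF A] ..
  also have "(\<Prod>b=0..<k. ?d (sorted_list_of_set I ! b)) = prod_list (map ?d (sorted_list_of_set I))"
    unfolding prod_list_eq_prod_nth using I' by (simp add: atLeast0LessThan)
  also have "\<dots> = (\<Prod>q\<in>I. ?d q)"
    using prod.distinct_set_conv_list[of "sorted_list_of_set I" ?d] fin by simp
  also have "\<dots> = (if j \<in> I then z else 1)" using fin by simp
  finally show ?thesis .
qed

abbreviation deg :: "nat \<Rightarrow> nat set list \<Rightarrow> nat" where
  "deg j Is \<equiv> length (filter (\<lambda>I. j \<in> I) Is)"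

lemma plprod_scale_col:
  assumes Is: "set Is \<subseteq> ksubsets k n" and A: "A \<in> carrier_mat k n"
  shows "plprod k n Is (scale_col k n j z A) = z ^ deg j Is * plprod k n Is A"
proof -
  have "(\<Prod>I\<leftarrow>Is. pl k I (scale_col k n j z A)) = z ^ deg j Is * (\<Prod>I\<leftarrow>Is. pl k I A)"
    using Is by (induction Is) (auto simp: pl_scale_col[OF A])
  moreover have "scale_col k n j z A \<in> carrier_mat k n" by (simp add: scale_col_def)
  ultimately show ?thesis using A by (simp add: plprod_def)
qed

text \<open>Scaling column \<open>j\<close> by \<open>z\<close> multiplies each product by a power
  of \<open>z\<close>, and \<open>f\<close> itself by \<open>z ^ lam j\<close>. Comparing the
  coefficients at that power, as polynomials in \<open>z\<close>, discards all products of another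
  degree in \<open>j\<close>.\<close>

lemma homogeneous_component:
  assumes N: "\<And>Is. Is \<in> N \<Longrightarrow> set Is \<subseteq> ksubsets k n"
    and f: "f \<in> fspan (plprod k n ` N)" and fr: "f \<in> ring_deg k n lam" and j: "j < n"
  shows "f \<in> fspan (plprod k n ` {Is \<in> N. deg j Is = lam j})"
proof -
  obtain T c where T: "finite T" "T \<subseteq> N" "f = (\<lambda>A. \<Sum>Is\<in>T. c Is * plprod k n Is A)"
    using fspan_imageE[OF f] by blast
  have scale: "f (scale_col k n j z A) = z ^ lam j * f A" if A: "A \<in> carrier_mat k n" for z A
  proof -
    obtain U d where U: "U \<subseteq> {Is. of_degree k n lam Is}" "f = (\<lambda>A. \<Sum>Is\<in>U. d Is * plprod k n Is A)"
      using fspan_imageE[of f "plprod k n" "{Is. of_degree k n lam Is}"] fr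
      unfolding ring_deg_def setcompr_eq_image by blast
    have "plprod k n Is (scale_col k n j z A) = z ^ lam j * plprod k n Is A" if "Is \<in> U" for Is
      using U(1) that j plprod_scale_col[OF _ A, of Is j z] by (auto simp: of_degree_def)
    then show ?thesis unfolding U(2) sum_distrib_left by (intro sum.cong refl) (simp add: mult_ac)
  qed
  have comp: "f A = (\<Sum>Is\<in>{Is \<in> T. deg j Is = lam j}. c Is * plprod k n Is A)" for A
  proof (cases "A \<in> carrier_mat k n")
    case True
    let ?P = "\<Sum>Is\<in>T. monom (c Is * plprod k n Is A) (deg j Is)"
    have "poly ?P z = poly (monom (f A) (lam j)) z" for z
    proof -
      have "poly ?P z = (\<Sum>Is\<in>T. c Is * plprod k n Is (scale_col k n j z A))"
        unfolding poly_sum poly_monom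
      proof (intro sum.cong refl)
        fix Is assume "Is \<in> T"
        then have "set Is \<subseteq> ksubsets k n" using T(2) N by blast
        then show "c Is * plprod k n Is A * z ^ deg j Is = c Is * plprod k n Is (scale_col k n j z A)"
          by (simp add: plprod_scale_col[OF _ True] mult_ac)
      qed
      also have "\<dots> = f (scale_col k n j z A)" by (simp add: T(3))
      finally show ?thesis by (simp add: scale[OF True] poly_monom)
    qed
    then have "?P = monom (f A) (lam j)" by (simp add: poly_eq_poly_eq_iff[symmetric] fun_eq_iff)
    then have "coeff ?P (lam j) = f A" by simp
    then show ?thesis using T(1) by (simp add: coeff_sum sum.inter_filter)
  next
    case False
    then show ?thesis unfolding T(3) by (simp add: plprod_def)
  qed
  show ?thesis
  proof (rule fspan_sumI)
    show "finite {Is \<in> T. deg j Is = lam j}" using T(1) by simp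
    show "plprod k n Is \<in> fspan (plprod k n ` {Is \<in> N. deg j Is = lam j})"
      if "Is \<in> {Is \<in> T. deg j Is = lam j}" for Is
      by (rule fs.span_base) (use that T(2) in auto)
  qed (rule comp)
qed

lemma homogeneous_part:
  assumes N: "\<And>Is. Is \<in> N \<Longrightarrow> set Is \<subseteq> ksubsets k n"
    and f: "f \<in> fspan (plprod k n ` N)" and fr: "f \<in> ring_deg k n lam"
  shows "f \<in> fspan (plprod k n ` {Is \<in> N. of_degree k n lam Is})"
proof -
  have "f \<in> fspan (plprod k n ` {Is \<in> N. \<forall>j<i. deg j Is = lam j})" if "i \<le> n" for i
    using that
  proof (induction i)
    case 0
    show ?case using f by simp
  next
    case (Suc i)
    let ?N = "{Is \<in> N. \<forall>j<i. deg j Is = lam j}"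
    have "f \<in> fspan (plprod k n ` {Is \<in> ?N. deg i Is = lam i})"
      by (rule homogeneous_component[OF _ _ fr]) (use Suc N in auto)
    also have "{Is \<in> ?N. deg i Is = lam i} = {Is \<in> N. \<forall>j<Suc i. deg j Is = lam j}"
      by (auto simp: less_Suc_eq)
    finally show ?case .
  qed
  from this[of n] show ?thesis
    using N by (simp add: of_degree_def conj_comms cong: conj_cong)
qed

lemma plprod_snoc: "plprod k n (Is @ [J]) A = plprod k n [J] A * plprod k n Is A"
  by (simp add: plprod_def mult_ac)

text \<open>The set outside \<open>M\<close> is appended, not prepended: it then has the last index
  in the dual list, the one that partial evaluation fills.\<close>

lemma pideal_subset:
  "pideal k n M \<subseteq> fspan (plprod k n ` {Is @ [J] | Is J. set Is \<subseteq> ksubsets k n \<and> J \<in> ksubsets k n \<and> J \<notin> M})"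
    (is "_ \<subseteq> fspan ?G")
  unfolding pideal_def
proof (rule fs.span_minimal, clarify)
  fix J g assume J: "J \<in> ksubsets k n" "J \<notin> M" and g: "g \<in> plucker_ring k n"
  obtain T c where T: "finite T" "T \<subseteq> {Is. set Is \<subseteq> ksubsets k n}" "g = (\<lambda>A. \<Sum>Is\<in>T. c Is * plprod k n Is A)"
    using g fspan_imageE[of g "plprod k n" "{Is. set Is \<subseteq> ksubsets k n}"]
    unfolding plucker_ring_def setcompr_eq_image by blast
  show "(\<lambda>A. plprod k n [J] A * g A) \<in> fspan ?G"
  proof (rule fspan_sumI[OF T(1)])
    show "plprod k n (Is @ [J]) \<in> fspan ?G" if "Is \<in> T" for Is
      by (rule fs.span_base) (use that T(2) J in auto)
    show "plprod k n [J] A * g A = (\<Sum>Is\<in>T. c Is * plprod k n (Is @ [J]) A)" for A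
      by (simp add: T(3) sum_distrib_left plprod_snoc mult_ac)
  qed
qed (rule fs.subspace_span)

text \<open>A member of the intersection is a priori a combination of generators of many degrees;
  \<open>homogeneous_part\<close> removes those of the wrong degree.\<close>

lemma pideal_deg_subset:
  "pideal_deg k n M lam \<subseteq> fspan (plprod k n ` {Is @ [J] | Is J. J \<in> ksubsets k n - M \<and> of_degree k n lam (Is @ [J])})"
proof
  fix f assume "f \<in> pideal_deg k n M lam"
  then have f: "f \<in> pideal k n M" "f \<in> ring_deg k n lam" by (auto simp: pideal_deg_def)
  let ?N = "{Is @ [J] | Is J. set Is \<subseteq> ksubsets k n \<and> J \<in> ksubsets k n \<and> J \<notin> M}"
  have "f \<in> fspan (plprod k n ` {Is \<in> ?N. of_degree k n lam Is})"
    by (rule homogeneous_part[OF _ _ f(2)]) (use pideal_subset f(1) in auto)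
  also have "\<dots> \<subseteq> fspan (plprod k n ` {Is @ [J] | Is J. J \<in> ksubsets k n - M \<and> of_degree k n lam (Is @ [J])})"
    by (intro fs.span_mono image_mono) auto
  finally show "f \<in> fspan (plprod k n ` {Is @ [J] | Is J. J \<in> ksubsets k n - M \<and> of_degree k n lam (Is @ [J])})" .
qed

lemma plprod_in_pideal_deg:
  assumes "J \<in> ksubsets k n - M" "of_degree k n lam (Is @ [J])"
  shows "plprod k n (Is @ [J]) \<in> pideal_deg k n M lam"
proof -
  have Is: "set Is \<subseteq> ksubsets k n" using assms by (auto simp: of_degree_def)
  have "plprod k n Is \<in> plucker_ring k n"
    unfolding plucker_ring_def by (rule fs.span_base) (use Is in auto)
  then have "(\<lambda>A. plprod k n [J] A * plprod k n Is A) \<in> pideal k n M"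
    unfolding pideal_def by (intro fs.span_base) (use assms in auto)
  moreover have "plprod k n (Is @ [J]) \<in> ring_deg k n lam"
    unfolding ring_deg_def by (rule fs.span_base) (use assms in auto)
  ultimately show ?thesis unfolding pideal_deg_def plprod_snoc[abs_def, symmetric] by simp
qed

section \<open>Partial evaluation against the annihilator\<close>

lemma dualS_snoc:
  "dualS n (Is @ [J]) j = (if j < n \<and> j \<in> J then insert (length Is) (dualS n Is j) else dualS n Is j)"
  by (auto simp: dualS_def nth_append less_Suc_eq)

text \<open>The index \<open>r - 1\<close> occurs in the dual list exactly at the elements of
  \<open>J\<close>; deleting it leaves the dual list of the first \<open>r - 1\<close>
  factors.\<close>

lemma peval_dualS:
  assumes of: "of_degree k n lam (Is @ [J])" and J: "J \<subseteq> {0..<n}" and len: "length Is = r - 1" and r: "r > 0"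
    and m: "(\<Sum>j<n. lam j) = r * k"
  shows "peval n r lam x J (dualS n Is) = x (dualS n (Is @ [J]))"
proof -
  let ?S = "dualS n (Is @ [J])"
  have S: "validS n r lam ?S" by (rule of_degree_validS(1)[OF of m])
  have eq: "?S = (\<lambda>j. if j \<in> J then insert (r - 1) (dualS n Is j) else dualS n Is j)"
    using J len by (auto simp: dualS_snoc fun_eq_iff)
  have fin: "finite (dualS n Is j)" "dualS n Is j \<subseteq> {0..<r - 1}" "r - 1 \<notin> dualS n Is j" for j
    using len by (auto simp: dualS_def)
  have c: "card (?S j) = lam j" if "j < n" for j using S that by (simp add: validS_def)
  have card: "card (dualS n Is j) = (if j \<in> J then lam j - 1 else lam j)" if "j < n" for j
    using c[OF that] fin[of j] unfolding eq by (auto split: if_splits)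
  have "lam j \<noteq> 0" if "j \<in> J" for j
  proof -
    have "j < n" using that J by auto
    from c[OF this] show ?thesis using that fin[of j] unfolding eq by auto
  qed
  then have "\<not> (\<exists>i\<in>J. lam i = 0)" by auto
  moreover have "validS n (r - 1) (\<lambda>j. if j \<in> J then lam j - 1 else lam j) (dualS n Is)"
    unfolding validS_def by (intro conjI allI impI fin(2) card) (simp_all add: dualS_def)
  ultimately show ?thesis unfolding peval_def eq by auto
qed

text \<open>Both conditions say that \<open>x\<close> vanishes at the lists dual to products ending
  in a set outside \<open>M\<close>. Coordinates at lists that are not dual to any product vanish by
  \<open>Wspace_nonzero_dual\<close>. The premise for \<open>k = 0\<close> sets aside the case where
  the degree does not determine the number of factors.\<close>

lemma WspaceM_eq_annihilator:
  assumes r: "r > 0" and m: "(\<Sum>j<n. lam j) = r * k" and k: "k = 0 \<Longrightarrow> ksubsets k n - M = {}"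
  shows "WspaceM k n r lam M = annihilator k n r lam M"
proof (rule subset_antisym; rule subsetI)
  fix x assume "x \<in> WspaceM k n r lam M"
  then have x: "x \<in> Wspace n r lam" and pe: "\<And>J. J \<in> ksubsets k n - M \<Longrightarrow> peval n r lam x J = (\<lambda>T. 0)"
    by (auto simp: WspaceM_def)
  obtain T c where T: "finite T" "T \<subseteq> carrier_mat k n" "x = (\<lambda>S. \<Sum>A\<in>T. c A * evec k n r lam A S)"
    by (rule WspaceE[OF x r m])
  let ?G = "{Is @ [J] | Is J. J \<in> ksubsets k n - M \<and> of_degree k n lam (Is @ [J])}"
  have gen: "(\<Sum>A\<in>T. c A * plprod k n (Is @ [J]) A) = 0"
    if J: "J \<in> ksubsets k n - M" and of: "of_degree k n lam (Is @ [J])" for Is J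
  proof -
    have "k \<noteq> 0" using k J by blast
    then have k0: "k > 0" by simp
    have len: "length Is = r - 1" using of_degree_validS(2)[OF of m k0] by simp
    have ring: "plprod k n (Is @ [J]) \<in> ring_deg k n lam"
      unfolding ring_deg_def by (rule fs.span_base) (use of in auto)
    have "(\<Sum>A\<in>T. c A * plprod k n (Is @ [J]) A) = pairing k n lam x (plprod k n (Is @ [J]))"
      by (rule pairing_eval[OF x r m T ring, symmetric])
    also have "\<dots> = signS n (dualS n (Is @ [J])) * x (dualS n (Is @ [J]))"
      by (rule pairing_plprod[OF x r m of])
    also have "x (dualS n (Is @ [J])) = peval n r lam x J (dualS n Is)"
      by (rule peval_dualS[OF of _ len r m, symmetric]) (use J in \<open>auto simp: ksubsets_def\<close>)
    finally show ?thesis using pe[OF J] by simp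
  qed
  \<comment> \<open>With \<open>x\<close> expanded in evaluations, being annihilated is a linear
    condition on \<open>f\<close>, so spanning products suffice.\<close>
  have sub: "fs.subspace {f :: complex mat \<Rightarrow> complex. (\<Sum>A\<in>T. c A * f A) = 0}"
    by (auto simp: fs.subspace_def fscale_def distrib_left sum.distrib mult.left_commute simp flip: sum_distrib_left)
  have "fspan (plprod k n ` ?G) \<subseteq> {f. (\<Sum>A\<in>T. c A * f A) = 0}"
    by (rule fs.span_minimal[OF _ sub]) (use gen in auto)
  then have "pairing k n lam x f = 0" if "f \<in> pideal_deg k n M lam" for f
  proof -
    have "f \<in> ring_deg k n lam" using that by (simp add: pideal_deg_def)
    then have "pairing k n lam x f = (\<Sum>A\<in>T. c A * f A)" by (rule pairing_eval[OF x r m T])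
    then show ?thesis using that pideal_deg_subset[of k n M lam] \<open>fspan _ \<subseteq> _\<close> by auto
  qed
  then show "x \<in> annihilator k n r lam M" using x by (simp add: annihilator_def)
next
  fix x assume "x \<in> annihilator k n r lam M"
  then have x: "x \<in> Wspace n r lam" and ann: "\<And>f. f \<in> pideal_deg k n M lam \<Longrightarrow> pairing k n lam x f = 0"
    by (auto simp: annihilator_def)
  have "peval n r lam x J T = 0" if J: "J \<in> ksubsets k n - M" for J T
  proof (cases "(\<exists>i\<in>J. lam i = 0) \<or> \<not> validS n (r - 1) (\<lambda>j. if j \<in> J then lam j - 1 else lam j) T")
    case True
    then show ?thesis by (auto simp: peval_def)
  next
    case False
    let ?S = "\<lambda>j. if j \<in> J then insert (r - 1) (T j) else T j"
    have "x ?S = 0"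
    proof (rule ccontr)
      assume "x ?S \<noteq> 0"
      then obtain Is where Is: "of_degree k n lam Is" "length Is = r" "dualS n Is = ?S"
        by (rule Wspace_nonzero_dual[OF x r m])
      have Jn: "J \<subseteq> {0..<n}" using J by (auto simp: ksubsets_def)
      have "j \<in> Is ! (r - 1) \<longleftrightarrow> j \<in> J" for j
      proof (cases "j < n")
        case True
        have "j \<in> Is ! (r - 1) \<longleftrightarrow> r - 1 \<in> dualS n Is j" using True Is(2) r by (simp add: dualS_def)
        moreover have "r - 1 \<notin> T j" using False True by (fastforce simp: validS_def)
        ultimately show ?thesis unfolding Is(3) by simp
      next
        case f: False
        have "Is ! (r - 1) \<in> ksubsets k n" using Is(1,2) r nth_mem[of "r - 1" Is] by (auto simp: of_degree_def)
        then show ?thesis using f Jn by (auto simp: ksubsets_def)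
      qed
      then have lastJ: "Is ! (r - 1) = J" by blast
      have "Is \<noteq> []" using Is(2) r by auto
      then have "Is = butlast Is @ [J]" using lastJ Is(2) append_butlast_last_id[of Is] by (simp add: last_conv_nth)
      then have "plprod k n Is \<in> pideal_deg k n M lam"
        using plprod_in_pideal_deg[OF J, of lam "butlast Is"] Is(1) by simp
      then have "signS n (dualS n Is) * x (dualS n Is) = 0"
        using ann pairing_plprod[OF x r m Is(1)] by simp
      then have "(signS n (dualS n Is) * signS n (dualS n Is)) * x (dualS n Is) = 0"
        by (simp only: mult.assoc mult_zero_right)
      then show False using \<open>x ?S \<noteq> 0\<close> Is(3) by simp
    qed
    then show ?thesis by (auto simp: peval_def)
  qed
  then show "x \<in> WspaceM k n r lam M" using x by (auto simp: WspaceM_def)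
qed

text \<open>Functionals on a finite-dimensional space of functions are combinations of evaluations.\<close>

lemma evaluation_dual_basis:
  fixes B :: "('a \<Rightarrow> complex) set"
  assumes "finite B" "fs.independent B"
  obtains P \<phi> where "finite P"
    "\<And>b b'. b \<in> B \<Longrightarrow> b' \<in> B \<Longrightarrow> (\<Sum>A\<in>P. \<phi> b A * b' A) = (if b = b' then 1 else 0)"
proof -
  have "\<exists>P \<phi>. finite P \<and> (\<forall>b\<in>B. \<forall>b'\<in>B. (\<Sum>A\<in>P. \<phi> b A * b' A) = (if b = b' then 1 else (0::complex)))"
    using assms
  proof (induction B rule: finite_induct)
    case empty
    then show ?case by auto
  next
    case (insert f B)
    have ind: "fs.independent B" using insert.prems fs.independent_mono by blast
    have fB: "f \<notin> fspan B" using insert.prems insert.hyps(2) by (simp add: fs.independent_insert)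
    obtain P \<phi> where P: "finite P" "\<And>b b'. b \<in> B \<Longrightarrow> b' \<in> B \<Longrightarrow> (\<Sum>A\<in>P. \<phi> b A * b' A) = (if b = b' then 1 else (0::complex))"
      using insert.IH[OF ind] by blast
    define s where "s b = (\<Sum>A\<in>P. \<phi> b A * f A)" for b
    have "\<exists>A. f A \<noteq> (\<Sum>b\<in>B. s b * b A)"
    proof (rule ccontr)
      assume "\<not> ?thesis"
      then have "f \<in> fspan B" by (intro fspan_sumI[OF insert.hyps(1) fs.span_base]) auto
      then show False using fB by simp
    qed
    \<comment> \<open>A point where \<open>f\<close> differs from its projection to the span of
      \<open>B\<close>; it exists because \<open>f\<close> lies outside that span.\<close>
    then obtain X where X: "f X - (\<Sum>b\<in>B. s b * b X) \<noteq> 0" by auto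
    define d where "d = f X - (\<Sum>b\<in>B. s b * b X)"
    define \<epsilon> where "\<epsilon> A = (if A = X then 1 else 0 :: complex)" for A
    \<comment> \<open>Extension by zero, since the new point \<open>X\<close> may or may not belong
      to \<open>P\<close>.\<close>
    define \<phi>' where "\<phi>' b A = (if A \<in> P then \<phi> b A else 0)" for b A
    \<comment> \<open>Evaluation at \<open>X\<close>, corrected to kill \<open>B\<close> and
      normalised to be 1 on \<open>f\<close>. The old functionals are then corrected by multiples of
      it so as to kill \<open>f\<close>.\<close>
    define \<psi> where "\<psi> A = (\<epsilon> A - (\<Sum>b\<in>B. b X * \<phi>' b A)) / d" for A
    define \<chi> where "\<chi> b = (if b = f then \<psi> else (\<lambda>A. \<phi>' b A - s b * \<psi> A))" for b
    let ?P = "insert X P"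
    have finP: "finite ?P" using P by simp
    have e\<phi>: "(\<Sum>A\<in>?P. \<phi>' b A * g A) = (\<Sum>A\<in>P. \<phi> b A * g A)" for b g
    proof -
      have "(\<Sum>A\<in>P. \<phi>' b A * g A) = (\<Sum>A\<in>?P. \<phi>' b A * g A)"
        by (rule sum.mono_neutral_left[OF finP]) (auto simp: \<phi>'_def)
      then show ?thesis by (simp add: \<phi>'_def)
    qed
    have e\<epsilon>: "(\<Sum>A\<in>?P. \<epsilon> A * g A) = g X" for g
    proof -
      have "(\<Sum>A\<in>?P. \<epsilon> A * g A) = (\<Sum>A\<in>?P. if A = X then g X else 0)"
        by (intro sum.cong refl) (simp add: \<epsilon>_def)
      then show ?thesis using finP by simp
    qed
    have e\<psi>: "(\<Sum>A\<in>?P. \<psi> A * g A) = (g X - (\<Sum>b\<in>B. b X * (\<Sum>A\<in>P. \<phi> b A * g A))) / d" for g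
    proof -
      have "(\<Sum>A\<in>?P. \<psi> A * g A) = ((\<Sum>A\<in>?P. \<epsilon> A * g A) - (\<Sum>A\<in>?P. \<Sum>b\<in>B. b X * (\<phi>' b A * g A))) / d"
        unfolding \<psi>_def by (simp only: times_divide_eq_left left_diff_distrib sum_divide_distrib[symmetric]
          sum_subtractf sum_distrib_right mult.assoc)
      also have "(\<Sum>A\<in>?P. \<Sum>b\<in>B. b X * (\<phi>' b A * g A)) = (\<Sum>b\<in>B. b X * (\<Sum>A\<in>?P. \<phi>' b A * g A))"
        unfolding sum_distrib_left by (rule sum.swap)
      finally show ?thesis unfolding e\<epsilon> e\<phi> .
    qed
    have \<psi>B: "(\<Sum>A\<in>?P. \<psi> A * b A) = 0" if "b \<in> B" for b
    proof -
      have "(\<Sum>b'\<in>B. b' X * (\<Sum>A\<in>P. \<phi> b' A * b A)) = (\<Sum>b'\<in>B. if b' = b then b X else 0)"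
        by (intro sum.cong refl) (simp add: P(2) that)
      then show ?thesis unfolding e\<psi> using that insert.hyps(1) by simp
    qed
    have \<psi>f: "(\<Sum>A\<in>?P. \<psi> A * f A) = 1"
      unfolding e\<psi> s_def[symmetric] using X by (simp add: d_def mult.commute)
    have "(\<Sum>A\<in>?P. \<chi> b A * b' A) = (if b = b' then 1 else 0)" if b: "b \<in> insert f B" "b' \<in> insert f B" for b b'
    proof (cases "b = f")
      case True
      then show ?thesis using \<psi>B \<psi>f b insert.hyps(2) by (auto simp: \<chi>_def)
    next
      case False
      then have bB: "b \<in> B" using b by simp
      have "(\<Sum>A\<in>?P. \<chi> b A * b' A) = (\<Sum>A\<in>?P. \<phi>' b A * b' A) - s b * (\<Sum>A\<in>?P. \<psi> A * b' A)"
        using False by (simp only: \<chi>_def if_False left_diff_distrib sum_subtractf sum_distrib_left mult.assoc)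
      also have "\<dots> = (if b = b' then 1 else 0)"
      proof (cases "b' = f")
        case True
        then show ?thesis using False unfolding True e\<phi> \<psi>f s_def by simp
      next
        case b': False
        then have "b' \<in> B" using b by simp
        then show ?thesis unfolding e\<phi> using \<psi>B P(2)[OF bB] by simp
      qed
      finally show ?thesis .
    qed
    then show ?case using finP by blast
  qed
  then show thesis using that by blast
qed

section \<open>The dimension count\<close>

text \<open>A product depends only on its dual list, and there are finitely many valid lists; the
  lists of factors themselves can be infinite in number when \<open>k = 0\<close>.\<close>

lemma ring_deg_finite_span:
  assumes m: "(\<Sum>j<n. lam j) = r * k"
  obtains F where "finite F" "ring_deg k n lam = fspan F"
proof
  let ?F = "{plprod k n Is | Is. of_degree k n lam Is}"
  show "ring_deg k n lam = fspan ?F" by (simp add: ring_deg_def)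
  let ?g = "\<lambda>S A. if A \<in> carrier_mat k n then signS n S * evec k n r lam A S else 0"
  have "?F \<subseteq> ?g ` {S. validS n r lam S}"
  proof clarify
    fix Is assume Is: "of_degree k n lam Is"
    have "plprod k n Is = ?g (dualS n Is)"
    proof
      fix A show "plprod k n Is A = ?g (dualS n Is) A"
        using plprod_eq_evec[OF Is m, of A] by (cases "A \<in> carrier_mat k n") (simp_all add: plprod_def)
    qed
    then show "plprod k n Is \<in> ?g ` {S. validS n r lam S}"
      using of_degree_validS(1)[OF Is m] by blast
  qed
  then show "finite ?F" by (rule finite_subset) simp
qed

text \<open>Extend a basis of the ideal piece to one of the ring piece. The dual functionals are
  combinations of evaluations, hence pairings with invariants, and those belonging to the added
  basis vectors form a basis of the annihilator.\<close>

lemma dim_annihilator: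
  assumes r: "r > 0" and m: "(\<Sum>j<n. lam j) = r * k"
  shows "fdim (annihilator k n r lam M) = fdim (ring_deg k n lam) - fdim (pideal_deg k n M lam)"
proof -
  let ?W = "Wspace n r lam" and ?R = "ring_deg k n lam" and ?Q = "pideal_deg k n M lam"
  let ?p = "pairing k n lam"
  let ?A = "annihilator k n r lam M"
  have QR: "?Q \<subseteq> ?R" by (auto simp: pideal_deg_def)
  obtain BQ where BQ: "BQ \<subseteq> ?Q" "fs.independent BQ" "?Q \<subseteq> fspan BQ"
    by (rule fs.maximal_independent_subset)
  obtain BR where BR: "BQ \<subseteq> BR" "BR \<subseteq> ?R" "fs.independent BR" "?R \<subseteq> fspan BR"
    using fs.maximal_independent_subset_extend[of BQ ?R] BQ QR by blast
  obtain F where F: "finite F" "?R = fspan F" by (rule ring_deg_finite_span[OF m])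
  have finBR: "finite BR" using fs.independent_span_bound[OF F(1) BR(3)] BR(2) F(2) by blast
  have dR: "fdim ?R = card BR" by (rule fs.dim_unique[OF BR(2,4,3) refl])
  have dQ: "fdim ?Q = card BQ" by (rule fs.dim_unique[OF BQ(1,3,2) refl])
  obtain P \<phi> where P: "finite P"
    "\<And>b b'. b \<in> BR \<Longrightarrow> b' \<in> BR \<Longrightarrow> (\<Sum>A\<in>P. \<phi> b A * b' A) = (if b = b' then 1 else 0)"
    using evaluation_dual_basis[OF finBR BR(3)] by blast
  \<comment> \<open>Points that are not \<open>k \<times> n\<close> matrices may be dropped, because
    all functions of the graded piece vanish there.\<close>
  define P' where "P' = P \<inter> carrier_mat k n"
  define y where "y b = (\<lambda>S. \<Sum>A\<in>P'. \<phi> b A * evec k n r lam A S)" for b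
  have P': "finite P'" "P' \<subseteq> carrier_mat k n" using P(1) by (auto simp: P'_def)
  have yW: "y b \<in> ?W" for b
    unfolding Wspace_eq_span[OF r m]
    by (rule fspan_sumI[OF P'(1), where F = "evec k n r lam"]) (use P'(2) in \<open>auto simp: y_def intro!: fs.span_base\<close>)
  have off: "f A = 0" if f: "f \<in> ?R" and A: "A \<notin> carrier_mat k n" for f A
  proof -
    obtain gs where "f = (\<lambda>A. \<Sum>(a, Is)\<leftarrow>gs. a * plprod k n Is A)" by (rule ring_degE[OF f])
    moreover have "(\<Sum>(a, Is)\<leftarrow>gs. a * plprod k n Is A) = 0" using A by (induction gs) (auto simp: plprod_def)
    ultimately show ?thesis by simp
  qed
  have y_ev: "?p (y b) f = (\<Sum>A\<in>P. \<phi> b A * f A)" if f: "f \<in> ?R" for b f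
  proof -
    have "?p (y b) f = (\<Sum>A\<in>P'. \<phi> b A * f A)"
      by (rule pairing_eval[OF yW r m P' _ f]) (simp add: y_def)
    also have "\<dots> = (\<Sum>A\<in>P. \<phi> b A * f A)"
      unfolding P'_def by (rule sum.mono_neutral_left[OF P(1)]) (auto simp: off[OF f])
    finally show ?thesis .
  qed
  have y_dual: "?p (y b) b' = (if b = b' then 1 else 0)" if "b \<in> BR" "b' \<in> BR" for b b'
    using y_ev[of b' b] P(2)[OF that] BR(2) that by auto
  have lin: "?p (\<lambda>S. \<Sum>i\<in>I. c i * z i S) f = (\<Sum>i\<in>I. c i * ?p (z i) f)"
    if "finite I" "\<And>i. i \<in> I \<Longrightarrow> z i \<in> ?W" and f: "f \<in> ?R" for I c z f
  proof -
    obtain gs where gs: "\<forall>(a, Is)\<in>set gs. of_degree k n lam Is" "f = (\<lambda>A. \<Sum>(a, Is)\<leftarrow>gs. a * plprod k n Is A)"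
      by (rule ring_degE[OF f])
    have W: "(\<lambda>S. \<Sum>i\<in>I. c i * z i S) \<in> ?W"
      unfolding Wspace_eq_span[OF r m]
      by (rule fspan_sumI[OF that(1), where F = z]) (use that(2) Wspace_eq_span[OF r m] in auto)
    have "?p (\<lambda>S. \<Sum>i\<in>I. c i * z i S) f = (\<Sum>(a, Is)\<leftarrow>gs. a * signS n (dualS n Is) * (\<Sum>i\<in>I. c i * z i (dualS n Is)))"
      unfolding gs(2) by (rule pairing_list[OF W r m gs(1)])
    also have "\<dots> = (\<Sum>i\<in>I. c i * (\<Sum>(a, Is)\<leftarrow>gs. a * signS n (dualS n Is) * z i (dualS n Is)))"
      by (induction gs) (auto simp: sum_distrib_left distrib_left sum.distrib mult_ac)
    also have "\<dots> = (\<Sum>i\<in>I. c i * ?p (z i) f)"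
      unfolding gs(2) by (intro sum.cong refl) (simp add: pairing_list[OF that(2) r m gs(1)])
    finally show ?thesis .
  qed
  have lin2: "?p z f = 0" if z: "z \<in> ?W" and f: "f \<in> fspan B" and B: "B \<subseteq> ?R" "\<And>b. b \<in> B \<Longrightarrow> ?p z b = 0" for z f B
  proof -
    obtain T c where T: "finite T" "T \<subseteq> carrier_mat k n" "z = (\<lambda>S. \<Sum>A\<in>T. c A * evec k n r lam A S)"
      by (rule WspaceE[OF z r m])
    have sub: "fs.subspace {f :: complex mat \<Rightarrow> complex. (\<Sum>A\<in>T. c A * f A) = 0}"
      by (auto simp: fs.subspace_def fscale_def distrib_left sum.distrib mult.left_commute simp flip: sum_distrib_left)
    have "fspan B \<subseteq> {f. (\<Sum>A\<in>T. c A * f A) = 0}"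
    proof (rule fs.span_minimal[OF _ sub], rule subsetI)
      fix b assume b: "b \<in> B"
      then have "b \<in> ?R" using B(1) by blast
      then show "b \<in> {f. (\<Sum>A\<in>T. c A * f A) = 0}" using pairing_eval[OF z r m T, of b] B(2)[OF b] by simp
    qed
    moreover have "f \<in> ?R" using f fs.span_minimal[OF B(1)] by (auto simp: ring_deg_def)
    ultimately show ?thesis using pairing_eval[OF z r m T] f by auto
  qed
  let ?B = "BR - BQ"
  have finB: "finite ?B" using finBR by simp
  have yA: "y b \<in> ?A" if b: "b \<in> ?B" for b
  proof -
    have "?p (y b) f = 0" if "f \<in> ?Q" for f
    proof (rule lin2[OF yW])
      show "f \<in> fspan BQ" using that BQ(3) by blast
      show "?p (y b) b' = 0" if "b' \<in> BQ" for b'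
        using y_dual[of b b'] b that BR(1) by auto
    qed (use BQ(1) QR in blast)
    then show ?thesis using yW by (simp add: annihilator_def)
  qed
  \<comment> \<open>Nondegeneracy on the side of the invariants: a nonzero coordinate is, up to
    sign, the pairing with the product dual to it.\<close>
  have zero: "z = (\<lambda>_. 0)" if z: "z \<in> ?W" and "\<And>b. b \<in> BR \<Longrightarrow> ?p z b = 0" for z
  proof
    fix S show "z S = 0"
    proof (rule ccontr)
      assume "z S \<noteq> 0"
      then obtain Is where Is: "of_degree k n lam Is" "dualS n Is = S"
        using Wspace_nonzero_dual[OF z r m] by metis
      have "plprod k n Is \<in> ?R" unfolding ring_deg_def by (rule fs.span_base) (use Is in auto)
      then have "?p z (plprod k n Is) = 0" using lin2[OF z _ BR(2)] that(2) BR(4) by blast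
      then have "signS n S * z S = 0" using pairing_plprod[OF z r m Is(1)] Is(2) by simp
      then have "(signS n S * signS n S) * z S = 0" by (simp only: mult.assoc mult_zero_right)
      then show False using \<open>z S \<noteq> 0\<close> by simp
    qed
  qed
  have inj: "inj_on y ?B"
  proof (rule inj_onI)
    fix b b' assume b: "b \<in> ?B" "b' \<in> ?B" "y b = y b'"
    then have "?p (y b') b = 1" using y_dual[of b b] by auto
    then show "b = b'" using y_dual[of b' b] b by (auto split: if_splits)
  qed
  have ind: "fs.independent (y ` ?B)"
  proof
    assume "fs.dependent (y ` ?B)"
    then obtain b where b: "b \<in> ?B" "y b \<in> fspan (y ` ?B - {y b})" unfolding fs.dependent_def by blast
    have "y ` ?B - {y b} = y ` (?B - {b})" using inj b(1) by (auto simp: inj_on_def)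
    then have "y b \<in> fspan (y ` (?B - {b}))" using b(2) by simp
    then obtain T c where T: "finite T" "T \<subseteq> ?B - {b}" "y b = (\<lambda>S. \<Sum>t\<in>T. c t * y t S)"
      by (rule fspan_imageE)
    have "?p (y b) b = (\<Sum>t\<in>T. c t * ?p (y t) b)"
      by (subst T(3), rule lin[OF T(1) yW]) (use b BR(2) in auto)
    also have "\<dots> = 0" using T(2) b(1) by (intro sum.neutral) (auto simp: y_dual subset_iff)
    finally show False using y_dual[of b b] b(1) by simp
  qed
  have span: "?A \<subseteq> fspan (y ` ?B)"
  proof
    fix x assume "x \<in> ?A"
    then have x: "x \<in> ?W" and ann: "\<And>f. f \<in> ?Q \<Longrightarrow> ?p x f = 0" by (auto simp: annihilator_def)
    \<comment> \<open>The expansion of \<open>x\<close> in the dual family; no terms from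
      \<open>BQ\<close> appear because \<open>x\<close> annihilates the ideal piece.\<close>
    let ?x' = "\<lambda>S. \<Sum>b\<in>?B. ?p x b * y b S"
    have x'W: "?x' \<in> ?W"
      unfolding Wspace_eq_span[OF r m]
      by (rule fspan_sumI[OF finB, where F = y]) (use yW Wspace_eq_span[OF r m] in auto)
    have dW: "(\<lambda>S. x S - ?x' S) \<in> ?W"
      using fs.subspace_diff[OF subspace_Wspace x x'W] by (simp add: fun_diff_def)
    have "?p (\<lambda>S. x S - ?x' S) b' = 0" if b': "b' \<in> BR" for b'
    proof -
      have b'R: "b' \<in> ?R" using b' BR(2) by blast
      \<comment> \<open>The difference is written as a two-term combination so that
        \<open>lin\<close> applies to it.\<close>
      have "?p (\<lambda>S. \<Sum>i\<in>{False, True}. (if i then 1 else - 1) * (if i then x else ?x') S) b'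
        = (\<Sum>i\<in>{False, True}. (if i then 1 else - 1) * ?p (if i then x else ?x') b')"
        by (rule lin[OF _ _ b'R]) (use x x'W in auto)
      then have "?p (\<lambda>S. x S - ?x' S) b' = ?p x b' - ?p ?x' b'" by simp
      also have "?p ?x' b' = (\<Sum>b\<in>?B. ?p x b * ?p (y b) b')" by (rule lin[OF finB yW b'R])
      also have "\<dots> = (\<Sum>b\<in>?B. if b = b' then ?p x b' else 0)"
        by (intro sum.cong refl) (use y_dual b' in auto)
      also have "\<dots> = ?p x b'" using finB ann BQ(1) b' by auto
      finally show ?thesis by simp
    qed
    then have "(\<lambda>S. x S - ?x' S) = (\<lambda>_. 0)" by (rule zero[OF dW])
    then have x_eq: "x S = ?x' S" for S by (simp add: fun_eq_iff)
    show "x \<in> fspan (y ` ?B)"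
    proof (rule fspan_sumI[OF finB _ x_eq])
      show "y b \<in> fspan (y ` ?B)" if "b \<in> ?B" for b by (rule fs.span_base) (use that in blast)
    qed
  qed
  have "fdim ?A = card (y ` ?B)" by (rule fs.dim_unique[OF _ span ind refl]) (use yA in blast)
  also have "\<dots> = card BR - card BQ"
    using card_image[OF inj] card_Diff_subset[OF finite_subset[OF BR(1) finBR] BR(1)] by simp
  finally show ?thesis using dR dQ by simp
qed

theorem mainTheorem9:
  fixes k n r :: nat and lam :: "nat \<Rightarrow> nat" and M :: "nat set set"
  assumes "positroid k n M"
    and "r \<ge> 1"
    and "\<forall>i<n. lam i \<le> r"
    and "(\<Sum>i<n. lam i) = k * r"
  shows "WspaceM k n r lam M = annihilator k n r lam M
     \<and> fdim (WspaceM k n r lam M) = positroid_ring_deg_dim k n M lam"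
proof -
  have r: "r > 0" and m: "(\<Sum>i<n. lam i) = r * k" using assms by (auto simp: mult.commute)
  \<comment> \<open>A positroid has at least one basis; for \<open>k = 0\<close> the only candidate
    is the empty set, so no subset lies outside \<open>M\<close>.\<close>
  have "ksubsets 0 n = {{}}" by (auto simp: ksubsets_def dest: finite_subset)
  then have "ksubsets k n - M = {}" if "k = 0"
    using assms(1) that unfolding positroid_def by auto
  then have "WspaceM k n r lam M = annihilator k n r lam M" by (rule WspaceM_eq_annihilator[OF r m])
  then show ?thesis using dim_annihilator[OF r m] by (simp add: positroid_ring_deg_dim_def)
qed

end
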